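(* Let $q$ be a prime power, $n,d\ge 1$ integers, and let $\sigma$ be an automorphism of $\mathbb{F}_{q^n}$ whose fixed field is $\mathbb{F}_q$. The number of isotopism classes of semifields $\mathbb{S}_f$ of order $q^{nd}$ obtained from irreducible elements $f$ of degree $d$ in $\mathbb{F}_{q^n}[t;\sigma]$ is less than or equal to the number of $G$-orbits on $I(q,d)$.
   Context: $\mathbb{F}_{q^n}[t;\sigma]$ is the skew polynomial ring: polynomials in $t$ with (left) coefficients in $\mathbb{F}_{q^n}$, termwise addition, and multiplication determined by $ta=a^{\sigma}t$ for $a\in\mathbb{F}_{q^n}$. An element $f$ of positive degree is irreducible if there are no $a,b$ with $\deg(a),\deg(b)<\deg(f)$ and $f=ab$. For $f\neq0$ every $a$ can be written uniquely as $a=uf+v$ with $\deg(v)<\deg(f)$; write $v=a\bmod f$. For $f$ irreducible of degree $d$, $\mathbb{S}_f=(V,\circ_f)$ is the semifield on the set $V$ of elements of degree less than $d$ with $a\circ_f b:=ab\bmod f$. Two semifields $(\mathbb{S},\circ)$, $(\hat{\mathbb{S}},\hat\circ)$ are isotopic if there is a triple $(F,G,H)$ of bijective additive (linear over the prime field) maps $\mathbb{S}\to\hat{\mathbb{S}}$ with $x^F\,\hat\circ\, y^G=(x\circ y)^H$ for all $x,y$. $I(q,d)$ is the set of monic irreducible polynomials of degree $d$ in the ordinary polynomial ring $\mathbb{F}_q[y]$. $G=\Gamma L(1,q)$ is the semidirect product of $\mathbb{F}_q^{\times}$ and $\mathrm{Aut}(\mathbb{F}_q)$, with elements $(\lambda,\rho)$,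 $\lambda\in\mathbb{F}_q^\times$, $\rho\in\mathrm{Aut}(\mathbb{F}_q)$, acting on $I(q,d)$ by $f^{(\lambda,\rho)}(y):=\lambda^{-d}f^{\rho}(\lambda y)$, where $f^\rho$ is obtained by applying $\rho$ to the coefficients of $f$. *)

theory Defs
  imports
    "HOL-Library.Cardinality"
    "HOL-Computational_Algebra.Computational_Algebra"
    "HOL-Number_Theory.Prime_Powers"
    "HOL-Algebra.Ring"
    "HOL-Algebra.Group_Action"
begin

section \<open>Field automorphisms\<close>

definition field_aut :: "('a::field \<Rightarrow> 'a) \<Rightarrow> bool" where
  "field_aut \<sigma> \<longleftrightarrow> bij \<sigma> \<and> (\<forall>x y. \<sigma> (x + y) = \<sigma> x + \<sigma> y) \<and> (\<forall>x y. \<sigma> (x * y) = \<sigma> x * \<sigma> y)"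

definition fixed_field :: "('a::field \<Rightarrow> 'a) \<Rightarrow> 'a set" where
  "fixed_field \<sigma> = {x. \<sigma> x = x}"

lemma field_aut_bij: "field_aut \<sigma> \<Longrightarrow> bij \<sigma>"
  and field_aut_add: "field_aut \<sigma> \<Longrightarrow> \<sigma> (x + y) = \<sigma> x + \<sigma> y"
  and field_aut_mult: "field_aut \<sigma> \<Longrightarrow> \<sigma> (x * y) = \<sigma> x * \<sigma> y"
  by (auto simp: field_aut_def)

lemma field_aut_0: "field_aut \<sigma> \<Longrightarrow> \<sigma> 0 = 0"
  by (metis add_cancel_right_right field_aut_add)

lemma field_aut_eq_0_iff: "field_aut \<sigma> \<Longrightarrow> \<sigma> x = 0 \<longleftrightarrow> x = 0"
  using field_aut_bij[of \<sigma>] field_aut_0[of \<sigma>] by (metis bij_pointE)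

lemma field_aut_1: "field_aut \<sigma> \<Longrightarrow> \<sigma> 1 = 1"
  using field_aut_mult[of \<sigma> 1 1] field_aut_eq_0_iff[of \<sigma> 1] by simp

lemma field_aut_power: "field_aut \<sigma> \<Longrightarrow> \<sigma> (x ^ k) = \<sigma> x ^ k"
  by (induction k) (simp_all add: field_aut_1 field_aut_mult)

lemma field_aut_id: "field_aut id"
  by (simp add: field_aut_def)

lemma field_aut_comp: "field_aut \<sigma> \<Longrightarrow> field_aut \<tau> \<Longrightarrow> field_aut (\<sigma> \<circ> \<tau>)"
  by (auto simp: field_aut_def bij_comp)

lemma field_aut_funpow: "field_aut \<sigma> \<Longrightarrow> field_aut (\<sigma> ^^ i)"
  by (induction i) (simp_all add: field_aut_comp field_aut_id)

lemma field_aut_sum: "field_aut \<sigma> \<Longrightarrow> \<sigma> (sum f A) = (\<Sum>i\<in>A. \<sigma> (f i))"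
  by (induction A rule: infinite_finite_induct) (auto simp: field_aut_0 field_aut_add)

lemma field_aut_inv:
  assumes "field_aut \<sigma>" shows "field_aut (inv_into UNIV \<sigma>)"
proof -
  have b: "bij \<sigma>" using assms by (rule field_aut_bij)
  have s: "\<sigma> (inv_into UNIV \<sigma> x) = x" for x
    using bij_is_surj[OF b] by (rule surj_f_inv_f)
  have "inv_into UNIV \<sigma> (x + y) = inv_into UNIV \<sigma> x + inv_into UNIV \<sigma> y"
    "inv_into UNIV \<sigma> (x * y) = inv_into UNIV \<sigma> x * inv_into UNIV \<sigma> y" for x y
    by (rule injD[OF bij_is_inj[OF b]], simp add: s field_aut_add[OF assms] field_aut_mult[OF assms])+
  then show ?thesis using b by (simp add: field_aut_def bij_imp_bij_inv)
qed


section \<open>Skew polynomials\<close>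

text \<open>
  A polynomial \<open>[:a\<^sub>0, \<dots>, a\<^sub>m:]\<close> stands for the skew polynomial
  \<open>a\<^sub>0 + a\<^sub>1 t + \<dots> + a\<^sub>m t\<^sup>m\<close> with left coefficients. Since \<open>t a = \<sigma>(a) t\<close>,
  the product of \<open>a t\<^sup>i\<close> and \<open>b t\<^sup>j\<close> is \<open>a \<sigma>\<^sup>i(b) t\<^bsup>i+j\<^esup>\<close>. The product \<open>*\<close> of the
  type of polynomials is the commutative one and plays no role here.
\<close>

definition skew_mult :: "('a::field \<Rightarrow> 'a) \<Rightarrow> 'a poly \<Rightarrow> 'a poly \<Rightarrow> 'a poly" where
  "skew_mult \<sigma> a b =
     (\<Sum>i\<le>degree a. \<Sum>j\<le>degree b. monom (coeff a i * (\<sigma> ^^ i) (coeff b j)) (i + j))"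

definition skew_poly_ring :: "('a::field \<Rightarrow> 'a) \<Rightarrow> 'a poly ring" where
  "skew_poly_ring \<sigma> = \<lparr>carrier = UNIV, mult = skew_mult \<sigma>, one = 1, zero = 0, add = (+)\<rparr>"

definition skew_irreducible :: "('a::field \<Rightarrow> 'a) \<Rightarrow> 'a poly \<Rightarrow> bool" where
  "skew_irreducible \<sigma> f \<longleftrightarrow> degree f > 0 \<and>
     \<not> (\<exists>a b. degree a < degree f \<and> degree b < degree f \<and> f = skew_mult \<sigma> a b)"

text \<open>
  The disjunct \<open>v = 0\<close> is needed because \<open>degree 0 = 0\<close> in the library, so that
  \<open>degree v < degree f\<close> fails for \<open>v = 0\<close> and constant \<open>f\<close>.
\<close>

definition skew_mod :: "('a::field \<Rightarrow> 'a) \<Rightarrow> 'a poly \<Rightarrow> 'a poly \<Rightarrow> 'a poly" where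
  "skew_mod \<sigma> a f =
     (THE v. (v = 0 \<or> degree v < degree f) \<and> (\<exists>u. a = skew_mult \<sigma> u f + v))"

definition skew_semifield :: "('a::field \<Rightarrow> 'a) \<Rightarrow> 'a poly \<Rightarrow> 'a poly ring" where
  "skew_semifield \<sigma> f =
     \<lparr>carrier = {a. a = 0 \<or> degree a < degree f},
      mult = (\<lambda>a b. skew_mod \<sigma> (skew_mult \<sigma> a b) f),
      one = 1, zero = 0, add = (+)\<rparr>"


section \<open>Isotopism\<close>

text \<open>Additive maps are the same as maps linear over the prime field.\<close>

definition additive_bij :: "('a, 'm) ring_scheme \<Rightarrow> ('b, 'n) ring_scheme \<Rightarrow> ('a \<Rightarrow> 'b) \<Rightarrow> bool" where
  "additive_bij S T F \<longleftrightarrow> bij_betw F (carrier S) (carrier T) \<and>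
     (\<forall>x\<in>carrier S. \<forall>y\<in>carrier S. F (x \<oplus>\<^bsub>S\<^esub> y) = F x \<oplus>\<^bsub>T\<^esub> F y)"

definition isotopic :: "('a, 'm) ring_scheme \<Rightarrow> ('b, 'n) ring_scheme \<Rightarrow> bool" where
  "isotopic S T \<longleftrightarrow> (\<exists>F G H. additive_bij S T F \<and> additive_bij S T G \<and> additive_bij S T H \<and>
     (\<forall>x\<in>carrier S. \<forall>y\<in>carrier S. F x \<otimes>\<^bsub>T\<^esub> G y = H (x \<otimes>\<^bsub>S\<^esub> y)))"

definition isotopism_classes :: "('a, 'm) ring_scheme set \<Rightarrow> ('a, 'm) ring_scheme set set" where
  "isotopism_classes \<S> = \<S> // {(S, T). S \<in> \<S> \<and> T \<in> \<S> \<and> isotopic S T}"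

definition skew_semifields :: "('a::field \<Rightarrow> 'a) \<Rightarrow> nat \<Rightarrow> 'a poly ring set" where
  "skew_semifields \<sigma> d = skew_semifield \<sigma> ` {f. skew_irreducible \<sigma> f \<and> degree f = d}"


section \<open>The action of \<open>\<Gamma>L(1, q)\<close>\<close>

definition monic_irreducibles :: "nat \<Rightarrow> 'b::field poly set" where
  "monic_irreducibles d = {f. lead_coeff f = 1 \<and> irreducible f \<and> degree f = d}"

text \<open>The pair \<open>(c, \<rho>)\<close> corresponds to the semilinear map \<open>x \<mapsto> c \<rho>(x)\<close>.\<close>

definition GammaL1 :: "('b::field \<times> ('b \<Rightarrow> 'b)) monoid" where
  "GammaL1 =
     \<lparr>carrier = {(c, \<rho>). c \<noteq> 0 \<and> field_aut \<rho>},
      mult = (\<lambda>(c, \<rho>) (\<mu>, \<tau>). (c * \<rho> \<mu>, \<rho> \<circ> \<tau>)),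
      one = (1, id)\<rparr>"

definition GammaL1_act :: "nat \<Rightarrow> 'b::field \<times> ('b \<Rightarrow> 'b) \<Rightarrow> 'b poly \<Rightarrow> 'b poly" where
  "GammaL1_act d = (\<lambda>(c, \<rho>). \<lambda>f\<in>monic_irreducibles d.
     smult (inverse (c ^ d)) (pcompose (map_poly \<rho> f) [:0, c:]))"


section \<open>Well-definedness\<close>

lemma coeff_skew_mult:
  assumes \<sigma>: "field_aut \<sigma>"
  shows "coeff (skew_mult \<sigma> a b) k = (\<Sum>i\<le>k. coeff a i * (\<sigma> ^^ i) (coeff b (k - i)))"
proof -
  have z: "(\<sigma> ^^ i) 0 = 0" for i using field_aut_0[OF field_aut_funpow[OF \<sigma>]] .
  have inner: "(\<Sum>j\<le>degree b. if i + j = k then coeff a i * (\<sigma> ^^ i) (coeff b j) else 0)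
      = (if i \<le> k then coeff a i * (\<sigma> ^^ i) (coeff b (k - i)) else 0)" for i
  proof (cases "i \<le> k")
    case True
    have "(\<Sum>j\<le>degree b. if i + j = k then coeff a i * (\<sigma> ^^ i) (coeff b j) else 0)
        = (\<Sum>j\<le>degree b. if k - i = j then coeff a i * (\<sigma> ^^ i) (coeff b j) else 0)"
      using True by (intro sum.cong) auto
    also have "\<dots> = (if k - i \<le> degree b then coeff a i * (\<sigma> ^^ i) (coeff b (k - i)) else 0)"
      by simp
    also have "\<dots> = coeff a i * (\<sigma> ^^ i) (coeff b (k - i))"
      using z by (simp add: coeff_eq_0)
    finally show ?thesis using True by simp
  qed (auto intro!: sum.neutral)
  have "coeff (skew_mult \<sigma> a b) k =
      (\<Sum>i\<le>degree a. if i \<le> k then coeff a i * (\<sigma> ^^ i) (coeff b (k - i)) else 0)"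
    by (simp add: skew_mult_def coeff_sum inner)
  also have "\<dots> = (\<Sum>i\<in>{..degree a} \<inter> {..k}. coeff a i * (\<sigma> ^^ i) (coeff b (k - i)))"
    by (simp only: sum.inter_restrict[OF finite_atMost] atMost_iff)
  also have "\<dots> = (\<Sum>i\<le>k. coeff a i * (\<sigma> ^^ i) (coeff b (k - i)))"
    by (rule sum.mono_neutral_left) (auto simp: coeff_eq_0)
  finally show ?thesis .
qed

lemma skew_mult_add_left:
  "field_aut \<sigma> \<Longrightarrow> skew_mult \<sigma> (a + b) c = skew_mult \<sigma> a c + skew_mult \<sigma> b c"
  by (simp add: poly_eq_iff coeff_skew_mult algebra_simps sum.distrib)

lemma skew_mult_add_right:
  "field_aut \<sigma> \<Longrightarrow> skew_mult \<sigma> a (b + c) = skew_mult \<sigma> a b + skew_mult \<sigma> a c"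
  by (simp add: poly_eq_iff coeff_skew_mult algebra_simps sum.distrib
      field_aut_add[OF field_aut_funpow])

lemma skew_mult_0_left: "field_aut \<sigma> \<Longrightarrow> skew_mult \<sigma> 0 a = 0"
  by (simp add: poly_eq_iff coeff_skew_mult)

lemma skew_mult_minus_left: "field_aut \<sigma> \<Longrightarrow> skew_mult \<sigma> (- a) c = - skew_mult \<sigma> a c"
  by (simp add: poly_eq_iff coeff_skew_mult sum_negf)

lemma skew_mult_diff_left:
  "field_aut \<sigma> \<Longrightarrow> skew_mult \<sigma> (a - b) c = skew_mult \<sigma> a c - skew_mult \<sigma> b c"
  using skew_mult_add_left[of \<sigma> a "- b" c] skew_mult_minus_left[of \<sigma> b c] by simp

lemma skew_mult_1_left:
  assumes "field_aut \<sigma>" shows "skew_mult \<sigma> 1 a = a"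
proof (rule poly_eqI)
  fix k
  have "coeff (skew_mult \<sigma> 1 a) k = (\<Sum>i\<le>k. if i = 0 then coeff a k else 0)"
    unfolding coeff_skew_mult[OF assms] by (intro sum.cong) auto
  then show "coeff (skew_mult \<sigma> 1 a) k = coeff a k" by simp
qed

lemma skew_mult_1_right:
  assumes "field_aut \<sigma>" shows "skew_mult \<sigma> a 1 = a"
proof (rule poly_eqI)
  fix k
  have "coeff (skew_mult \<sigma> a 1) k = (\<Sum>i\<le>k. if i = k then coeff a k else 0)"
    unfolding coeff_skew_mult[OF assms]
    by (intro sum.cong)
      (auto simp: field_aut_0[OF field_aut_funpow[OF assms]] field_aut_1[OF field_aut_funpow[OF assms]])
  then show "coeff (skew_mult \<sigma> a 1) k = coeff a k" by simp
qed

lemma skew_mult_assoc: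
  assumes \<sigma>: "field_aut \<sigma>"
  shows "skew_mult \<sigma> (skew_mult \<sigma> a b) c = skew_mult \<sigma> a (skew_mult \<sigma> b c)"
proof (rule poly_eqI)
  fix k
  note f = field_aut_funpow[OF \<sigma>]
  let ?g = "\<lambda>i j. coeff a i * (\<sigma> ^^ i) (coeff b j) * (\<sigma> ^^ (i + j)) (coeff c (k - i - j))"
  have "coeff (skew_mult \<sigma> (skew_mult \<sigma> a b) c) k = (\<Sum>m\<le>k. \<Sum>i\<le>m. ?g i (m - i))"
    by (auto simp: coeff_skew_mult[OF \<sigma>] sum_distrib_right intro!: sum.cong)
  also have "\<dots> = (\<Sum>(i,j)\<in>{(i,j). i + j \<le> k}. ?g i j)"
    by (rule sum.triangle_reindex_eq[symmetric])
  also have "{(i,j). i + j \<le> k} = (SIGMA i:{..k}. {..k - i})" by auto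
  also have "(\<Sum>(i,j)\<in>(SIGMA i:{..k}. {..k - i}). ?g i j) = (\<Sum>i\<le>k. \<Sum>j\<le>k - i. ?g i j)"
    by (rule sum.Sigma[symmetric]) auto
  also have "\<dots> = coeff (skew_mult \<sigma> a (skew_mult \<sigma> b c)) k"
    by (auto simp: coeff_skew_mult[OF \<sigma>] sum_distrib_left field_aut_sum[OF f]
        field_aut_mult[OF f] funpow_add mult.assoc intro!: sum.cong)
  finally show "coeff (skew_mult \<sigma> (skew_mult \<sigma> a b) c) k
      = coeff (skew_mult \<sigma> a (skew_mult \<sigma> b c)) k" .
qed

theorem skew_poly_ring:
  assumes \<sigma>: "field_aut \<sigma>" shows "ring (skew_poly_ring \<sigma>)"
proof (rule ringI)
  show "abelian_group (skew_poly_ring \<sigma>)"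
  proof (rule abelian_groupI)
    fix x assume "x \<in> carrier (skew_poly_ring \<sigma>)"
    show "\<exists>y\<in>carrier (skew_poly_ring \<sigma>). y \<oplus>\<^bsub>skew_poly_ring \<sigma>\<^esub> x = \<zero>\<^bsub>skew_poly_ring \<sigma>\<^esub>"
      by (rule bexI[of _ "- x"]) (simp_all add: skew_poly_ring_def)
  qed (simp_all add: skew_poly_ring_def add_ac)
  show "Group.monoid (skew_poly_ring \<sigma>)"
    by (rule monoidI)
      (simp_all add: skew_poly_ring_def skew_mult_assoc[OF \<sigma>] skew_mult_1_left[OF \<sigma>]
        skew_mult_1_right[OF \<sigma>])
qed (simp_all add: skew_poly_ring_def skew_mult_add_left[OF \<sigma>] skew_mult_add_right[OF \<sigma>])

lemma skew_mult_monom: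
  assumes \<sigma>: "field_aut \<sigma>"
  shows "skew_mult \<sigma> (monom a i) (monom b j) = monom (a * (\<sigma> ^^ i) b) (i + j)"
proof (rule poly_eqI)
  fix k
  note z = field_aut_0[OF field_aut_funpow[OF \<sigma>]]
  have "coeff (skew_mult \<sigma> (monom a i) (monom b j)) k =
      (\<Sum>m\<le>k. if m = i then (if k = i + j then a * (\<sigma> ^^ i) b else 0) else 0)"
    unfolding coeff_skew_mult[OF \<sigma>] by (intro sum.cong) (auto simp: z)
  then show "coeff (skew_mult \<sigma> (monom a i) (monom b j)) k
      = coeff (monom (a * (\<sigma> ^^ i) b) (i + j)) k"
    by auto
qed

lemma skew_mult_t:
  assumes "field_aut \<sigma>"
  shows "skew_mult \<sigma> (monom 1 1) [:a:] = skew_mult \<sigma> [:\<sigma> a:] (monom 1 1)"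
  unfolding monom_0[symmetric] skew_mult_monom[OF assms] by simp

lemma
  assumes \<sigma>: "field_aut \<sigma>"
  shows skew_mult_degree_le: "degree (skew_mult \<sigma> a b) \<le> degree a + degree b"
    and coeff_skew_mult_top: "coeff (skew_mult \<sigma> a b) (degree a + degree b) =
      lead_coeff a * (\<sigma> ^^ degree a) (lead_coeff b)"
proof -
  note z = field_aut_0[OF field_aut_funpow[OF \<sigma>]]
  have z': "coeff a i * (\<sigma> ^^ i) (coeff b (k - i)) = 0"
    if "degree a + degree b \<le> k" "i \<le> k" "i \<noteq> degree a \<or> k \<noteq> degree a + degree b" for i k
  proof (cases "i > degree a")
    case False
    then have "k - i > degree b" using that by linarith
    then show ?thesis by (simp add: coeff_eq_0 z)
  qed (simp add: coeff_eq_0)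
  show "degree (skew_mult \<sigma> a b) \<le> degree a + degree b"
    by (rule degree_le) (auto simp: coeff_skew_mult[OF \<sigma>] z' intro!: sum.neutral)
  have "coeff (skew_mult \<sigma> a b) (degree a + degree b) =
      (\<Sum>i\<in>{degree a}. coeff a i * (\<sigma> ^^ i) (coeff b (degree a + degree b - i)))"
    unfolding coeff_skew_mult[OF \<sigma>] by (rule sum.mono_neutral_right) (auto simp: z')
  then show "coeff (skew_mult \<sigma> a b) (degree a + degree b) =
      lead_coeff a * (\<sigma> ^^ degree a) (lead_coeff b)" by simp
qed

lemma skew_mult_degree_eq:
  assumes "field_aut \<sigma>" "a \<noteq> 0" "b \<noteq> 0"
  shows "degree (skew_mult \<sigma> a b) = degree a + degree b" "skew_mult \<sigma> a b \<noteq> 0"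
proof -
  have "coeff (skew_mult \<sigma> a b) (degree a + degree b) \<noteq> 0"
    using assms by (simp add: coeff_skew_mult_top field_aut_eq_0_iff[OF field_aut_funpow])
  then show "degree (skew_mult \<sigma> a b) = degree a + degree b" "skew_mult \<sigma> a b \<noteq> 0"
    using skew_mult_degree_le[OF assms(1), of a b] le_degree[of "skew_mult \<sigma> a b"]
    by (auto intro: antisym)
qed

lemma skew_division_exists:
  assumes \<sigma>: "field_aut \<sigma>" and f: "f \<noteq> 0"
  shows "\<exists>u v. a = skew_mult \<sigma> u f + v \<and> (v = 0 \<or> degree v < degree f)"
proof (induction "degree a" arbitrary: a rule: less_induct)
  case less
  show ?case
  proof (cases "a = 0 \<or> degree a < degree f")
    case True
    then show ?thesis by (intro exI[of _ 0] exI[of _ a]) (auto simp: skew_mult_0_left[OF \<sigma>])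
  next
    case False
    define m where "m = degree a - degree f"
    define w where "w = monom (lead_coeff a / (\<sigma> ^^ m) (lead_coeff f)) m"
    have nz: "(\<sigma> ^^ m) (lead_coeff f) \<noteq> 0"
      using f by (simp add: field_aut_eq_0_iff[OF field_aut_funpow[OF \<sigma>]])
    have w: "w \<noteq> 0" "degree w = m" "lead_coeff w = lead_coeff a / (\<sigma> ^^ m) (lead_coeff f)"
      using False nz by (auto simp: w_def degree_monom_eq)
    define a' where "a' = a - skew_mult \<sigma> w f"
    have dw: "degree w + degree f = degree a" using False w by (simp add: m_def)
    have "degree (skew_mult \<sigma> w f) = degree a"
      using skew_mult_degree_eq(1)[OF \<sigma> w(1) f] dw by simp
    moreover have "lead_coeff (skew_mult \<sigma> w f) = lead_coeff a"
      using coeff_skew_mult_top[OF \<sigma>, of w f] dw w nz calculation by simp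
    ultimately have "a' = 0 \<or> degree a' < degree a"
      unfolding a'_def by (metis coeff_diff degree_diff_le diff_self eq_zero_or_degree_less order_refl)
    then obtain u v where uv: "a' = skew_mult \<sigma> u f + v" "v = 0 \<or> degree v < degree f"
    proof
      assume "a' = 0"
      then show ?thesis using that[of 0 0] by (simp add: skew_mult_0_left[OF \<sigma>])
    next
      assume "degree a' < degree a"
      then show ?thesis using less[of a'] that by blast
    qed
    have "a = skew_mult \<sigma> (w + u) f + v"
      using uv(1) by (simp add: a'_def skew_mult_add_left[OF \<sigma>] algebra_simps)
    then show ?thesis using uv(2) by blast
  qed
qed

lemma skew_division_unique:
  assumes \<sigma>: "field_aut \<sigma>" and f: "f \<noteq> 0"
    and eq: "skew_mult \<sigma> u f + v = skew_mult \<sigma> u' f + v'"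
    and v: "v = 0 \<or> degree v < degree f" and v': "v' = 0 \<or> degree v' < degree f"
  shows "u = u' \<and> v = v'"
proof -
  have eq': "skew_mult \<sigma> (u - u') f = v' - v"
    using eq by (simp add: skew_mult_diff_left[OF \<sigma>] algebra_simps)
  have "u = u'"
  proof (rule ccontr)
    assume "u \<noteq> u'"
    then have "degree f \<le> degree (v' - v)" "v' - v \<noteq> 0"
      using skew_mult_degree_eq[OF \<sigma> _ f, of "u - u'"] by (auto simp: eq')
    then show False using v v' degree_diff_less[of v' "degree f" v] by (cases "degree f = 0") auto
  qed
  then show ?thesis using eq by simp
qed

lemma skew_mod_eqI:
  assumes "field_aut \<sigma>" "f \<noteq> 0" "v = 0 \<or> degree v < degree f"
  shows "skew_mod \<sigma> (skew_mult \<sigma> u f + v) f = v"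
  unfolding skew_mod_def
proof (rule the_equality)
  show "(v = 0 \<or> degree v < degree f) \<and> (\<exists>u'. skew_mult \<sigma> u f + v = skew_mult \<sigma> u' f + v)"
    using assms(3) by blast
next
  fix v' assume "(v' = 0 \<or> degree v' < degree f) \<and> (\<exists>u'. skew_mult \<sigma> u f + v = skew_mult \<sigma> u' f + v')"
  then obtain u' where "v' = 0 \<or> degree v' < degree f"
    and "skew_mult \<sigma> u f + v = skew_mult \<sigma> u' f + v'" by blast
  from skew_division_unique[OF assms(1,2) this(2) assms(3) this(1)] show "v' = v" by simp
qed

lemma skew_mod:
  assumes "field_aut \<sigma>" "f \<noteq> 0"
  shows "skew_mod \<sigma> a f = 0 \<or> degree (skew_mod \<sigma> a f) < degree f"
    and "\<exists>u. a = skew_mult \<sigma> u f + skew_mod \<sigma> a f"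
proof -
  obtain u v where uv: "a = skew_mult \<sigma> u f + v" "v = 0 \<or> degree v < degree f"
    using skew_division_exists[OF assms, of a] by (elim exE conjE)
  have "skew_mod \<sigma> a f = v" unfolding uv(1) by (rule skew_mod_eqI[OF assms uv(2)])
  then show "skew_mod \<sigma> a f = 0 \<or> degree (skew_mod \<sigma> a f) < degree f"
    and "\<exists>u. a = skew_mult \<sigma> u f + skew_mod \<sigma> a f"
    using uv by (simp_all only:, intro exI[of _ u], simp)
qed

lemma bij_betw_coeffs_lists:
  "bij_betw (\<lambda>p::'a::zero poly. map (coeff p) [0..<n]) {p. p = 0 \<or> degree p < n}
     {xs. set xs \<subseteq> UNIV \<and> length xs = n}"
proof (rule bij_betwI[where g = Poly])
  show "Poly \<in> {xs. set xs \<subseteq> UNIV \<and> length xs = n} \<rightarrow> {p::'a poly. p = 0 \<or> degree p < n}"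
  proof
    fix xs :: "'a list" assume "xs \<in> {xs. set xs \<subseteq> UNIV \<and> length xs = n}"
    then have z: "coeff (Poly xs) i = 0" if "i \<ge> n" for i
      using that by (simp add: nth_default_def)
    have "Poly xs \<noteq> 0 \<Longrightarrow> degree (Poly xs) < n"
      using z[of "degree (Poly xs)"] by (metis leading_coeff_0_iff not_le_imp_less)
    then show "Poly xs \<in> {p. p = 0 \<or> degree p < n}" by blast
  qed
next
  fix p :: "'a poly" assume "p \<in> {p. p = 0 \<or> degree p < n}"
  then show "Poly (map (coeff p) [0..<n]) = p"
    by (intro poly_eqI) (auto simp: nth_default_def coeff_eq_0)
next
  fix xs :: "'a list" assume "xs \<in> {xs. set xs \<subseteq> UNIV \<and> length xs = n}"
  then show "map (coeff (Poly xs)) [0..<n] = xs"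
    by (intro nth_equalityI) (auto simp: nth_default_def)
qed auto

lemma finite_degree_less: "finite {p::'a::{zero,finite} poly. p = 0 \<or> degree p < n}"
  by (rule iffD2[OF bij_betw_finite[OF bij_betw_coeffs_lists] finite_lists_length_eq]) simp

lemma card_skew_semifield:
  fixes f :: "'a::{field,finite} poly"
  shows "card (carrier (skew_semifield \<sigma> f)) = CARD('a) ^ degree f"
proof -
  have "card (carrier (skew_semifield \<sigma> f))
      = card {xs. set xs \<subseteq> (UNIV :: 'a set) \<and> length xs = degree f}"
    unfolding skew_semifield_def partial_object.simps
    by (rule bij_betw_same_card[OF bij_betw_coeffs_lists])
  also have "\<dots> = CARD('a) ^ degree f"
    by (rule card_lists_length_eq) simp
  finally show ?thesis .
qed

lemma finite_skew_semifields: "finite (skew_semifields (\<sigma> :: 'a::{field,finite} \<Rightarrow> 'a) d)"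
  unfolding skew_semifields_def
  by (intro finite_imageI finite_subset[OF _ finite_degree_less[of "Suc d"]]) auto

lemma finite_monic_irreducibles: "finite (monic_irreducibles d :: 'b::{field,finite} poly set)"
  unfolding monic_irreducibles_def
  by (intro finite_subset[OF _ finite_degree_less[of "Suc d"]]) auto

lemma additive_bij_inv:
  assumes "additive_bij S T F" "\<And>x y. x \<in> carrier S \<Longrightarrow> y \<in> carrier S \<Longrightarrow> x \<oplus>\<^bsub>S\<^esub> y \<in> carrier S"
  shows "additive_bij T S (inv_into (carrier S) F)"
proof -
  let ?G = "inv_into (carrier S) F"
  have b: "bij_betw F (carrier S) (carrier T)" using assms(1) by (simp add: additive_bij_def)
  have "?G (x \<oplus>\<^bsub>T\<^esub> y) = ?G x \<oplus>\<^bsub>S\<^esub> ?G y" if xy: "x \<in> carrier T" "y \<in> carrier T" for x y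
  proof -
    have g: "?G x \<in> carrier S" "?G y \<in> carrier S" "F (?G x) = x" "F (?G y) = y"
      using b xy by (auto simp: bij_betw_def inv_into_into f_inv_into_f)
    then have "F (?G x \<oplus>\<^bsub>S\<^esub> ?G y) = x \<oplus>\<^bsub>T\<^esub> y" using assms(1) by (simp add: additive_bij_def)
    then show ?thesis using bij_betw_inv_into_left[OF b assms(2)[OF g(1,2)]] by simp
  qed
  then show ?thesis using bij_betw_inv_into[OF b] by (simp add: additive_bij_def)
qed

lemma additive_bij_comp:
  assumes "additive_bij S T F" "additive_bij T U G" shows "additive_bij S U (G \<circ> F)"
  using assms bij_betw_trans[of F "carrier S" "carrier T" G "carrier U"]
  by (auto simp: additive_bij_def dest: bij_betwE)

lemma isotopic_refl: "isotopic S S"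
  unfolding isotopic_def
  by (intro exI[of _ "\<lambda>x. x"]) (auto simp: additive_bij_def bij_betw_id[unfolded id_def])

lemma isotopic_trans:
  assumes "isotopic S T" "isotopic T U" shows "isotopic S U"
proof -
  obtain F G H where 1: "additive_bij S T F" "additive_bij S T G" "additive_bij S T H"
    and m: "\<forall>x\<in>carrier S. \<forall>y\<in>carrier S. F x \<otimes>\<^bsub>T\<^esub> G y = H (x \<otimes>\<^bsub>S\<^esub> y)"
    using assms(1) unfolding isotopic_def by (elim exE conjE)
  obtain F' G' H' where 2: "additive_bij T U F'" "additive_bij T U G'" "additive_bij T U H'"
    and m': "\<forall>x\<in>carrier T. \<forall>y\<in>carrier T. F' x \<otimes>\<^bsub>U\<^esub> G' y = H' (x \<otimes>\<^bsub>T\<^esub> y)"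
    using assms(2) unfolding isotopic_def by (elim exE conjE)
  have "F x \<in> carrier T" "G x \<in> carrier T" if "x \<in> carrier S" for x
    using that 1 by (auto simp: additive_bij_def dest: bij_betwE)
  then have "\<forall>x\<in>carrier S. \<forall>y\<in>carrier S. (F' \<circ> F) x \<otimes>\<^bsub>U\<^esub> (G' \<circ> G) y = (H' \<circ> H) (x \<otimes>\<^bsub>S\<^esub> y)"
    using m m' by simp
  then show ?thesis unfolding isotopic_def
    using additive_bij_comp[OF 1(1) 2(1)] additive_bij_comp[OF 1(2) 2(2)] additive_bij_comp[OF 1(3) 2(3)]
    by blast
qed

lemma isotopic_sym:
  assumes "isotopic S T"
    and add: "\<And>x y. x \<in> carrier S \<Longrightarrow> y \<in> carrier S \<Longrightarrow> x \<oplus>\<^bsub>S\<^esub> y \<in> carrier S"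
    and mult: "\<And>x y. x \<in> carrier S \<Longrightarrow> y \<in> carrier S \<Longrightarrow> x \<otimes>\<^bsub>S\<^esub> y \<in> carrier S"
  shows "isotopic T S"
proof -
  obtain F G H where *:
    "additive_bij S T F" "additive_bij S T G" "additive_bij S T H"
    "\<And>x y. x \<in> carrier S \<Longrightarrow> y \<in> carrier S \<Longrightarrow> F x \<otimes>\<^bsub>T\<^esub> G y = H (x \<otimes>\<^bsub>S\<^esub> y)"
    using assms(1) unfolding isotopic_def by blast
  let ?i = "inv_into (carrier S)"
  have b: "bij_betw F (carrier S) (carrier T)" "bij_betw G (carrier S) (carrier T)"
    "bij_betw H (carrier S) (carrier T)" using * by (auto simp: additive_bij_def)
  have "?i F x \<otimes>\<^bsub>S\<^esub> ?i G y = ?i H (x \<otimes>\<^bsub>T\<^esub> y)" if xy: "x \<in> carrier T" "y \<in> carrier T" for x y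
  proof -
    have g: "?i F x \<in> carrier S" "?i G y \<in> carrier S" "F (?i F x) = x" "G (?i G y) = y"
      using b xy by (auto simp: bij_betw_def inv_into_into f_inv_into_f)
    then have "x \<otimes>\<^bsub>T\<^esub> y = H (?i F x \<otimes>\<^bsub>S\<^esub> ?i G y)" using *(4)[OF g(1,2)] by simp
    then show ?thesis using bij_betw_inv_into_left[OF b(3) mult[OF g(1,2)]] by simp
  qed
  then show ?thesis unfolding isotopic_def
    using additive_bij_inv[OF *(1) add] additive_bij_inv[OF *(2) add] additive_bij_inv[OF *(3) add]
    by blast
qed

lemma isotopic_skew_semifield_sym:
  assumes \<sigma>: "field_aut \<sigma>" and f: "f \<noteq> 0" and iso: "isotopic (skew_semifield \<sigma> f) T"
  shows "isotopic T (skew_semifield \<sigma> f)"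
proof (rule isotopic_sym[OF iso])
  fix x y assume "x \<in> carrier (skew_semifield \<sigma> f)" "y \<in> carrier (skew_semifield \<sigma> f)"
  then show "x \<oplus>\<^bsub>skew_semifield \<sigma> f\<^esub> y \<in> carrier (skew_semifield \<sigma> f)"
    by (auto simp: skew_semifield_def intro: degree_add_less)
  show "x \<otimes>\<^bsub>skew_semifield \<sigma> f\<^esub> y \<in> carrier (skew_semifield \<sigma> f)"
    using skew_mod(1)[OF \<sigma> f] by (simp add: skew_semifield_def)
qed

theorem equiv_isotopic:
  assumes \<sigma>: "field_aut \<sigma>"
  shows "equiv (skew_semifields \<sigma> d)
    {(S, T). S \<in> skew_semifields \<sigma> d \<and> T \<in> skew_semifields \<sigma> d \<and> isotopic S T}"
    (is "equiv ?S ?R")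
proof (rule equivI)
  show "?R \<subseteq> ?S \<times> ?S" by blast
  show "refl_on ?S ?R" using isotopic_refl by (auto intro: refl_onI)
  show "sym ?R"
  proof (rule symI)
    fix S T assume "(S, T) \<in> ?R"
    then have S: "S \<in> ?S" "T \<in> ?S" "isotopic S T" by simp_all
    obtain f where f: "S = skew_semifield \<sigma> f" "skew_irreducible \<sigma> f"
      using S(1) unfolding skew_semifields_def by blast
    then have "f \<noteq> 0" unfolding skew_irreducible_def by auto
    then have "isotopic T S" using isotopic_skew_semifield_sym[OF \<sigma>] S(3) f(1) by blast
    then show "(T, S) \<in> ?R" using S by simp
  qed
  show "trans ?R"
    by (rule transI) (auto intro: isotopic_trans)
qed

theorem group_GammaL1: "group (GammaL1 :: ('b::field \<times> ('b \<Rightarrow> 'b)) monoid)"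
proof (rule groupI)
  fix x :: "'b \<times> ('b \<Rightarrow> 'b)" assume "x \<in> carrier GammaL1"
  then obtain c \<rho> where x: "x = (c, \<rho>)" "c \<noteq> 0" "field_aut \<rho>" by (auto simp: GammaL1_def)
  then have i: "field_aut (inv_into UNIV \<rho>)" by (simp add: field_aut_inv)
  have "inv_into UNIV \<rho> (inverse c) * inv_into UNIV \<rho> c = 1"
    using x by (simp add: field_aut_mult[OF i, symmetric] field_aut_1[OF i])
  then show "\<exists>y\<in>carrier GammaL1. y \<otimes>\<^bsub>GammaL1\<^esub> x = \<one>\<^bsub>GammaL1\<^esub>"
    using x i bij_is_inj[OF field_aut_bij[OF x(3)]]
    by (intro bexI[of _ "(inv_into UNIV \<rho> (inverse c), inv_into UNIV \<rho>)"])
      (auto simp: GammaL1_def field_aut_eq_0_iff)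
qed (auto simp: GammaL1_def field_aut_comp field_aut_id field_aut_mult
    field_aut_eq_0_iff comp_assoc mult.assoc)

lemma coeff_GammaL1_act:
  assumes "f \<in> monic_irreducibles d" "field_aut \<rho>"
  shows "coeff (GammaL1_act d (c, \<rho>) f) k = inverse (c ^ d) * (c ^ k * \<rho> (coeff f k))"
  using assms coeff_pcompose_monom_linear[of "map_poly \<rho> f" c k]
  by (simp add: GammaL1_act_def monom_Suc monom_0 coeff_map_poly field_aut_0)

lemma map_poly_field_aut_mult:
  assumes "field_aut \<rho>" shows "map_poly \<rho> (p * q) = map_poly \<rho> p * map_poly \<rho> q"
  using assms
  by (intro poly_eqI)
    (simp add: coeff_map_poly coeff_mult field_aut_0 field_aut_sum field_aut_mult)

lemma degree_map_poly_field_aut: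
  assumes "field_aut \<rho>" shows "degree (map_poly \<rho> p) = degree p"
  using assms by (intro degree_map_poly) (simp add: field_aut_eq_0_iff)

lemma irreducible_semilinear_subst:
  fixes f :: "'b::field poly"
  assumes f: "irreducible f" and \<rho>: "field_aut \<rho>" and l: "c \<noteq> 0" and e: "e \<noteq> 0"
  shows "irreducible (smult e (pcompose (map_poly \<rho> f) [:0, c:]))"
proof -
  define \<Phi> where "\<Phi> p = pcompose (map_poly \<rho> p) [:0, c:]" for p
  define \<Psi> where "\<Psi> p = map_poly (inv_into UNIV \<rho>) (pcompose p [:0, inverse c:])" for p
  have i: "field_aut (inv_into UNIV \<rho>)" using \<rho> by (rule field_aut_inv)
  have deg: "degree (\<Phi> p) = degree p" for p
    using l by (simp add: \<Phi>_def degree_pcompose degree_map_poly_field_aut[OF \<rho>])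
  have deg': "degree (\<Psi> p) = degree p" for p
    using l by (simp add: \<Psi>_def degree_pcompose degree_map_poly_field_aut[OF i])
  have mult: "\<Psi> (p * q) = \<Psi> p * \<Psi> q" for p q
    by (simp add: \<Psi>_def pcompose_mult map_poly_field_aut_mult[OF i])
  have inv: "\<Psi> (\<Phi> p) = p" for p
  proof (rule poly_eqI)
    fix k
    have "coeff (\<Phi> p) k = c ^ k * \<rho> (coeff p k)" for k
      using coeff_pcompose_monom_linear[of "map_poly \<rho> p" c k]
      by (simp add: \<Phi>_def monom_Suc monom_0 coeff_map_poly field_aut_0[OF \<rho>])
    then show "coeff (\<Psi> (\<Phi> p)) k = coeff p k"
      using coeff_pcompose_monom_linear[of "\<Phi> p" "inverse c" k] l
        bij_is_inj[OF field_aut_bij[OF \<rho>]]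
      by (simp add: \<Psi>_def monom_Suc monom_0 coeff_map_poly field_aut_0[OF i]
          mult.assoc[symmetric] power_mult_distrib[symmetric])
  qed
  have df: "degree f > 0" using f
    by (metis gr0I irreducible_def is_unit_iff_degree)
  have "irreducible (\<Phi> f)"
  proof (rule irreducibleI)
    show nz: "\<Phi> f \<noteq> 0" using df deg[of f] by auto
    show "\<not> is_unit (\<Phi> f)" using df deg[of f] nz by (simp add: is_unit_iff_degree)
    fix a b assume ab: "\<Phi> f = a * b"
    then have "f = \<Psi> a * \<Psi> b" using inv[of f] mult by simp
    then have "is_unit (\<Psi> a) \<or> is_unit (\<Psi> b)" using f irreducibleD by blast
    moreover have "\<Psi> a \<noteq> 0" "\<Psi> b \<noteq> 0" using \<open>f = \<Psi> a * \<Psi> b\<close> df by auto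
    moreover have "a \<noteq> 0" "b \<noteq> 0" using ab nz by auto
    ultimately show "is_unit a \<or> is_unit b" by (simp add: is_unit_iff_degree deg')
  qed
  moreover have "is_unit [:e:]" using e by (simp add: is_unit_const_poly_iff dvd_field_iff)
  ultimately show ?thesis unfolding \<Phi>_def[symmetric]
    using irreducible_mult_unit_left[of "[:e:]" "\<Phi> f"] by simp
qed

lemma GammaL1_act_closed:
  assumes "f \<in> monic_irreducibles d" "c \<noteq> 0" "field_aut \<rho>"
  shows "GammaL1_act d (c, \<rho>) f \<in> monic_irreducibles d"
proof -
  have "degree (GammaL1_act d (c, \<rho>) f) = d" "irreducible (GammaL1_act d (c, \<rho>) f)"
    using assms irreducible_semilinear_subst[of f \<rho> c "inverse (c ^ d)"]
    by (auto simp: GammaL1_act_def monic_irreducibles_def degree_pcompose degree_map_poly_field_aut)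
  then show ?thesis using assms coeff_GammaL1_act[OF assms(1,3), of c d]
    by (auto simp: monic_irreducibles_def field_aut_1)
qed

theorem group_action_GammaL1:
  "group_action (GammaL1 :: ('b::field \<times> ('b \<Rightarrow> 'b)) monoid) (monic_irreducibles d) (GammaL1_act d)"
proof -
  let ?I = "monic_irreducibles d :: 'b poly set"
  have comp: "GammaL1_act d (c * \<rho> \<mu>, \<rho> \<circ> \<tau>) f = GammaL1_act d (c, \<rho>) (GammaL1_act d (\<mu>, \<tau>) f)"
    if "f \<in> ?I" "\<mu> \<noteq> 0" "field_aut \<rho>" "field_aut \<tau>" for c \<mu> \<rho> \<tau> f
  proof (rule poly_eqI)
    fix k
    have inv: "\<rho> (inverse x) = inverse (\<rho> x)" for x
      using field_aut_mult[OF that(3), of x "inverse x"] field_aut_0[OF that(3)] field_aut_1[OF that(3)]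
      by (cases "x = 0") (auto intro: inverse_unique[symmetric])
    show "coeff (GammaL1_act d (c * \<rho> \<mu>, \<rho> \<circ> \<tau>) f) k =
        coeff (GammaL1_act d (c, \<rho>) (GammaL1_act d (\<mu>, \<tau>) f)) k"
      using that
      by (simp add: coeff_GammaL1_act field_aut_comp GammaL1_act_closed field_aut_mult field_aut_power
          inv power_mult_distrib)
  qed
  have one: "GammaL1_act d (1, id) f = f" if "f \<in> ?I" for f
    using that by (intro poly_eqI) (simp add: coeff_GammaL1_act field_aut_id)
  have bij: "GammaL1_act d x \<in> Bij ?I" if x: "x \<in> carrier GammaL1" for x
  proof -
    obtain y where y: "y \<in> carrier GammaL1" "y \<otimes>\<^bsub>GammaL1\<^esub> x = (1, id)" "x \<otimes>\<^bsub>GammaL1\<^esub> y = (1, id)"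
      using group.l_inv[OF group_GammaL1 x] group.r_inv[OF group_GammaL1 x]
        group.inv_closed[OF group_GammaL1 x]
      by (auto simp: GammaL1_def)
    obtain c \<rho> \<mu> \<tau> where xy: "x = (c, \<rho>)" "y = (\<mu>, \<tau>)" by (cases x, cases y)
    have "bij_betw (GammaL1_act d x) ?I ?I"
      using x y(1) comp[of _ \<mu> \<rho> \<tau> c] comp[of _ c \<tau> \<rho> \<mu>] y(2,3) one unfolding xy
      by (intro bij_betwI[where g = "GammaL1_act d y"]) (auto simp: GammaL1_def xy GammaL1_act_closed)
    then show ?thesis by (auto simp: Bij_def GammaL1_act_def split: prod.splits)
  qed
  have "GammaL1_act d (x \<otimes>\<^bsub>GammaL1\<^esub> y) = GammaL1_act d x \<otimes>\<^bsub>BijGroup ?I\<^esub> GammaL1_act d y"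
    if x: "x \<in> carrier GammaL1" and y: "y \<in> carrier GammaL1" for x y
  proof (rule extensionalityI[where A = ?I])
    show "GammaL1_act d (x \<otimes>\<^bsub>GammaL1\<^esub> y) \<in> extensional ?I"
      by (auto simp: GammaL1_act_def split: prod.splits)
    show "GammaL1_act d x \<otimes>\<^bsub>BijGroup ?I\<^esub> GammaL1_act d y \<in> extensional ?I"
      using bij x y by (simp add: BijGroup_def)
    fix f assume "f \<in> ?I"
    then show "GammaL1_act d (x \<otimes>\<^bsub>GammaL1\<^esub> y) f = (GammaL1_act d x \<otimes>\<^bsub>BijGroup ?I\<^esub> GammaL1_act d y) f"
      using bij[OF x] bij[OF y] x y comp by (auto simp: BijGroup_def GammaL1_def compose_def)
  qed
  then have "GammaL1_act d \<in> hom GammaL1 (BijGroup ?I)"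
    using bij by (auto simp: hom_def BijGroup_def)
  then show ?thesis
    using group_GammaL1 group_BijGroup by (auto simp: group_action_def group_hom_def group_hom_axioms_def)
qed

end

theory Submission
  imports Defs "HOL-Number_Theory.Residues"
begin

text \<open>
  Write \<open>L\<close> for the field with \<open>q\<^sup>n\<close> elements, \<open>K\<close> for the fixed field of \<open>\<sigma>\<close> in \<open>L\<close>, \<open>R\<close> for the
  skew polynomial ring \<open>L[t;\<sigma>]\<close> and \<open>y = t\<^sup>n\<close>. The automorphism \<open>\<sigma>\<close> has order \<open>n\<close>
  (\<open>\<sigma>_order\<close>), so \<open>K[y]\<close> is central in \<open>R\<close>. The idea is to attach to an irreducible \<open>f\<close> of
  degree \<open>d\<close> a monic irreducible polynomial \<open>h\<close> over \<open>K\<close>, of the same degree \<open>d\<close>, such that \<open>f\<close>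
  divides \<open>h(t\<^sup>n)\<close> on the right, and to show that the orbit of \<open>h\<close> under \<open>\<Gamma>L(1,q)\<close> determines the
  semifield of \<open>f\<close> up to isotopism. Choosing such an \<open>f\<close> and \<open>h\<close> for every isotopism class then
  injects the classes into the orbits.

  \<^item> Some irreducible \<open>h\<close> exists because \<open>K[y]\<close> is infinite while \<open>R/Rf\<close> is finite, and because the
    annihilator of the simple module \<open>R/Rf\<close> in the centre is prime (\<open>irreducible_dvd_central\<close>).

  \<^item> If \<open>h(0) \<noteq> 0\<close>, then \<open>R/Rh(t\<^sup>n)\<close> is a simple ring (\<open>central_quotient_simple\<close>), so all irreducible
    right divisors of \<open>h(t\<^sup>n)\<close> give isomorphic simple modules. In terms of polynomials they are
    similar (\<open>similar_if_common_central_multiple\<close>); hence they have equal degrees, and right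
    multiplication by the intertwining element is an isotopism between their semifields
    (\<open>isotopic_if_similar\<close>).

  \<^item> The degree of \<open>h\<close> is \<open>d\<close>. By the previous point it is enough to find one irreducible right divisor
    of \<open>h(t\<^sup>n)\<close> whose degree is that of \<open>h\<close>. This is where finiteness enters, in the form that the
    norm from \<open>L[y]/(h)\<close> to the finite field \<open>K[y]/(h)\<close> is onto the units
    (\<open>norm_surjective_mod\<close>): with \<open>u\<close> of norm \<open>y\<close>, the rule \<open>t v = u \<sigma>(v)\<close> makes \<open>L[y]/(h)\<close> a simple
    \<open>R\<close>-module of the right size (\<open>skew_irreducible_factor_exists\<close>). Surjectivity of the norm follows
    from Hilbert's Theorem 90 and a count of Herbrand type. If \<open>h(0) = 0\<close>, then \<open>h = y\<close> and \<open>f\<close> is a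
    multiple of \<open>t\<close>.

  \<^item> The pair \<open>(c, \<rho>)\<close> is realised on \<open>R\<close>: choose \<open>\<alpha>\<close> in \<open>L\<close> of norm \<open>c\<close>, and extend \<open>\<rho>\<close>, which is a
    power of the Frobenius map, to the same power \<open>\<phi>\<close> on \<open>L\<close>. Then \<open>a \<mapsto> \<phi>(a)\<close>, \<open>t \<mapsto> \<alpha> t\<close> is an
    automorphism of \<open>R\<close>; it transports semifields isomorphically (\<open>isotopic_skew_subst\<close>) and acts
    on \<open>K[y]\<close> as \<open>(c, \<rho>)\<close> does, up to a constant factor (\<open>skew_subst_central\<close>).

  The field \<open>K\<close> lies inside \<open>L\<close>, whereas the orbits are formed over a field with \<open>q\<close> elements given
  separately. An isomorphism \<open>\<iota>\<close> between the two (\<open>finite_field_embedding\<close>) is fixed throughout.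
\<close>

(* coeff, monom and smult below are the operations on the type of polynomials *)
hide_const (open) up_ring.coeff up_ring.monom module.smult

section \<open>Ring morphisms between types\<close>

definition ring_morphism :: "('a::comm_ring_1 \<Rightarrow> 'b::comm_ring_1) \<Rightarrow> bool" where
  "ring_morphism h \<longleftrightarrow> h 1 = 1 \<and> (\<forall>x y. h (x + y) = h x + h y) \<and> (\<forall>x y. h (x * y) = h x * h y)"

lemma ring_morphism_field_aut: "field_aut \<sigma> \<Longrightarrow> ring_morphism \<sigma>"
  by (simp add: ring_morphism_def field_aut_1 field_aut_add field_aut_mult)

lemma ring_morphism_of_int: "ring_morphism of_int"
  by (simp add: ring_morphism_def)

context
  fixes h :: "'a::comm_ring_1 \<Rightarrow> 'b::comm_ring_1"
  assumes h: "ring_morphism h"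
begin

lemma morphism_1: "h 1 = 1" and morphism_add: "h (x + y) = h x + h y"
  and morphism_mult: "h (x * y) = h x * h y"
  using h by (simp_all add: ring_morphism_def)

lemma morphism_0: "h 0 = 0"
  using morphism_add[of 0 0] by simp

lemma morphism_minus: "h (- x) = - h x"
  using morphism_add[of x "- x"] by (simp add: morphism_0 minus_unique)

lemma morphism_diff: "h (x - y) = h x - h y"
  using morphism_add[of x "- y"] by (simp add: morphism_minus)

lemma morphism_power: "h (x ^ k) = h x ^ k"
  by (induction k) (simp_all add: morphism_1 morphism_mult)

lemma morphism_sum: "h (sum f A) = (\<Sum>i\<in>A. h (f i))"
  by (induction A rule: infinite_finite_induct) (simp_all add: morphism_0 morphism_add)

lemma morphism_prod: "h (prod f A) = (\<Prod>i\<in>A. h (f i))"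
  by (induction A rule: infinite_finite_induct) (simp_all add: morphism_1 morphism_mult)

lemma coeff_map_morphism: "coeff (map_poly h p) k = h (coeff p k)"
  by (simp add: coeff_map_poly morphism_0)

lemma map_poly_morphism_add: "map_poly h (p + q) = map_poly h p + map_poly h q"
  by (intro poly_eqI) (simp add: coeff_map_morphism morphism_add)

lemma map_poly_morphism_mult: "map_poly h (p * q) = map_poly h p * map_poly h q"
  by (intro poly_eqI) (simp add: coeff_map_morphism coeff_mult morphism_sum morphism_mult)

lemma ring_morphism_map_poly: "ring_morphism (map_poly h)"
  unfolding ring_morphism_def
  by (simp add: map_poly_morphism_add map_poly_morphism_mult morphism_1)

lemma map_poly_morphism_monom: "map_poly h (monom c k) = monom (h c) k"
  by (simp add: map_poly_monom morphism_0)

lemma poly_map_morphism: "poly (map_poly h p) (h x) = h (poly p x)"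
  by (induction p) (simp_all add: map_poly_pCons morphism_0 morphism_add morphism_mult)

lemma ring_morphism_eval: "ring_morphism (\<lambda>p. poly (map_poly h p) \<alpha>)"
  unfolding ring_morphism_def
  by (simp add: map_poly_morphism_add map_poly_morphism_mult morphism_1)

end

lemma morphism_inj:
  fixes h :: "'a::field \<Rightarrow> 'b::comm_ring_1"
  assumes h: "ring_morphism h" shows "inj h"
proof (rule injI)
  fix x y assume xy: "h x = h y"
  show "x = y"
  proof (rule ccontr)
    assume "x \<noteq> y"
    then have "h ((x - y) * inverse (x - y)) = 1" by (simp add: morphism_1[OF h])
    then show False using xy by (simp add: morphism_mult[OF h] morphism_diff[OF h])
  qed
qed

lemma map_poly_morphism_mod:
  fixes h :: "'a::field \<Rightarrow> 'b::field"
  assumes h: "ring_morphism h"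
  shows "map_poly h (a mod b) = map_poly h a mod map_poly h b"
proof (cases "b = 0")
  case False
  note M = ring_morphism_map_poly[OF h]
  have deg: "degree (map_poly h p) = degree p" for p
    using inj_eq[OF morphism_inj[OF h], of _ 0] by (intro degree_map_poly) (simp add: morphism_0[OF h])
  have "map_poly h a = map_poly h (a div b) * map_poly h b + map_poly h (a mod b)"
    by (simp flip: morphism_mult[OF M] morphism_add[OF M])
  then have "map_poly h a mod map_poly h b = map_poly h (a mod b) mod map_poly h b" by simp
  also have "\<dots> = map_poly h (a mod b)"
    using degree_mod_less[OF False, of a] by (auto intro: mod_poly_less simp: deg)
  finally show ?thesis by simp
qed simp

section \<open>Finite fields\<close>

lemma finite_field_primitive_element:
  "\<exists>g::'a::{field,finite}. g \<noteq> 0 \<and> (\<forall>x. x \<noteq> 0 \<longrightarrow> (\<exists>k. x = g ^ k))"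
proof -
  let ?R = "\<lparr>carrier = UNIV, mult = (*), one = 1, zero = 0, add = (+)\<rparr> :: 'a ring"
  have "\<exists>y. x + y = 0" for x :: 'a by (rule exI[of _ "- x"]) simp
  moreover have "x \<noteq> 0 \<Longrightarrow> \<exists>y. x * y = 1" for x :: 'a by (rule exI[of _ "inverse x"]) simp
  ultimately interpret F: Ring.field ?R
    by unfold_locales (auto simp: algebra_simps Units_def)
  have pow: "g [^]\<^bsub>?R\<^esub> (k::nat) = g ^ k" for g k
    by (induction k) (simp_all add: mult.commute)
  obtain g where g: "g \<in> carrier (mult_of ?R)"
    "carrier (mult_of ?R) = {g [^]\<^bsub>?R\<^esub> i |i::nat. i \<in> UNIV}"
    using F.finite_field_mult_group_has_gen by auto
  have "\<exists>k. x = g ^ k" if "x \<noteq> 0" for x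
  proof -
    have "x \<in> carrier (mult_of ?R)" using that by simp
    then show ?thesis using g(2) by (auto simp: pow)
  qed
  then show ?thesis using g(1) by auto
qed

text \<open>
  Multiplication by a nonzero \<open>x\<close> permutes the nonzero elements of \<open>K\<close>, so their product is unchanged
  when every factor is multiplied by \<open>x\<close>.
\<close>

lemma power_card_closed_subset:
  fixes K :: "'a::field set"
  assumes K: "finite K" "0 \<in> K" "\<And>x y. x \<in> K \<Longrightarrow> y \<in> K \<Longrightarrow> x * y \<in> K" and x: "x \<in> K"
  shows "x ^ card K = x"
proof (cases "x = 0")
  case False
  let ?K = "K - {0}"
  have "(*) x ` ?K \<subseteq> ?K" using False x K(3) by auto
  moreover have inj: "inj_on ((*) x) ?K" using False by (auto intro: inj_onI)
  ultimately have "(*) x ` ?K = ?K" using K(1) by (intro endo_inj_surj) auto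
  then have "\<Prod>?K = (\<Prod>y\<in>?K. x * y)" using prod.reindex[OF inj, of id] by simp
  then have "\<Prod>?K = x ^ card ?K * \<Prod>?K" using K(1) by (simp add: prod.distrib)
  then have "x ^ card ?K = 1" using K(1) by simp
  moreover have "card K = Suc (card ?K)" using card.remove[OF K(1,2)] .
  ultimately show ?thesis by simp
qed (use K in \<open>auto simp: power_0_left card_eq_0_iff\<close>)

lemma prime_CHAR_finite: "prime CHAR('a::{field,finite})"
  by (rule prime_CHAR_semidom) (simp add: finite_imp_CHAR_pos)

lemma CHAR_eq_if_CARD_power:
  assumes "CARD('a::{field,finite}) = p ^ m" "prime p"
  shows "CHAR('a) = p"
proof -
  have "CHAR('a) dvd p ^ m" using CHAR_dvd_CARD[where 'a='a] assms(1) by simp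
  then have "CHAR('a) dvd p" using prime_dvd_power prime_CHAR_finite by blast
  then show ?thesis using assms(2) prime_CHAR_finite[where 'a='a] primes_dvd_imp_eq by blast
qed

lemma frobenius_field_aut: "field_aut (\<lambda>x::'a::{field,finite}. x ^ (CHAR('a) ^ j))"
proof -
  let ?m = "CHAR('a) ^ j"
  have add: "(x + y) ^ ?m = x ^ ?m + y ^ ?m" for x y :: 'a
    by (rule freshmans_dream') (simp_all add: prime_CHAR_finite)
  have "inj (\<lambda>x::'a. x ^ ?m)"
  proof (rule injI)
    fix x y :: 'a assume "x ^ ?m = y ^ ?m"
    moreover have "x ^ ?m = (x - y) ^ ?m + y ^ ?m" using add[of "x - y" y] by simp
    ultimately have "(x - y) ^ ?m = 0" by simp
    then show "x = y" by simp
  qed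
  then show ?thesis
    by (simp add: field_aut_def bij_def finite_UNIV_inj_surj add power_mult_distrib)
qed

text \<open>
  When \<open>r\<close> is the length of the orbit of \<open>g\<close>, this is the minimal polynomial of \<open>g\<close> over the fixed field
  of \<open>\<sigma>\<close>.
\<close>

definition orbit_poly :: "('a::field \<Rightarrow> 'a) \<Rightarrow> 'a \<Rightarrow> nat \<Rightarrow> 'a poly" where
  "orbit_poly \<sigma> g r = (\<Prod>i<r. [:- (\<sigma> ^^ i) g, 1:])"

lemma degree_orbit_poly: "degree (orbit_poly \<sigma> g r) = r"
  and lead_coeff_orbit_poly: "lead_coeff (orbit_poly \<sigma> g r) = 1"
  unfolding orbit_poly_def lead_coeff_prod by (simp_all add: degree_prod_eq_sum_degree)

lemma poly_orbit_poly_eq_0_iff: "poly (orbit_poly \<sigma> g r) x = 0 \<longleftrightarrow> (\<exists>i<r. x = (\<sigma> ^^ i) g)"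
  by (auto simp: orbit_poly_def poly_prod)

lemma map_poly_orbit_poly:
  assumes \<sigma>: "field_aut \<sigma>" and r: "(\<sigma> ^^ r) g = g"
  shows "map_poly \<sigma> (orbit_poly \<sigma> g r) = orbit_poly \<sigma> g r"
proof -
  note m = ring_morphism_field_aut[OF \<sigma>]
  have "map_poly \<sigma> (\<Prod>i<k. [:- (\<sigma> ^^ i) g, 1:]) = (\<Prod>i<k. [:- (\<sigma> ^^ Suc i) g, 1:])" for k
    unfolding morphism_prod[OF ring_morphism_map_poly[OF m]]
    by (simp add: map_poly_pCons morphism_0[OF m] morphism_minus[OF m] morphism_1[OF m])
  then have "map_poly \<sigma> (orbit_poly \<sigma> g r) = (\<Prod>i<r. [:- (\<sigma> ^^ Suc i) g, 1:])"
    by (simp add: orbit_poly_def)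
  also have "\<dots> = orbit_poly \<sigma> g r"
  proof (cases r)
    case (Suc s)
    have "(\<Prod>i<Suc s. [:- (\<sigma> ^^ Suc i) g, 1:]) = (\<Prod>i<s. [:- (\<sigma> ^^ Suc i) g, 1:]) * [:- g, 1:]"
      using r Suc by simp
    also have "\<dots> = (\<Prod>i<Suc s. [:- (\<sigma> ^^ i) g, 1:])"
      by (subst prod.lessThan_Suc_shift) (simp add: mult.commute)
    finally show ?thesis by (simp add: orbit_poly_def Suc)
  qed (simp add: orbit_poly_def)
  finally show ?thesis .
qed

lemma field_aut_finite_period:
  fixes \<sigma> :: "'a::{field,finite} \<Rightarrow> 'a"
  assumes \<sigma>: "field_aut \<sigma>"
  shows "\<exists>r>0. (\<sigma> ^^ r) g = g \<and> inj_on (\<lambda>i. (\<sigma> ^^ i) g) {..<r}"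
proof -
  have shift: "(\<sigma> ^^ (j - i)) g = g" if "i < j" "(\<sigma> ^^ i) g = (\<sigma> ^^ j) g" for i j
  proof -
    have "(\<sigma> ^^ i) ((\<sigma> ^^ (j - i)) g) = (\<sigma> ^^ i) g"
      using that by (metis add_diff_inverse_nat comp_apply funpow_add not_less_iff_gr_or_eq)
    then show ?thesis
      using bij_is_inj[OF field_aut_bij[OF field_aut_funpow[OF \<sigma>]]] by (simp add: inj_eq)
  qed
  let ?P = "\<lambda>r. r > 0 \<and> (\<sigma> ^^ r) g = g"
  have "\<not> inj (\<lambda>i. (\<sigma> ^^ i) g)" using finite_imageD[of "\<lambda>i. (\<sigma> ^^ i) g" UNIV] by auto
  then have "\<exists>i j. i < j \<and> (\<sigma> ^^ i) g = (\<sigma> ^^ j) g"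
    unfolding inj_on_def by (metis linorder_neqE_nat)
  then have ex: "\<exists>r. ?P r" using shift by (metis zero_less_diff)
  let ?r = "LEAST r. ?P r"
  have r: "?P ?r" using LeastI_ex[OF ex] .
  have "(\<sigma> ^^ i) g \<noteq> (\<sigma> ^^ j) g" if "i < j" "j < ?r" for i j
    using not_less_Least[of "j - i" ?P] shift[of i j] that by auto
  then have "inj_on (\<lambda>i. (\<sigma> ^^ i) g) {..<?r}"
    unfolding inj_on_def by (metis lessThan_iff linorder_neqE_nat)
  then show ?thesis using r by blast
qed

text \<open>
  The polynomial \<open>X\<^sup>p - X\<close> has at most \<open>p\<close> roots, and the multiples of \<open>1\<close> already provide that many.
\<close>

lemma frobenius_fixed_prime_field:
  fixes x :: "'a::{field,finite}"
  assumes "x ^ CHAR('a) = x"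
  shows "\<exists>k. x = of_nat k"
proof -
  let ?p = "CHAR('a)"
  let ?P = "monom 1 ?p - monom 1 1 :: 'a poly"
  let ?Z = "{x::'a. poly ?P x = 0}"
  have p: "prime ?p" by (rule prime_CHAR_finite)
  then have p1: "?p > 1" by (rule prime_gt_1_nat)
  have "coeff ?P ?p = 1" using p1 by simp
  then have P: "?P \<noteq> 0" by (metis coeff_0 zero_neq_one)
  have "degree ?P \<le> ?p" using p1 by (intro degree_diff_le) (simp_all add: degree_monom_eq)
  then have le: "card ?Z \<le> ?p" using card_poly_roots_bound[OF P] by linarith
  have fr: "(of_nat k :: 'a) ^ ?p = of_nat k" for k
    by (induction k) (use p1 in \<open>simp_all add: freshmans_dream[OF p refl] power_0_left\<close>)
  have inj: "inj_on (of_nat :: nat \<Rightarrow> 'a) {..<?p}"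
  proof (rule inj_onI)
    fix i j assume "i \<in> {..<?p}" "j \<in> {..<?p}" "(of_nat i :: 'a) = of_nat j"
    then show "i = j" using of_nat_eq_iff_cong_CHAR[where 'a='a] by (auto simp: cong_def)
  qed
  have "(of_nat :: nat \<Rightarrow> 'a) ` {..<?p} \<subseteq> ?Z" using fr by (auto simp: poly_monom)
  moreover have "finite ?Z" by simp
  moreover have "card ((of_nat :: nat \<Rightarrow> 'a) ` {..<?p}) = ?p" using inj by (simp add: card_image)
  ultimately have "(of_nat :: nat \<Rightarrow> 'a) ` {..<?p} = ?Z" using le by (metis card_seteq)
  moreover have "x \<in> ?Z" using assms by (simp add: poly_monom)
  ultimately show ?thesis by blast
qed

text \<open>
  For a primitive element \<open>g\<close>, the orbit polynomial under Frobenius has its coefficients in the prime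
  field, so \<open>\<rho>\<close> fixes them and permutes its roots. Thus \<open>\<rho>(g)\<close> is a Frobenius conjugate of \<open>g\<close>, and \<open>g\<close>
  determines everything.
\<close>

lemma field_aut_is_frobenius_power:
  fixes \<rho> :: "'a::{field,finite} \<Rightarrow> 'a"
  assumes \<rho>: "field_aut \<rho>"
  shows "\<exists>j. \<forall>x. \<rho> x = x ^ (CHAR('a) ^ j)"
proof -
  note m = ring_morphism_field_aut[OF \<rho>]
  let ?p = "CHAR('a)"
  define \<phi> where "\<phi> = (\<lambda>x::'a. x ^ ?p)"
  have \<phi>: "field_aut \<phi>" using frobenius_field_aut[where 'a='a, of 1] by (simp add: \<phi>_def)
  have \<phi>_pow: "(\<phi> ^^ i) x = x ^ (?p ^ i)" for i x
    by (induction i arbitrary: x) (simp_all add: \<phi>_def mult.commute flip: power_mult)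
  obtain g :: 'a where g: "g \<noteq> 0" "\<And>x. x \<noteq> 0 \<Longrightarrow> \<exists>k. x = g ^ k"
    using finite_field_primitive_element by blast
  obtain r where r0: "r > 0" and r: "(\<phi> ^^ r) g = g" using field_aut_finite_period[OF \<phi>] by blast
  let ?m = "orbit_poly \<phi> g r"
  have "map_poly \<rho> ?m = ?m"
  proof (rule poly_eqI)
    fix k
    have "\<phi> (coeff ?m k) = coeff ?m k"
      using map_poly_orbit_poly[OF \<phi> r] coeff_map_morphism[OF ring_morphism_field_aut[OF \<phi>]] by metis
    then obtain c where "coeff ?m k = of_nat c"
      using frobenius_fixed_prime_field unfolding \<phi>_def by blast
    moreover have "\<rho> (of_nat c) = of_nat c" for c
      by (induction c) (simp_all add: morphism_0[OF m] morphism_add[OF m] morphism_1[OF m])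
    ultimately show "coeff (map_poly \<rho> ?m) k = coeff ?m k" by (simp add: coeff_map_morphism[OF m])
  qed
  moreover have "poly ?m g = 0"
    unfolding poly_orbit_poly_eq_0_iff using r0 by (intro exI[of _ 0]) simp
  ultimately have "poly ?m (\<rho> g) = 0"
    using poly_map_morphism[OF m, of ?m g] by (simp add: morphism_0[OF m])
  then obtain l where l: "\<rho> g = g ^ (?p ^ l)"
    unfolding poly_orbit_poly_eq_0_iff \<phi>_pow by blast
  have "\<rho> x = x ^ (?p ^ l)" for x
  proof (cases "x = 0")
    case True
    have "?p ^ l \<noteq> 0" using prime_gt_0_nat[OF prime_CHAR_finite[where 'a='a]] by simp
    then show ?thesis using True by (simp add: morphism_0[OF m] power_0_left)
  next
    case False
    then obtain k where "x = g ^ k" using g(2) by blast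
    then show ?thesis by (simp add: morphism_power[OF m] l mult.commute flip: power_mult)
  qed
  then show ?thesis by blast
qed


text \<open>
  Two finite fields of the same size are compared through evaluation of integer polynomials: every
  element of the first field is the value of an integer polynomial at a primitive element \<open>g\<close>.
\<close>

abbreviation int_eval :: "'a::comm_ring_1 \<Rightarrow> int poly \<Rightarrow> 'a" where
  "int_eval x P \<equiv> poly (map_poly of_int P) x"

lemma monic_int_division:
  fixes f m :: "int poly"
  assumes m: "lead_coeff m = 1"
  shows "\<exists>u r. f = m * u + r \<and> (r = 0 \<or> degree r < degree m)"
proof -
  have "m \<noteq> 0" using m by auto
  then show ?thesis
    using pseudo_divmod[of m f "fst (pseudo_divmod f m)" "snd (pseudo_divmod f m)"] m
    by (intro exI[of _ "fst (pseudo_divmod f m)"] exI[of _ "snd (pseudo_divmod f m)"]) auto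
qed

text \<open>
  Let \<open>m\<close> be monic of least degree among the integer polynomials vanishing at \<open>g\<close>. Modulo \<open>p\<close>, every
  integer polynomial vanishing at \<open>g\<close> is a multiple of \<open>m\<close>; in particular so is \<open>X\<^sup>q - X\<close>, which
  vanishes on all \<open>q\<close> elements of \<open>K\<close>. The cofactor has degree less than \<open>q\<close>, hence \<open>m\<close> has a root in
  \<open>K\<close>.
\<close>

lemma int_eval_common_root:
  fixes g :: "'b::{field,finite}" and K :: "'a::{field,finite} set"
  assumes p: "CHAR('a) = CHAR('b)"
    and K: "card K = CARD('b)" "\<And>x. x \<in> K \<Longrightarrow> x ^ CARD('b) = x"
  shows "\<exists>\<alpha>\<in>K. \<forall>P. int_eval g P = 0 \<longrightarrow> int_eval \<alpha> P = 0"
proof -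
  note M = ring_morphism_eval[OF ring_morphism_of_int]
  let ?p = "CHAR('b)" and ?q = "CARD('b)"
  have prime: "prime ?p" by (rule prime_CHAR_finite)
  have q1: "?q > 1" using card_mono[of UNIV "{0::'b, 1}"] by simp
  have gq: "g ^ ?q = g" by (rule power_card_closed_subset[of UNIV]) auto
  let ?I = "\<lambda>P. lead_coeff P = 1 \<and> int_eval g P = 0"
  let ?X = "monom 1 ?q - monom 1 1 :: int poly"
  have degX: "degree ?X = ?q"
  proof (rule antisym)
    show "degree ?X \<le> ?q" using q1 by (intro degree_diff_le) (simp_all add: degree_monom_eq)
    show "?q \<le> degree ?X" using q1 by (intro le_degree) simp
  qed
  have leadX: "lead_coeff ?X = 1" unfolding degX using q1 by simp
  have evX: "int_eval x ?X = x ^ ?q - x" for x :: "'c::comm_ring_1"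
    by (simp add: morphism_diff[OF M] map_poly_morphism_monom[OF ring_morphism_of_int] poly_monom)
  have "?I ?X" using leadX gq evX[of g] by simp
  then obtain m where m: "?I m" and min: "\<And>P. ?I P \<Longrightarrow> degree m \<le> degree P"
    using ex_has_least_nat[of ?I ?X degree] by blast
  have m0: "degree m > 0"
  proof (rule ccontr)
    assume "\<not> degree m > 0"
    then have "m = 1" using m by (metis bot_nat_0.not_eq_extremum degree_eq_zeroE lead_coeff_pCons(2) one_pCons)
    then show False using m by (simp add: morphism_1[OF M])
  qed
  \<comment> \<open>A polynomial of smaller degree that vanishes at \<open>g\<close> is zero modulo \<open>p\<close>: otherwise an inverse
    modulo \<open>p\<close> of its leading coefficient would turn it into a monic competitor of \<open>m\<close>.\<close>
  have small: "int ?p dvd coeff r k"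
    if "r = 0 \<or> degree r < degree m" "int_eval g r = 0" for r :: "int poly" and k
    using that
  proof (induction "degree r" arbitrary: r k rule: less_induct)
    case less
    show ?case
    proof (cases "r = 0")
      case False
      then have d: "degree r < degree m" using less.prems by simp
      define c where "c = lead_coeff r"
      have "int ?p dvd c"
      proof (rule ccontr)
        assume "\<not> int ?p dvd c"
        then have "coprime c (int ?p)"
          using prime prime_imp_coprime[of "int ?p" c] by (simp add: coprime_commute)
        then obtain x where x: "[c * x = 1] (mod int ?p)" using cong_solve_coprime_int by blast
        then obtain y where y: "c * x = 1 + int ?p * y" by (metis cong_iff_lin cong_sym)
        define s where "s = smult x r - smult (int ?p * y) (monom 1 (degree r))"
        have "degree s \<le> degree r"
          unfolding s_def using degree_smult_le degree_monom_le
          by (intro degree_diff_le) (auto intro: order.trans[OF degree_smult_le degree_monom_le])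
        moreover have "coeff s (degree r) = 1"
          using y by (simp add: s_def c_def[symmetric] mult.commute)
        ultimately have s: "lead_coeff s = 1" "degree s = degree r"
          by (metis le_antisym le_degree zero_neq_one)+
        have sm: "smult a P = [:a:] * P" for a :: int and P by simp
        have "int_eval g s = 0"
          unfolding s_def morphism_diff[OF M] sm morphism_mult[OF M] less.prems(2)
          using m by (simp add: map_poly_pCons)
        then have "degree m \<le> degree s" using s min by blast
        then show False using s d by simp
      qed
      define r' where "r' = r - monom c (degree r)"
      have ev': "int_eval g r' = 0"
        unfolding r'_def morphism_diff[OF M] less.prems(2)
        using \<open>int ?p dvd c\<close>
        by (auto simp: map_poly_morphism_monom[OF ring_morphism_of_int] elim!: dvdE)
      have "coeff r' (degree r) = 0" by (simp add: r'_def c_def)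
      moreover have "degree r' \<le> degree r"
        unfolding r'_def by (intro degree_diff_le) (simp_all add: degree_monom_le)
      ultimately have "r' = 0 \<or> degree r' < degree r"
        by (metis leading_coeff_0_iff order_le_less)
      then have "int ?p dvd coeff r' k"
        using less.hyps[of r' k] ev' d by auto
      moreover have "coeff r k = coeff r' k + (if k = degree r then c else 0)"
        by (simp add: r'_def)
      ultimately show ?thesis using \<open>int ?p dvd c\<close> by (auto simp: c_def)
    qed simp
  qed
  have small': "int_eval \<alpha> r = 0"
    if "r = 0 \<or> degree r < degree m" "int_eval g r = 0" for r :: "int poly" and \<alpha> :: 'a
  proof -
    have "(of_int (coeff r k) :: 'a) = 0" for k
      using small[OF that, of k] p by (simp add: of_int_eq_0_iff_char_dvd)
    then have "map_poly of_int r = (0 :: 'a poly)" by (intro poly_eqI) (simp add: coeff_map_poly)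
    then show ?thesis by simp
  qed
  have divide: "\<exists>u. (\<forall>\<alpha>::'a. int_eval \<alpha> P = int_eval \<alpha> m * int_eval \<alpha> u)
      \<and> (\<exists>r. P = m * u + r \<and> (r = 0 \<or> degree r < degree m))"
    if P: "int_eval g P = 0" for P
  proof -
    obtain u r where ur: "P = m * u + r" "r = 0 \<or> degree r < degree m"
      using monic_int_division m by blast
    have "int_eval g r = 0"
      using P m unfolding ur(1) morphism_add[OF M] morphism_mult[OF M] by simp
    then have "int_eval \<alpha> P = int_eval \<alpha> m * int_eval \<alpha> u" for \<alpha> :: 'a
      using small'[OF ur(2)] unfolding ur(1) morphism_add[OF M] morphism_mult[OF M] by simp
    then show ?thesis using ur by blast
  qed
  have "\<exists>\<alpha>\<in>K. int_eval \<alpha> m = 0"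
  proof (rule ccontr)
    assume no: "\<not> ?thesis"
    obtain u r where u: "\<And>\<alpha>::'a. int_eval \<alpha> ?X = int_eval \<alpha> m * int_eval \<alpha> u"
      and r: "?X = m * u + r" "r = 0 \<or> degree r < degree m"
      using divide[of ?X] gq unfolding evX[of g] right_minus_eq by blast
    have "degree m \<le> ?q" using min[of ?X] \<open>?I ?X\<close> degX by simp
    have mu: "degree (m * u) = ?q \<and> lead_coeff (m * u) = 1"
    proof -
      have e: "m * u = ?X - r" using r(1) by simp
      have lr: "coeff r k = 0" if "k \<ge> ?q" for k
        using r(2) \<open>degree m \<le> ?q\<close> that by (cases "r = 0") (auto intro!: coeff_eq_0)
      have "degree r \<le> ?q" using r(2) \<open>degree m \<le> ?q\<close> by auto
      then have "degree (m * u) \<le> ?q" unfolding e using degX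
        by (intro degree_diff_le[of ?X]) simp_all
      moreover have "coeff (m * u) ?q = 1" unfolding e using lr[of ?q] leadX degX by simp
      ultimately show ?thesis by (metis le_antisym le_degree zero_neq_one)
    qed
    have lu: "lead_coeff u = 1" using mu m by (simp add: lead_coeff_mult)
    then have "u \<noteq> 0" "m \<noteq> 0" using m by auto
    then have du: "degree u < ?q" using mu m0 by (simp add: degree_mult_eq)
    let ?u = "map_poly of_int u :: 'a poly"
    have "coeff ?u (degree u) = 1" using lu by (simp add: coeff_map_poly)
    then have "?u \<noteq> 0" by auto
    moreover have "K \<subseteq> {x. poly ?u x = 0}"
    proof
      fix x assume x: "x \<in> K"
      then have "int_eval x m * int_eval x u = 0" using u[of x] K(2) evX[of x] by simp
      then show "x \<in> {x. poly ?u x = 0}" using no x by auto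
    qed
    ultimately have "card K \<le> degree ?u"
      using card_poly_roots_bound[of ?u] card_mono[of "{x. poly ?u x = 0}" K] by auto
    then show False using du K(1) map_poly_degree_leq[of of_int u] by (metis leD le_trans)
  qed
  then show ?thesis using divide by (metis mult_eq_0_iff)
qed

text \<open>
  Send the value of an integer polynomial at \<open>g\<close> to its value at the common root \<open>\<alpha>\<close>; the preceding
  lemma says that this is well defined. Counting elements shows that the image is all of \<open>K\<close>.
\<close>

lemma finite_field_embedding:
  fixes K :: "'a::{field,finite} set"
  assumes p: "CHAR('a) = CHAR('b::{field,finite})" and K: "card K = CARD('b)" "0 \<in> K" "1 \<in> K"
    and mult: "\<And>x y. x \<in> K \<Longrightarrow> y \<in> K \<Longrightarrow> x * y \<in> K"
  shows "\<exists>\<iota>::'b \<Rightarrow> 'a. ring_morphism \<iota> \<and> range \<iota> = K"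
proof -
  note M = ring_morphism_eval[OF ring_morphism_of_int]
  obtain g :: 'b where g: "\<And>x. x \<noteq> 0 \<Longrightarrow> \<exists>k. x = g ^ k"
    using finite_field_primitive_element by blast
  have "x ^ CARD('b) = x" if "x \<in> K" for x
    using power_card_closed_subset[of K x] that K mult by simp
  then obtain \<alpha> where \<alpha>: "\<alpha> \<in> K" "\<And>P. int_eval g P = 0 \<Longrightarrow> int_eval \<alpha> P = 0"
    using int_eval_common_root[OF p K(1), of g] by blast
  have X: "int_eval x (monom 1 k) = x ^ k" for x :: "'c::comm_ring_1" and k
    by (simp add: map_poly_morphism_monom[OF ring_morphism_of_int] poly_monom)
  have "\<exists>P. int_eval g P = x" for x
  proof (cases "x = 0")
    case True
    then show ?thesis by (intro exI[of _ 0]) simp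
  next
    case False
    then show ?thesis using g[of x] X by metis
  qed
  then obtain P where P: "\<And>x. int_eval g (P x) = x" by metis
  define \<iota> where "\<iota> x = int_eval \<alpha> (P x)" for x
  have \<iota>: "\<iota> (int_eval g Q) = int_eval \<alpha> Q" for Q
    using \<alpha>(2)[of "P (int_eval g Q) - Q"] P by (simp add: \<iota>_def morphism_diff[OF M])
  have mor: "ring_morphism \<iota>"
    unfolding ring_morphism_def
  proof (intro conjI allI)
    show "\<iota> 1 = 1" using \<iota>[of 1] by (simp add: morphism_1[OF M])
    show "\<iota> (x + y) = \<iota> x + \<iota> y" for x y
      using \<iota>[of "P x + P y"] P by (simp add: \<iota>_def morphism_add[OF M])
    show "\<iota> (x * y) = \<iota> x * \<iota> y" for x y
      using \<iota>[of "P x * P y"] P by (simp add: \<iota>_def morphism_mult[OF M])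
  qed
  have pow: "\<alpha> ^ k \<in> K" for k using \<alpha>(1) K mult by (induction k) auto
  have "\<iota> x \<in> K" for x
  proof (cases "x = 0")
    case False
    then obtain k where "x = g ^ k" using g by blast
    then show ?thesis using \<iota>[of "monom 1 k"] pow[of k] by (simp add: X)
  qed (use mor K in \<open>simp add: morphism_0\<close>)
  moreover have "card (range \<iota>) = card K"
    using K(1) card_image[OF morphism_inj[OF mor]] by simp
  ultimately have "range \<iota> = K" by (intro card_subset_eq) auto
  then show ?thesis using mor by blast
qed

lemma card_degree_less: "card {p::'c::{zero,finite} poly. p = 0 \<or> degree p < d} = CARD('c) ^ d"
proof -
  have "card {p::'c poly. p = 0 \<or> degree p < d} = card {xs. set xs \<subseteq> (UNIV :: 'c set) \<and> length xs = d}"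
    by (rule bij_betw_same_card[OF bij_betw_coeffs_lists])
  then show ?thesis using card_lists_length_eq[of "UNIV :: 'c set" d] by simp
qed

section \<open>The cyclic extension\<close>

text \<open>
  Here \<open>\<iota>\<close> identifies an abstract field with the fixed field of \<open>\<sigma>\<close>. Below, \<open>E\<close> extends scalars from
  polynomials over that field, and \<open>S\<close> lets \<open>\<sigma>\<close> act on the coefficients of a polynomial.
\<close>

locale cyclic_extension =
  fixes \<sigma> :: "'a::{field,finite} \<Rightarrow> 'a" and \<iota> :: "'b::{field,finite} \<Rightarrow> 'a" and n :: nat
  assumes \<sigma>: "field_aut \<sigma>" and \<iota>: "ring_morphism \<iota>"
    and range_\<iota>: "range \<iota> = fixed_field \<sigma>" and card_ext: "CARD('a) = CARD('b) ^ n"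
begin

abbreviation E :: "'b poly \<Rightarrow> 'a poly" where "E \<equiv> map_poly \<iota>"
abbreviation S :: "'a poly \<Rightarrow> 'a poly" where "S \<equiv> map_poly \<sigma>"

lemmas \<sigma>_morphism = ring_morphism_field_aut[OF \<sigma>]
lemmas S_morphism = ring_morphism_map_poly[OF \<sigma>_morphism]
lemmas E_morphism = ring_morphism_map_poly[OF \<iota>]

lemma \<iota>_eq_iff: "\<iota> x = \<iota> y \<longleftrightarrow> x = y"
  using morphism_inj[OF \<iota>] by (rule inj_eq)

lemma \<iota>_eq_0_iff: "\<iota> x = 0 \<longleftrightarrow> x = 0"
  using \<iota>_eq_iff[of x 0] by (simp add: morphism_0[OF \<iota>])

lemma degree_E: "degree (E p) = degree p"
  by (intro degree_map_poly) (simp add: \<iota>_eq_0_iff)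

lemma coeff_E: "coeff (E p) k = \<iota> (coeff p k)"
  by (rule coeff_map_morphism[OF \<iota>])

lemma E_eq_iff: "E p = E q \<longleftrightarrow> p = q"
  by (auto simp: poly_eq_iff coeff_E \<iota>_eq_iff)

lemma E_eq_0_iff: "E p = 0 \<longleftrightarrow> p = 0"
  by (auto simp: poly_eq_iff coeff_E \<iota>_eq_0_iff)

lemma degree_S: "degree (S p) = degree p"
  by (rule degree_map_poly_field_aut[OF \<sigma>])

lemma coeff_S: "coeff (S p) k = \<sigma> (coeff p k)"
  by (rule coeff_map_morphism[OF \<sigma>_morphism])

lemma \<sigma>_fixed_iff: "\<sigma> x = x \<longleftrightarrow> (\<exists>y. x = \<iota> y)"
  using range_\<iota> by (auto simp: fixed_field_def)

lemma \<sigma>_\<iota>: "\<sigma> (\<iota> x) = \<iota> x"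
  using \<sigma>_fixed_iff by blast

lemma S_E: "S (E p) = E p"
  by (intro poly_eqI) (simp add: coeff_S coeff_E \<sigma>_\<iota>)

lemma S_fixed_iff: "S p = p \<longleftrightarrow> (\<exists>r. p = E r)"
proof
  assume "S p = p"
  then have "\<sigma> (coeff p k) = coeff p k" for k using coeff_S by metis
  then have c: "coeff p k = \<iota> (inv_into UNIV \<iota> (coeff p k))" for k
    using \<sigma>_fixed_iff by (metis f_inv_into_f rangeI)
  have "p = E (map_poly (inv_into UNIV \<iota>) p)"
  proof (rule poly_eqI)
    fix k
    have "inv_into UNIV \<iota> 0 = 0"
      using inv_into_f_f[OF morphism_inj[OF \<iota>], of 0] by (simp add: morphism_0[OF \<iota>])
    then show "coeff p k = coeff (E (map_poly (inv_into UNIV \<iota>) p)) k"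
      using c[of k] by (simp add: coeff_E coeff_map_poly)
  qed
  then show "\<exists>r. p = E r" by blast
qed (auto simp: S_E)

lemma E_dvd_E_iff: "E p dvd E r \<longleftrightarrow> p dvd r"
proof
  assume "E p dvd E r"
  then have "E (r mod p) = 0" by (simp add: map_poly_morphism_mod[OF \<iota>])
  then show "p dvd r" by (simp add: E_eq_0_iff mod_eq_0_iff_dvd)
qed (auto elim!: dvdE simp: morphism_mult[OF E_morphism])

text \<open>
  For a primitive element \<open>g\<close> with an orbit of length \<open>r\<close>, evaluation at \<open>g\<close> is a bijection from the
  polynomials of degree less than \<open>r\<close> over the fixed field to the whole field: it is injective because
  such a polynomial vanishing at \<open>g\<close> has \<open>r\<close> roots, and surjective by reduction modulo the orbit
  polynomial. Comparing cardinalities gives \<open>r = n\<close>.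
\<close>

lemma \<sigma>_order: "(\<sigma> ^^ n) x = x" and \<sigma>_free_orbit: "\<exists>g. inj_on (\<lambda>i. (\<sigma> ^^ i) g) {..<n}"
proof -
  obtain g :: 'a where g: "\<And>x. x \<noteq> 0 \<Longrightarrow> \<exists>k. x = g ^ k"
    using finite_field_primitive_element by blast
  obtain r where r: "r > 0" "(\<sigma> ^^ r) g = g" "inj_on (\<lambda>i. (\<sigma> ^^ i) g) {..<r}"
    using field_aut_finite_period[OF \<sigma>] by blast
  let ?m = "orbit_poly \<sigma> g r"
  let ?V = "{p::'b poly. p = 0 \<or> degree p < r}"
  obtain m where m: "?m = E m" using map_poly_orbit_poly[OF \<sigma> r(2)] S_fixed_iff by metis
  have mg: "poly (E m) g = 0"
    unfolding m[symmetric] poly_orbit_poly_eq_0_iff using r(1) by (intro exI[of _ 0]) simp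
  have dm: "degree m = r" "m \<noteq> 0"
    using degree_orbit_poly[of \<sigma> g r] lead_coeff_orbit_poly[of \<sigma> g r] by (auto simp: m degree_E)
  have funpow_E: "(\<sigma> ^^ i) (poly (E p) g) = poly (E p) ((\<sigma> ^^ i) g)" for p i
    by (induction i) (simp_all add: poly_map_morphism[OF \<sigma>_morphism, symmetric] S_E)
  have inj: "inj_on (\<lambda>p. poly (E p) g) ?V"
  proof (rule inj_onI)
    fix p p' assume p: "p \<in> ?V" "p' \<in> ?V" "poly (E p) g = poly (E p') g"
    have "E p = E p'"
    proof (rule poly_eqI_degree)
      show "poly (E p) x = poly (E p') x" if "x \<in> (\<lambda>i. (\<sigma> ^^ i) g) ` {..<r}" for x
      proof -
        obtain i where "x = (\<sigma> ^^ i) g" using \<open>x \<in> (\<lambda>i. (\<sigma> ^^ i) g) ` {..<r}\<close> by blast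
        then show ?thesis using funpow_E[of i p] funpow_E[of i p'] p(3) by metis
      qed
      show "degree (E p) < card ((\<lambda>i. (\<sigma> ^^ i) g) ` {..<r})"
        "degree (E p') < card ((\<lambda>i. (\<sigma> ^^ i) g) ` {..<r})"
        using p r(1) unfolding card_image[OF r(3)] by (auto simp: degree_E)
    qed
    then show "p = p'" by (simp add: E_eq_iff)
  qed
  have "x \<in> (\<lambda>p. poly (E p) g) ` ?V" for x
  proof (cases "x = 0")
    case False
    then obtain k where k: "x = g ^ k" using g by blast
    let ?p = "monom 1 k mod m"
    have "poly (E (monom 1 k)) g = poly (E (monom 1 k div m * m + ?p)) g" by simp
    also have "\<dots> = poly (E ?p) g"
      using mg unfolding morphism_add[OF E_morphism] morphism_mult[OF E_morphism] by simp
    finally have "x = poly (E ?p) g"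
      by (simp add: k map_poly_morphism_monom[OF \<iota>] morphism_1[OF \<iota>] poly_monom)
    moreover have "?p \<in> ?V" using degree_mod_less[OF dm(2), of "monom 1 k"] dm(1) by auto
    ultimately show ?thesis by (rule image_eqI)
  next
    case True
    then show ?thesis by (intro image_eqI[of _ _ 0]) simp_all
  qed
  then have "(\<lambda>p. poly (E p) g) ` ?V = UNIV" by blast
  then have "CARD('a) = card ?V" using card_image[OF inj] by simp
  then have "CARD('b) ^ n = CARD('b) ^ r" by (simp add: card_ext card_degree_less)
  moreover have "CARD('b) > 1" using card_mono[of UNIV "{0::'b, 1}"] by simp
  ultimately have "n = r" using power_inject_exp by blast
  then show "\<exists>g. inj_on (\<lambda>i. (\<sigma> ^^ i) g) {..<n}" using r(3) by blast
  have "(\<sigma> ^^ r) x = x"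
  proof (cases "x = 0")
    case False
    then obtain k where "x = g ^ k" using g by blast
    then show ?thesis using r(2) by (simp add: field_aut_power[OF field_aut_funpow[OF \<sigma>]])
  qed (simp add: field_aut_0[OF field_aut_funpow[OF \<sigma>]])
  then show "(\<sigma> ^^ n) x = x" using \<open>n = r\<close> by simp
qed

lemma n_pos: "n > 0"
proof (rule ccontr)
  assume "\<not> n > 0"
  then show False using card_ext card_mono[of UNIV "{0::'a, 1}"] by simp
qed

end

section \<open>Left ideals of a skew polynomial ring\<close>

locale skew_polynomials =
  fixes \<sigma> :: "'a::field \<Rightarrow> 'a"
  assumes \<sigma>_aut: "field_aut \<sigma>"
begin

abbreviation skew_times :: "'a poly \<Rightarrow> 'a poly \<Rightarrow> 'a poly" (infixl "\<star>" 70) where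
  "a \<star> b \<equiv> skew_mult \<sigma> a b"

definition left_ideal :: "'a poly set \<Rightarrow> bool" where
  "left_ideal I \<longleftrightarrow> 0 \<in> I \<and> (\<forall>a\<in>I. \<forall>b\<in>I. a + b \<in> I) \<and> (\<forall>r. \<forall>a\<in>I. r \<star> a \<in> I)"

definition right_dvd :: "'a poly \<Rightarrow> 'a poly \<Rightarrow> bool" where
  "right_dvd f a \<longleftrightarrow> (\<exists>u. a = u \<star> f)"

lemmas add_left = skew_mult_add_left[OF \<sigma>_aut] and add_right = skew_mult_add_right[OF \<sigma>_aut]
  and diff_left = skew_mult_diff_left[OF \<sigma>_aut] and assoc = skew_mult_assoc[OF \<sigma>_aut]
  and one_left = skew_mult_1_left[OF \<sigma>_aut] and zero_left = skew_mult_0_left[OF \<sigma>_aut]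
  and minus_left = skew_mult_minus_left[OF \<sigma>_aut] and degree_mult = skew_mult_degree_eq(1)[OF \<sigma>_aut]

lemma zero_right: "a \<star> 0 = 0"
  using add_right[of a 0 0] by (metis add_0 add_cancel_right_right)

lemma minus_right: "a \<star> (- b) = - (a \<star> b)"
  using add_right[of a b "- b"] by (simp add: zero_right minus_unique)

lemma diff_right: "a \<star> (b - c) = a \<star> b - a \<star> c"
  using add_right[of a b "- c"] by (simp add: minus_right)

lemma const_left: "[:c:] \<star> a = smult c a"
proof (rule poly_eqI)
  fix k
  have "coeff ([:c:] \<star> a) k = (\<Sum>i\<le>k. if i = 0 then c * coeff a k else 0)"
    unfolding coeff_skew_mult[OF \<sigma>_aut] by (intro sum.cong) (auto simp: coeff_pCons split: nat.splits)
  then show "coeff ([:c:] \<star> a) k = coeff (smult c a) k" by simp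
qed

lemma left_idealD:
  assumes "left_ideal I"
  shows "0 \<in> I" "a \<in> I \<Longrightarrow> b \<in> I \<Longrightarrow> a + b \<in> I" "a \<in> I \<Longrightarrow> r \<star> a \<in> I"
    "a \<in> I \<Longrightarrow> - a \<in> I" "a \<in> I \<Longrightarrow> b \<in> I \<Longrightarrow> a - b \<in> I" "a \<in> I \<Longrightarrow> smult c a \<in> I"
proof -
  show 1: "0 \<in> I" "a \<in> I \<Longrightarrow> b \<in> I \<Longrightarrow> a + b \<in> I" "a \<in> I \<Longrightarrow> r \<star> a \<in> I" for a b r
    using assms by (auto simp: left_ideal_def)
  show 2: "a \<in> I \<Longrightarrow> - a \<in> I" for a
    using 1(3)[of a "- 1"] by (simp add: minus_left one_left)
  show "a \<in> I \<Longrightarrow> b \<in> I \<Longrightarrow> a - b \<in> I" using 1(2)[of a "- b"] 2[of b] by simp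
  show "a \<in> I \<Longrightarrow> smult c a \<in> I" using 1(3)[of a "[:c:]"] by (simp add: const_left)
qed

lemma left_ideal_generator:
  assumes I: "left_ideal I" and a: "a \<in> I" "a \<noteq> 0"
  obtains w where "w \<in> I" "lead_coeff w = 1" "\<And>b. b \<in> I \<Longrightarrow> b \<noteq> 0 \<Longrightarrow> degree w \<le> degree b"
    "\<And>b. b \<in> I \<Longrightarrow> right_dvd w b"
proof -
  obtain w' where w': "w' \<in> I" "w' \<noteq> 0" and
    min: "\<And>b. b \<in> I \<Longrightarrow> b \<noteq> 0 \<Longrightarrow> degree w' \<le> degree b"
    using ex_has_least_nat[of "\<lambda>b. b \<in> I \<and> b \<noteq> 0" a degree] a by blast
  define w where "w = smult (inverse (lead_coeff w')) w'"
  have w: "w \<in> I" "lead_coeff w = 1" "w \<noteq> 0" "degree w = degree w'"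
    using w' left_idealD(6)[OF I] by (auto simp: w_def)
  have "right_dvd w b" if b: "b \<in> I" for b
  proof -
    obtain u v where uv: "b = u \<star> w + v" "v = 0 \<or> degree v < degree w"
      using skew_division_exists[OF \<sigma>_aut w(3)] by metis
    then have "v = b - u \<star> w" by simp
    then have "v \<in> I" using left_idealD(3,5)[OF I] b w(1) by simp
    then have "v = 0" using uv(2) min[of v] w(4) by fastforce
    then show ?thesis using uv(1) by (auto simp: right_dvd_def)
  qed
  then show ?thesis using that[of w] w min by simp
qed

lemma left_ideal_multiples: "left_ideal {a. right_dvd f a}"
  unfolding left_ideal_def right_dvd_def
proof (intro conjI ballI allI)
  show "0 \<in> {a. \<exists>u. a = u \<star> f}" by (auto intro: exI[of _ 0] simp: zero_left)
next
  fix a b r assume "a \<in> {a. \<exists>u. a = u \<star> f}"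
  then obtain u where u: "a = u \<star> f" by blast
  then have "r \<star> a = (r \<star> u) \<star> f" by (simp only: assoc)
  then show "r \<star> a \<in> {a. \<exists>u. a = u \<star> f}" by blast
  assume "b \<in> {a. \<exists>u. a = u \<star> f}"
  then obtain v where "b = v \<star> f" by blast
  then have "a + b = (u + v) \<star> f" using u by (simp only: add_left)
  then show "a + b \<in> {a. \<exists>u. a = u \<star> f}" by blast
qed

lemma right_dvd_refl: "right_dvd f f"
  unfolding right_dvd_def by (rule exI[of _ 1]) (simp add: one_left)

lemma right_dvd_mult: "right_dvd f a \<Longrightarrow> right_dvd f (r \<star> a)"
  using left_idealD(3)[OF left_ideal_multiples] by blast

lemma right_dvd_add: "right_dvd f a \<Longrightarrow> right_dvd f b \<Longrightarrow> right_dvd f (a + b)"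
  using left_idealD(2)[OF left_ideal_multiples] by blast

lemma right_dvd_diff: "right_dvd f a \<Longrightarrow> right_dvd f b \<Longrightarrow> right_dvd f (a - b)"
  using left_idealD(5)[OF left_ideal_multiples] by blast

lemma right_dvd_trans: "right_dvd f g \<Longrightarrow> right_dvd g a \<Longrightarrow> right_dvd f a"
  unfolding right_dvd_def by (metis assoc)

lemma right_dvd_degree: "right_dvd f a \<Longrightarrow> a \<noteq> 0 \<Longrightarrow> degree f \<le> degree a"
  unfolding right_dvd_def using degree_mult zero_left zero_right by (metis le_add2)

lemma irreducible_degree: "skew_irreducible \<sigma> f \<Longrightarrow> degree f > 0"
  by (simp add: skew_irreducible_def)

lemma irreducible_nonzero: "skew_irreducible \<sigma> f \<Longrightarrow> f \<noteq> 0"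
  using irreducible_degree by force

lemma irreducible_not_dvd_1: "skew_irreducible \<sigma> f \<Longrightarrow> \<not> right_dvd f 1"
  using right_dvd_degree[of f 1] irreducible_degree[of f] by auto

text \<open>
  Left ideals are principal, so an irreducible \<open>f\<close> generates a maximal left ideal: \<open>R/Rf\<close> is a simple
  module.
\<close>

lemma irreducible_imp_maximal:
  assumes f: "skew_irreducible \<sigma> f" and I: "left_ideal I" "f \<in> I" "1 \<notin> I" and a: "a \<in> I"
  shows "right_dvd f a"
proof -
  have nz: "f \<noteq> 0" using f by (rule irreducible_nonzero)
  then obtain w where w: "w \<in> I" "lead_coeff w = 1" "\<And>b. b \<in> I \<Longrightarrow> right_dvd w b"
    using left_ideal_generator[OF I(1,2)] by metis
  obtain v where v: "f = v \<star> w" using w(3)[OF I(2)] by (auto simp: right_dvd_def)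
  have "v \<noteq> 0" "w \<noteq> 0" using v nz zero_left zero_right by metis+
  then have deg: "degree f = degree v + degree w" using v degree_mult by simp
  have "degree w \<noteq> 0"
  proof
    assume "degree w = 0"
    then have "w = 1" using w(2) by (metis degree_eq_zeroE lead_coeff_pCons(2) one_pCons)
    then show False using w(1) I(3) by simp
  qed
  then have "degree v = 0" using f v deg unfolding skew_irreducible_def
    by (metis add_less_same_cancel1 bot_nat_0.not_eq_extremum less_add_same_cancel1 less_add_same_cancel2)
  then obtain c where c: "v = [:c:]" by (rule degree_eq_zeroE)
  then have "w = [:inverse c:] \<star> f" using v \<open>v \<noteq> 0\<close> by (simp add: const_left)
  then have "right_dvd f w" by (auto simp: right_dvd_def)
  then show ?thesis using w(3)[OF a] right_dvd_trans by blast
qed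

end

section \<open>Residues modulo a skew polynomial\<close>

context skew_polynomials
begin

lemma mod_degree: "f \<noteq> 0 \<Longrightarrow> skew_mod \<sigma> a f = 0 \<or> degree (skew_mod \<sigma> a f) < degree f"
  by (rule skew_mod(1)[OF \<sigma>_aut])

lemma right_dvd_minus_mod: "f \<noteq> 0 \<Longrightarrow> right_dvd f (a - skew_mod \<sigma> a f)"
  using skew_mod(2)[OF \<sigma>_aut, of f a] by (metis add_diff_cancel_right' right_dvd_def)

lemma mod_eqI:
  assumes "f \<noteq> 0" "v = 0 \<or> degree v < degree f" "right_dvd f (a - v)"
  shows "skew_mod \<sigma> a f = v"
  using assms skew_mod_eqI[OF \<sigma>_aut assms(1,2)] unfolding right_dvd_def by (metis diff_add_cancel)

lemma mod_eq_iff: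
  assumes f: "f \<noteq> 0" shows "skew_mod \<sigma> a f = skew_mod \<sigma> b f \<longleftrightarrow> right_dvd f (a - b)"
proof
  assume "skew_mod \<sigma> a f = skew_mod \<sigma> b f"
  then show "right_dvd f (a - b)"
    using right_dvd_diff[OF right_dvd_minus_mod[OF f, of a] right_dvd_minus_mod[OF f, of b]] by simp
next
  assume "right_dvd f (a - b)"
  then have "right_dvd f (a - skew_mod \<sigma> b f)"
    using right_dvd_add[OF _ right_dvd_minus_mod[OF f, of b], of "a - b"] by simp
  then show "skew_mod \<sigma> a f = skew_mod \<sigma> b f" using mod_eqI[OF f mod_degree[OF f]] by blast
qed

lemma mod_add:
  assumes f: "f \<noteq> 0" shows "skew_mod \<sigma> (a + b) f = skew_mod \<sigma> a f + skew_mod \<sigma> b f"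
proof (rule mod_eqI[OF f])
  have "a + b - (skew_mod \<sigma> a f + skew_mod \<sigma> b f) = (a - skew_mod \<sigma> a f) + (b - skew_mod \<sigma> b f)"
    by simp
  then show "right_dvd f (a + b - (skew_mod \<sigma> a f + skew_mod \<sigma> b f))"
    using right_dvd_add right_dvd_minus_mod[OF f] by presburger
  show "skew_mod \<sigma> a f + skew_mod \<sigma> b f = 0 \<or>
      degree (skew_mod \<sigma> a f + skew_mod \<sigma> b f) < degree f"
    using mod_degree[OF f, of a] mod_degree[OF f, of b] by (auto intro: degree_add_less)
qed

lemma mod_small: "f \<noteq> 0 \<Longrightarrow> v = 0 \<or> degree v < degree f \<Longrightarrow> skew_mod \<sigma> v f = v"
  using left_idealD(1)[OF left_ideal_multiples] by (intro mod_eqI) auto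

lemma small_right_dvd:
  assumes "right_dvd f (v - v')" "v = 0 \<or> degree v < degree f" "v' = 0 \<or> degree v' < degree f" "f \<noteq> 0"
  shows "v = v'"
  using assms mod_eq_iff[of f v v'] mod_small[of f] by metis

lemma coeff_monom_left:
  "coeff (monom c i \<star> b) k = (if i \<le> k then c * (\<sigma> ^^ i) (coeff b (k - i)) else 0)"
proof -
  have "coeff (monom c i \<star> b) k = (\<Sum>j\<le>k. if j = i then c * (\<sigma> ^^ i) (coeff b (k - i)) else 0)"
    unfolding coeff_skew_mult[OF \<sigma>_aut] by (intro sum.cong) auto
  then show ?thesis by simp
qed

lemma coeff_monom_right:
  "coeff (b \<star> monom c i) k = (if i \<le> k then coeff b (k - i) * (\<sigma> ^^ (k - i)) c else 0)"
proof -
  note z = field_aut_0[OF field_aut_funpow[OF \<sigma>_aut]]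
  have "coeff (b \<star> monom c i) k =
      (\<Sum>j\<le>k. if j = k - i then if i \<le> k then coeff b (k - i) * (\<sigma> ^^ (k - i)) c else 0 else 0)"
    unfolding coeff_skew_mult[OF \<sigma>_aut] by (intro sum.cong) (auto simp: z)
  then show ?thesis by simp
qed

lemma coeff_const_right: "coeff (b \<star> [:c:]) k = coeff b k * (\<sigma> ^^ k) c"
  using coeff_monom_right[of b c 0 k] by (simp add: monom_0)

text \<open>
  Such a \<open>u\<close> gives a nonzero module homomorphism from \<open>R/Rg\<close> to \<open>R/Rf\<close>, namely \<open>x \<mapsto> x u\<close>.
\<close>

definition similar :: "'a poly \<Rightarrow> 'a poly \<Rightarrow> bool" where
  "similar f g \<longleftrightarrow> (\<exists>u. \<not> right_dvd f u \<and> right_dvd f (g \<star> u))"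

end

sublocale cyclic_extension \<subseteq> skew_polynomials \<sigma>
  by unfold_locales (rule \<sigma>)

context cyclic_extension
begin

section \<open>Polynomials in \<open>t\<^sup>n\<close>\<close>

text \<open>
  The value of \<open>p\<close> at \<open>t\<^sup>n\<close>. The composition is that of commutative polynomials, but only powers of \<open>t\<^sup>n\<close>
  occur and these commute with constants, so it agrees with the evaluation in the skew ring.
\<close>

definition at_tn :: "'a poly \<Rightarrow> 'a poly" where
  "at_tn p = pcompose p (monom 1 n)"

lemma at_tn_0: "at_tn 0 = 0" and at_tn_1: "at_tn 1 = 1"
  and at_tn_add: "at_tn (p + p') = at_tn p + at_tn p'"
  and at_tn_diff: "at_tn (p - p') = at_tn p - at_tn p'"
  and at_tn_smult: "at_tn (smult c p) = smult c (at_tn p)"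
  by (simp_all add: at_tn_def pcompose_1 pcompose_add pcompose_diff pcompose_smult)

lemma degree_at_tn: "degree (at_tn p) = degree p * n"
  by (simp add: at_tn_def degree_pcompose degree_monom_eq)

lemma at_tn_eq_0_iff: "at_tn p = 0 \<longleftrightarrow> p = 0"
  unfolding at_tn_def using n_pos by (subst pcompose_eq_0_iff) (auto simp: degree_monom_eq)

lemma coeff_at_tn: "coeff (at_tn p) k = (if n dvd k then coeff p (k div n) else 0)"
proof (induction p arbitrary: k rule: pCons_induct)
  case (pCons c p)
  have "coeff (at_tn (pCons c p)) k = coeff [:c:] k + (if n \<le> k then coeff (at_tn p) (k - n) else 0)"
    by (simp add: at_tn_def pcompose_pCons coeff_monom_mult)
  moreover have "k div n = Suc ((k - n) div n)" "n dvd k - n \<longleftrightarrow> n dvd k" "k \<noteq> 0" if "n \<le> k"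
    using that n_pos by (auto simp: le_div_geq dvd_minus_self)
  moreover have "n dvd k \<longleftrightarrow> k = 0" if "\<not> n \<le> k"
    using that by (auto dest: dvd_imp_le)
  ultimately show ?case
    by (cases "n \<le> k") (simp_all add: pCons.IH coeff_pCons split: nat.split)
qed (simp add: at_tn_0)

lemma shift_left: "monom 1 n \<star> r = monom 1 n * r" and shift_right: "r \<star> monom 1 n = monom 1 n * r"
  by (rule poly_eqI; simp add: coeff_monom_left coeff_monom_right coeff_monom_mult \<sigma>_order
      field_aut_1[OF field_aut_funpow[OF \<sigma>]])+

lemma at_tn_pCons: "at_tn (pCons c p) = [:c:] + monom 1 n \<star> at_tn p"
  by (simp add: at_tn_def pcompose_pCons shift_left)

lemma at_tn_mult: "at_tn (p * r) = at_tn p \<star> at_tn r"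
proof (induction p rule: pCons_induct)
  case (pCons c p)
  have "at_tn (pCons c p * r) = smult c (at_tn r) + at_tn (pCons 0 (p * r))"
    by (simp add: at_tn_add at_tn_smult)
  also have "\<dots> = at_tn (pCons c p) \<star> at_tn r"
    by (simp add: at_tn_pCons pCons.IH add_left const_left assoc)
  finally show ?case .
qed (simp add: at_tn_0 zero_left)

lemma at_tn_central:
  assumes "S p = p" shows "at_tn p \<star> r = r \<star> at_tn p"
  using assms
proof (induction p rule: pCons_induct)
  case (pCons c p)
  then have c: "\<sigma> c = c" and p: "S p = p"
    by (auto simp: map_poly_pCons morphism_0[OF \<sigma>_morphism])
  have "(\<sigma> ^^ k) c = c" for k by (induction k) (simp_all add: c)
  then have "[:c:] \<star> r = r \<star> [:c:]"
    by (intro poly_eqI) (simp add: const_left coeff_const_right mult.commute)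
  moreover have "monom 1 n \<star> at_tn p \<star> r = r \<star> (monom 1 n \<star> at_tn p)"
    using pCons.IH[OF p] by (metis assoc shift_left shift_right)
  ultimately show ?case by (simp add: at_tn_pCons add_left add_right)
qed (simp add: at_tn_0 zero_left zero_right)

lemma E_central: "at_tn (E p) \<star> r = r \<star> at_tn (E p)"
  by (rule at_tn_central[OF S_E])

lemma at_tn_E_mult: "at_tn (E (p * r)) = at_tn (E p) \<star> at_tn (E r)"
  by (simp add: morphism_mult[OF E_morphism] at_tn_mult)

lemma supported_at_tn:
  assumes c: "\<And>k. coeff c k \<noteq> 0 \<Longrightarrow> n dvd k"
  shows "\<exists>z. c = at_tn z"
proof -
  define z where "z = (\<Sum>k\<le>degree c. monom (coeff c (n * k)) k)"
  have "coeff z k = coeff c (n * k)" for k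
  proof (cases "k \<le> degree c")
    case False
    moreover have "k \<le> n * k" using n_pos by simp
    ultimately have "coeff c (n * k) = 0" by (intro coeff_eq_0) linarith
    then show ?thesis using False by (simp add: z_def coeff_sum)
  qed (simp add: z_def coeff_sum)
  then have "c = at_tn z" using c by (intro poly_eqI) (auto simp: coeff_at_tn)
  then show ?thesis by blast
qed

lemma right_dvd_E_mult: "right_dvd f (at_tn (E p)) \<Longrightarrow> right_dvd f (at_tn (E (p * r)))"
  using right_dvd_mult[of f "at_tn (E p)" "at_tn (E r)"] 
  unfolding at_tn_E_mult E_central[of p "at_tn (E r)"] .

text \<open>
  The annihilator of a simple module in the centre is a prime ideal.
\<close>

lemma irreducible_central_prime:
  assumes f: "skew_irreducible \<sigma> f" and ab: "right_dvd f (at_tn (E (a * b)))"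
  shows "right_dvd f (at_tn (E a)) \<or> right_dvd f (at_tn (E b))"
proof (cases "right_dvd f (at_tn (E b))")
  case False
  let ?I = "{r. right_dvd f (r \<star> at_tn (E b))}"
  have I: "left_ideal ?I"
    unfolding left_ideal_def
    using left_idealD[OF left_ideal_multiples[of f]] by (simp add: zero_left add_left assoc)
  have "f \<in> ?I" using right_dvd_mult[OF right_dvd_refl] by (simp add: E_central[of b f, symmetric])
  moreover have "1 \<notin> ?I" using False by (simp add: one_left)
  moreover have "at_tn (E a) \<in> ?I" using ab by (simp add: at_tn_E_mult)
  ultimately show ?thesis using irreducible_imp_maximal[OF f I] by blast
qed simp

text \<open>
  Two distinct polynomials over the fixed field have the same image in the finite module \<open>R/Rf\<close>, so
  their difference annihilates it; an annihilating polynomial of least degree is irreducible because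
  the annihilator is prime.
\<close>

lemma irreducible_dvd_central:
  assumes f: "skew_irreducible \<sigma> f"
  shows "\<exists>h. irreducible h \<and> lead_coeff h = 1 \<and> right_dvd f (at_tn (E h))"
proof -
  have nz: "f \<noteq> 0" using f by (rule irreducible_nonzero)
  let ?\<phi> = "\<lambda>p. skew_mod \<sigma> (at_tn (E p)) f"
  have "finite (range ?\<phi>)"
    using mod_degree[OF nz] by (intro finite_subset[OF _ finite_degree_less[of "degree f"]]) auto
  moreover have "infinite (UNIV :: 'b poly set)"
  proof
    assume "finite (UNIV :: 'b poly set)"
    moreover have "inj (\<lambda>k. monom (1::'b) k)" by (rule injI) (metis degree_monom_eq zero_neq_one)
    ultimately have "finite (UNIV :: nat set)" by (metis finite_imageD finite_subset subset_UNIV)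
    then show False by simp
  qed
  ultimately have "\<not> inj ?\<phi>" using finite_imageD by blast
  then obtain p p' where "?\<phi> p = ?\<phi> p'" "p \<noteq> p'" unfolding inj_on_def by blast
  then have "right_dvd f (at_tn (E (p - p')))" "p - p' \<noteq> 0"
    using mod_eq_iff[OF nz] by (simp_all add: at_tn_diff morphism_diff[OF E_morphism])
  then obtain h' where h': "h' \<noteq> 0" "right_dvd f (at_tn (E h'))"
    and min: "\<And>p. p \<noteq> 0 \<Longrightarrow> right_dvd f (at_tn (E p)) \<Longrightarrow> degree h' \<le> degree p"
    using ex_has_least_nat[of "\<lambda>p. p \<noteq> 0 \<and> right_dvd f (at_tn (E p))" "p - p'" degree] by blast
  define h where "h = h' * [:inverse (lead_coeff h'):]"
  have h: "lead_coeff h = 1" "degree h = degree h'" using h' by (simp_all add: h_def)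
  have dvd: "right_dvd f (at_tn (E h))" unfolding h_def using right_dvd_E_mult[OF h'(2)] .
  have "irreducible h"
  proof (rule irreducibleI)
    show "h \<noteq> 0" using h by auto
    show "\<not> is_unit h"
    proof
      assume "is_unit h"
      then have "h = 1" using h \<open>h \<noteq> 0\<close>
        by (metis degree_eq_zeroE is_unit_iff_degree lead_coeff_pCons(2) one_pCons)
      then show False using dvd irreducible_not_dvd_1[OF f]
        by (simp add: morphism_1[OF E_morphism] at_tn_1)
    qed
    fix a b assume ab: "h = a * b"
    then have nz': "a \<noteq> 0" "b \<noteq> 0" using \<open>h \<noteq> 0\<close> by auto
    then have deg: "degree h' = degree a + degree b" using h(2) ab degree_mult_eq by metis
    have "right_dvd f (at_tn (E a)) \<or> right_dvd f (at_tn (E b))"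
      using irreducible_central_prime[OF f] dvd ab by simp
    then have "degree h' \<le> degree a \<or> degree h' \<le> degree b" using min nz' by blast
    then show "is_unit a \<or> is_unit b" using deg nz' by (auto simp: is_unit_iff_degree)
  qed
  then show ?thesis using h(1) dvd by blast
qed

section \<open>Irreducible divisors of a central element are similar\<close>

lemma trivial_power_dvd:
  assumes "\<And>a. (\<sigma> ^^ k) a = a" shows "n dvd k"
proof (rule ccontr)
  assume "\<not> n dvd k"
  then have k: "0 < k mod n" "k mod n < n" using n_pos by (auto simp: mod_greater_zero_iff_not_dvd)
  obtain g where g: "inj_on (\<lambda>i. (\<sigma> ^^ i) g) {..<n}" using \<sigma>_free_orbit by blast
  have "(\<sigma> ^^ (k mod n)) g = (\<sigma> ^^ k) g" by (rule funpow_mod_eq) (rule \<sigma>_order)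
  then have "(\<sigma> ^^ (k mod n)) g = (\<sigma> ^^ 0) g" using assms by simp
  then show False using inj_onD[OF g, of "k mod n" 0] k n_pos by simp
qed

text \<open>
  The quotient of \<open>R\<close> by \<open>h(t\<^sup>n)\<close> is a simple ring. Let \<open>c\<close> be a monic element of least degree in a
  two-sided ideal that contains \<open>h(t\<^sup>n)\<close>. It divides \<open>h(t\<^sup>n)\<close> and \<open>h(0) \<noteq> 0\<close>, so it has a nonzero constant term. The minimality
  of its degree then forces the commutators of \<open>c\<close> with constants and with \<open>t\<close>, which lie in the ideal,
  to vanish. Hence \<open>c\<close> lies in \<open>K[t\<^sup>n]\<close>, where \<open>h\<close> is irreducible.
\<close>

lemma central_quotient_simple:
  assumes I: "left_ideal I" and I_right: "\<And>a r. a \<in> I \<Longrightarrow> a \<star> r \<in> I" and I1: "1 \<notin> I"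
    and h: "irreducible h" "coeff h 0 \<noteq> 0" and HI: "at_tn (E h) \<in> I" and a: "a \<in> I"
  shows "right_dvd (at_tn (E h)) a"
proof -
  let ?H = "at_tn (E h)"
  have "h \<noteq> 0" using h(2) by auto
  then have "?H \<noteq> 0" by (simp add: at_tn_eq_0_iff E_eq_0_iff)
  then obtain c where c: "c \<in> I" "lead_coeff c = 1"
    and min: "\<And>b. b \<in> I \<Longrightarrow> b \<noteq> 0 \<Longrightarrow> degree c \<le> degree b" and gen: "\<And>b. b \<in> I \<Longrightarrow> right_dvd c b"
    using left_ideal_generator[OF I HI] by metis
  obtain w where w: "?H = w \<star> c" using gen[OF HI] by (auto simp: right_dvd_def)
  have "coeff ?H 0 \<noteq> 0" using h(2) by (simp add: coeff_at_tn coeff_E \<iota>_eq_0_iff)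
  then have c0: "coeff c 0 \<noteq> 0" using w by (simp add: coeff_skew_mult[OF \<sigma>])
  \<comment> \<open>The commutator of \<open>c\<close> with a constant, twisted so that the leading terms cancel.\<close>
  have comm: "coeff c k * (\<sigma> ^^ k) a = (\<sigma> ^^ degree c) a * coeff c k" for a k
  proof -
    let ?x = "c \<star> [:a:] - smult ((\<sigma> ^^ degree c) a) c"
    have "?x \<in> I" using left_idealD(5,6)[OF I] I_right c(1) by blast
    moreover have "?x = 0 \<or> degree ?x < degree c"
    proof -
      have "coeff ?x (degree c) = 0" using c(2) by (simp add: coeff_const_right)
      moreover have "degree ?x \<le> degree c"
        by (rule degree_le) (simp add: coeff_const_right coeff_eq_0)
      ultimately show ?thesis by (metis leading_coeff_0_iff order_le_less)
    qed
    ultimately have "?x = 0" using min[of ?x] by linarith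
    then have "coeff ?x k = 0" by simp
    then show ?thesis by (simp add: coeff_const_right)
  qed
  have m: "(\<sigma> ^^ degree c) a = a" for a using c0 comm[of 0 a] by simp
  have "(\<sigma> ^^ k) a = a" if "coeff c k \<noteq> 0" for k a using comm[of k a] that m[of a] by simp
  then have "n dvd k" if "coeff c k \<noteq> 0" for k using that trivial_power_dvd by blast
  then obtain z where z: "c = at_tn z" using supported_at_tn by blast
  have "\<sigma> (coeff c k) = coeff c k" for k
  proof -
    \<comment> \<open>The commutator with \<open>t\<close> has degree at most that of \<open>c\<close>, hence is a constant multiple of \<open>c\<close>;
      it has no constant term, whereas \<open>c\<close> has one.\<close>
    let ?x = "monom 1 1 \<star> c - c \<star> monom 1 1"
    have cx: "coeff ?x (Suc k) = \<sigma> (coeff c k) - coeff c k" "coeff ?x 0 = 0" for k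
      by (simp_all add: coeff_monom_left coeff_monom_right field_aut_1[OF field_aut_funpow[OF \<sigma>]])
    have "?x \<in> I" using left_idealD(3,5)[OF I] I_right c(1) by blast
    then obtain u where u: "?x = u \<star> c" using gen by (auto simp: right_dvd_def)
    have "degree ?x \<le> degree c"
    proof (rule degree_le, safe)
      fix i assume "degree c < i"
      then obtain j where j: "i = Suc j" "degree c \<le> j" by (cases i) auto
      then show "coeff ?x i = 0" using cx(1)[of j] c(2)
        by (cases "j = degree c") (simp_all add: coeff_eq_0 field_aut_1[OF \<sigma>] field_aut_0[OF \<sigma>])
    qed
    moreover have "c \<noteq> 0" using c(2) by auto
    ultimately have "degree u = 0" using u degree_mult[of u c] by (cases "u = 0") auto
    then obtain b where b: "u = [:b:]" by (rule degree_eq_zeroE)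
    then have "b * coeff c 0 = 0" using cx(2) unfolding u b const_left by simp
    then have "b = 0" using c0 by simp
    then have "?x = 0" using u b zero_left by simp
    then show ?thesis using cx(1)[of k] by simp
  qed
  then have "\<sigma> (coeff (at_tn z) (n * k)) = coeff (at_tn z) (n * k)" for k by (simp flip: z)
  then have "S z = z" using n_pos by (intro poly_eqI) (simp add: coeff_S coeff_at_tn)
  then obtain y where y: "c = at_tn (E y)" using S_fixed_iff z by metis
  have ynz: "y \<noteq> 0" using y c(2) by (auto simp: morphism_0[OF E_morphism] at_tn_0)
  have "y dvd h"
  proof -
    have e: "w \<star> c + 0 = at_tn (E (h div y)) \<star> c + at_tn (E (h mod y))"
    proof -
      have "?H = at_tn (E (h div y * y + h mod y))" by simp
      then show ?thesis using w y
        by (simp only: morphism_add[OF E_morphism] at_tn_add at_tn_E_mult add_0_right)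
    qed
    have "at_tn (E (h mod y)) = 0 \<or> degree (at_tn (E (h mod y))) < degree c"
      using degree_mod_less[OF ynz, of h] n_pos
      by (auto simp: y degree_at_tn degree_E morphism_0[OF E_morphism] at_tn_0)
    moreover have "c \<noteq> 0" using c(2) by auto
    ultimately have "at_tn (E (h mod y)) = 0" using skew_division_unique[OF \<sigma> _ e] by metis
    then show ?thesis by (simp add: at_tn_eq_0_iff E_eq_0_iff mod_eq_0_iff_dvd)
  qed
  then have "is_unit y \<or> h dvd y" using irreducibleD'[OF h(1)] by blast
  then have "h dvd y"
  proof
    assume "is_unit y"
    then have "degree c = 0" using ynz by (simp add: y degree_at_tn degree_E is_unit_iff_degree)
    then have "c = 1" using c(2) by (metis degree_eq_zeroE lead_coeff_pCons(2) one_pCons)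
    then show ?thesis using c(1) I1 by simp
  qed
  then obtain k where k: "y = k * h" by (metis dvdE mult.commute)
  have "right_dvd ?H c" unfolding y k at_tn_E_mult by (rule right_dvd_mult[OF right_dvd_refl])
  then show ?thesis using gen[OF a] right_dvd_trans by blast
qed

text \<open>
  If \<open>f\<close> and \<open>g\<close> were not similar, left multiplication by \<open>g\<close> would be injective, hence bijective, on the
  finite module \<open>R/Rf\<close>. Writing \<open>h(t\<^sup>n) = h' g\<close>, the cofactor \<open>h'\<close> would annihilate \<open>R/Rf\<close>, although its
  degree is too small for an element of the annihilator.
\<close>

lemma similar_if_common_central_multiple:
  assumes f: "skew_irreducible \<sigma> f" and g: "skew_irreducible \<sigma> g"
    and h: "irreducible h" "coeff h 0 \<noteq> 0"
    and fh: "right_dvd f (at_tn (E h))" and gh: "right_dvd g (at_tn (E h))"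
  shows "similar f g"
proof (rule ccontr)
  assume "\<not> similar f g"
  then have cancel: "\<And>u. right_dvd f (g \<star> u) \<Longrightarrow> right_dvd f u" by (auto simp: similar_def)
  have nz: "f \<noteq> 0" using f by (rule irreducible_nonzero)
  let ?H = "at_tn (E h)" and ?V = "{v. v = 0 \<or> degree v < degree f}"
  let ?\<phi> = "\<lambda>v. skew_mod \<sigma> (g \<star> v) f"
  obtain h' where h': "?H = h' \<star> g" using gh by (auto simp: right_dvd_def)
  have hnz: "h \<noteq> 0" using h(2) by auto
  then have Hnz: "?H \<noteq> 0" by (simp add: at_tn_eq_0_iff E_eq_0_iff)
  then have h'nz: "h' \<noteq> 0" "g \<noteq> 0" using h' zero_left zero_right by metis+
  have "inj_on ?\<phi> ?V"
  proof (rule inj_onI)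
    fix v v' assume v: "v \<in> ?V" "v' \<in> ?V" "?\<phi> v = ?\<phi> v'"
    then have "right_dvd f (g \<star> (v - v'))" using mod_eq_iff[OF nz] by (simp add: diff_right)
    then show "v = v'" using small_right_dvd[OF cancel] v nz by blast
  qed
  then have surj: "?\<phi> ` ?V = ?V"
    using mod_degree[OF nz] by (intro endo_inj_surj finite_degree_less) auto
  have h'_ann: "right_dvd f (h' \<star> r)" for r
  proof -
    have "skew_mod \<sigma> r f \<in> ?\<phi> ` ?V" using surj mod_degree[OF nz] by blast
    then obtain x where "skew_mod \<sigma> r f = skew_mod \<sigma> (g \<star> x) f" by blast
    then have "right_dvd f (h' \<star> (r - g \<star> x))" using mod_eq_iff[OF nz] right_dvd_mult by blast
    moreover have "right_dvd f (h' \<star> (g \<star> x))"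
      using right_dvd_mult[OF fh, of x] by (simp flip: assoc h' add: E_central)
    ultimately show ?thesis using right_dvd_add[of f "h' \<star> (r - g \<star> x)" "h' \<star> (g \<star> x)"] by (simp add: diff_right)
  qed
  let ?I = "{c. \<forall>r. right_dvd f (c \<star> r)}"
  have I: "left_ideal ?I"
    unfolding left_ideal_def
    using left_idealD[OF left_ideal_multiples[of f]] by (simp add: zero_left add_left assoc)
  have I_right: "c \<star> r \<in> ?I" if "c \<in> ?I" for c r using that by (simp add: assoc)
  have I1: "1 \<notin> ?I" using irreducible_not_dvd_1[OF f] one_left by (metis mem_Collect_eq)
  have HI: "?H \<in> ?I" using right_dvd_mult[OF fh] by (simp add: E_central)
  have "right_dvd ?H h'"
  proof (rule central_quotient_simple[OF I _ I1 h HI])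
    show "h' \<in> ?I" using h'_ann by blast
  qed (rule I_right)
  then have "degree ?H \<le> degree h'" using h'nz(1) by (rule right_dvd_degree)
  moreover have "degree ?H = degree h' + degree g" using h' h'nz degree_mult by simp
  ultimately show False using irreducible_degree[OF g] by simp
qed

text \<open>
  A nonzero homomorphism out of the simple module \<open>R/Rg\<close> is injective.
\<close>

lemma similar_annihilator:
  assumes f: "skew_irreducible \<sigma> f" and g: "skew_irreducible \<sigma> g"
    and u: "\<not> right_dvd f u" "right_dvd f (g \<star> u)" and x: "right_dvd f (x \<star> u)"
  shows "right_dvd g x"
proof (rule irreducible_imp_maximal[OF g])
  show "left_ideal {x. right_dvd f (x \<star> u)}"
    unfolding left_ideal_def
    using left_idealD[OF left_ideal_multiples[of f]] by (simp add: zero_left add_left assoc)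
qed (use u x in \<open>simp_all add: one_left\<close>)

lemma similar_inj_on:
  assumes f: "skew_irreducible \<sigma> f" and g: "skew_irreducible \<sigma> g"
    and u: "\<not> right_dvd f u" "right_dvd f (g \<star> u)"
  shows "inj_on (\<lambda>x. skew_mod \<sigma> (x \<star> u) f) {x. x = 0 \<or> degree x < degree g}"
proof (rule inj_onI)
  fix x y assume xy: "x \<in> {x. x = 0 \<or> degree x < degree g}" "y \<in> {x. x = 0 \<or> degree x < degree g}"
    "skew_mod \<sigma> (x \<star> u) f = skew_mod \<sigma> (y \<star> u) f"
  then have "right_dvd f ((x - y) \<star> u)"
    using mod_eq_iff[OF irreducible_nonzero[OF f]] by (simp add: diff_left)
  then have "right_dvd g (x - y)" using similar_annihilator[OF f g u] by blast
  then show "x = y" using small_right_dvd irreducible_nonzero[OF g] xy(1,2) by blast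
qed

lemma card_gt_1: "CARD('a) > 1" "CARD('b) > 1"
  using card_mono[of UNIV "{0::'a, 1}"] card_mono[of UNIV "{0::'b, 1}"] by simp_all

lemma similar_degree_le:
  assumes f: "skew_irreducible \<sigma> f" and g: "skew_irreducible \<sigma> g" and s: "similar f g"
  shows "degree g \<le> degree f"
proof -
  obtain u where u: "\<not> right_dvd f u" "right_dvd f (g \<star> u)" using s by (auto simp: similar_def)
  have "card {x::'a poly. x = 0 \<or> degree x < degree g} \<le> card {x::'a poly. x = 0 \<or> degree x < degree f}"
    using similar_inj_on[OF f g u] mod_degree[OF irreducible_nonzero[OF f]]
    by (intro card_inj_on_le[OF _ _ finite_degree_less]) auto
  then show ?thesis using card_gt_1(1) by (simp add: card_degree_less)
qed

text \<open>
  The maps \<open>x \<mapsto> x\<close>, \<open>y \<mapsto> y u\<close>, \<open>z \<mapsto> z u\<close> (reduced modulo \<open>f\<close>) form an isotopism: both sides of the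
  isotopism identity are the residue of \<open>x y u\<close> modulo \<open>f\<close>.
\<close>

lemma isotopic_if_similar:
  assumes f: "skew_irreducible \<sigma> f" and g: "skew_irreducible \<sigma> g" and s: "similar f g"
    and deg: "degree f = degree g"
  shows "isotopic (skew_semifield \<sigma> g) (skew_semifield \<sigma> f)"
proof -
  have nz: "f \<noteq> 0" "g \<noteq> 0" using f g irreducible_nonzero by auto
  obtain u where u: "\<not> right_dvd f u" "right_dvd f (g \<star> u)" using s by (auto simp: similar_def)
  let ?G = "\<lambda>x. skew_mod \<sigma> (x \<star> u) f" and ?V = "{x. x = 0 \<or> degree x < degree g}"
  have inj: "inj_on ?G ?V" using similar_inj_on[OF f g u] .
  have "?G ` ?V = ?V"
    using inj mod_degree[OF nz(1)] deg by (intro endo_inj_surj finite_degree_less) auto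
  then have G: "additive_bij (skew_semifield \<sigma> g) (skew_semifield \<sigma> f) ?G"
    using inj deg mod_add[OF nz(1)]
    by (simp add: additive_bij_def skew_semifield_def bij_betw_def add_left)
  have F: "additive_bij (skew_semifield \<sigma> g) (skew_semifield \<sigma> f) (\<lambda>x. x)"
    using deg by (simp add: additive_bij_def skew_semifield_def bij_betw_def)
  have "skew_mod \<sigma> (x \<star> ?G y) f = ?G (skew_mod \<sigma> (x \<star> y) g)" for x y
  proof -
    have "right_dvd f (x \<star> y \<star> u - x \<star> ?G y)"
      using right_dvd_mult[OF right_dvd_minus_mod[OF nz(1)], of x "y \<star> u"] by (simp add: diff_right assoc)
    moreover obtain v where v: "x \<star> y - skew_mod \<sigma> (x \<star> y) g = v \<star> g"
      using right_dvd_minus_mod[OF nz(2)] by (auto simp: right_dvd_def)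
    have "(x \<star> y - skew_mod \<sigma> (x \<star> y) g) \<star> u = v \<star> (g \<star> u)" unfolding v by (rule assoc)
    then have "right_dvd f ((x \<star> y - skew_mod \<sigma> (x \<star> y) g) \<star> u)"
      using right_dvd_mult[OF u(2), of v] by simp
    ultimately have "right_dvd f (x \<star> ?G y - skew_mod \<sigma> (x \<star> y) g \<star> u)"
      using right_dvd_diff[of f "(x \<star> y - skew_mod \<sigma> (x \<star> y) g) \<star> u" "x \<star> y \<star> u - x \<star> ?G y"]
      by (simp add: diff_left)
    then show ?thesis using mod_eq_iff[OF nz(1)] by simp
  qed
  then have "\<forall>x\<in>carrier (skew_semifield \<sigma> g). \<forall>y\<in>carrier (skew_semifield \<sigma> g).
      x \<otimes>\<^bsub>skew_semifield \<sigma> f\<^esub> ?G y = ?G (x \<otimes>\<^bsub>skew_semifield \<sigma> g\<^esub> y)"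
    by (simp add: skew_semifield_def)
  then show ?thesis
    unfolding isotopic_def using F G by (intro exI[of _ "\<lambda>x. x"] exI[of _ ?G] conjI)
qed

end

section \<open>The norm modulo a central irreducible polynomial\<close>

lemma card_kernel_image:
  assumes G: "group G" and fin: "finite (carrier G)" and f: "f \<in> hom G G"
  shows "card (carrier G) = card (kernel G G f) * card (f ` carrier G)"
proof -
  interpret group_hom G G f
    using G f by (simp add: group_hom_def group_hom_axioms_def)
  let ?r = "\<lambda>y. SOME x. x \<in> carrier G \<and> f x = y"
  have r: "?r y \<in> carrier G" "f (?r y) = y" if "y \<in> f ` carrier G" for y
    using someI_ex[of "\<lambda>x. x \<in> carrier G \<and> f x = y"] that by blast+
  have "bij_betw (\<lambda>(k, y). k \<otimes>\<^bsub>G\<^esub> ?r y) (kernel G G f \<times> f ` carrier G) (carrier G)"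
  proof (rule bij_betwI[where g = "\<lambda>x. (x \<otimes>\<^bsub>G\<^esub> inv\<^bsub>G\<^esub> (?r (f x)), f x)"])
    show "(\<lambda>(k, y). k \<otimes>\<^bsub>G\<^esub> ?r y) \<in> kernel G G f \<times> f ` carrier G \<rightarrow> carrier G"
      using r by (auto simp: kernel_def)
    show "(\<lambda>x. (x \<otimes>\<^bsub>G\<^esub> inv\<^bsub>G\<^esub> (?r (f x)), f x)) \<in> carrier G \<rightarrow> kernel G G f \<times> f ` carrier G"
      using r by (auto simp: kernel_def)
  qed (use r in \<open>auto simp: kernel_def G.m_assoc\<close>)
  then show ?thesis using bij_betw_same_card by (fastforce simp: card_cartesian_product)
qed

text \<open>
  For every endomorphism, the orders of kernel and image multiply to the order of the group. Hence, if the kernel of \<open>f\<close> lies in the image of \<open>g\<close>, the image of \<open>f\<close> has at least as many elements as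
  the kernel of \<open>g\<close>. It is applied to the norm and to \<open>x \<mapsto> x / \<sigma>(x)\<close>, where exactness at the first place is
  Hilbert's Theorem 90.
\<close>

lemma herbrand_finite_group:
  assumes G: "group G" and fin: "finite (carrier G)" and f: "f \<in> hom G G" and g: "g \<in> hom G G"
    and exact: "kernel G G f \<subseteq> g ` carrier G" and zero: "f ` carrier G \<subseteq> kernel G G g"
  shows "f ` carrier G = kernel G G g"
proof (rule card_seteq[OF _ zero])
  have k: "finite (kernel G G g)" "finite (g ` carrier G)" "finite (kernel G G f)"
    using fin by (auto simp: kernel_def)
  then show "finite (kernel G G g)" by simp
  have "\<one>\<^bsub>G\<^esub> \<in> kernel G G f"
    using G f by (auto simp: kernel_def hom_one group.is_monoid)
  then have pos: "card (kernel G G f) > 0" using k(3) by (auto simp: card_gt_0_iff)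
  have "card (kernel G G f) * card (kernel G G g) \<le> card (g ` carrier G) * card (kernel G G g)"
    using card_mono[OF k(2) exact] by simp
  also have "\<dots> = card (kernel G G f) * card (f ` carrier G)"
    using card_kernel_image[OF G fin f] card_kernel_image[OF G fin g] by (simp add: mult.commute)
  finally show "card (kernel G G g) \<le> card (f ` carrier G)" using pos by simp
qed

lemma smult_sum_right: "smult c (sum f A) = (\<Sum>i\<in>A. smult c (f i))"
  by (induction A rule: infinite_finite_induct) (simp_all add: smult_add_right)

definition poly_ideal :: "'a::comm_ring_1 poly set \<Rightarrow> bool" where
  "poly_ideal I \<longleftrightarrow> 0 \<in> I \<and> (\<forall>a\<in>I. \<forall>b\<in>I. a + b \<in> I) \<and> (\<forall>r. \<forall>a\<in>I. r * a \<in> I)"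

text \<open>
  With the trivial automorphism the skew ring is the commutative ring, so its theory of left ideals
  applies to ordinary polynomials.
\<close>

lemma skew_mult_id: "skew_mult id a b = a * b"
proof -
  have "(id ^^ i) x = x" for i and x :: 'a by (induction i) simp_all
  then show ?thesis by (intro poly_eqI) (simp add: coeff_skew_mult[OF field_aut_id] coeff_mult)
qed

lemma poly_ideal_generator:
  fixes I :: "'a::field poly set"
  assumes I: "poly_ideal I" and a: "a \<in> I" "a \<noteq> 0"
  obtains w where "w \<in> I" "lead_coeff w = 1" "\<And>b. b \<in> I \<Longrightarrow> w dvd b"
proof -
  interpret skew_polynomials "id :: 'a \<Rightarrow> 'a" by unfold_locales (rule field_aut_id)
  have "left_ideal I" using I by (simp add: left_ideal_def poly_ideal_def skew_mult_id)
  then obtain w where "w \<in> I" "lead_coeff w = 1" "\<And>b. b \<in> I \<Longrightarrow> right_dvd w b"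
    using left_ideal_generator[OF _ a] by metis
  then show ?thesis using that[of w] unfolding right_dvd_def skew_mult_id by (metis dvd_triv_right)
qed

context cyclic_extension
begin

lemma S_power: "(S ^^ i) p = map_poly (\<sigma> ^^ i) p"
  by (induction i) (simp_all add: map_poly_map_poly morphism_0[OF \<sigma>_morphism] o_def
      field_aut_0[OF field_aut_funpow[OF \<sigma>]])

lemma S_order: "(S ^^ n) p = p"
  by (simp add: S_power \<sigma>_order map_poly_idI)

lemma S_power_mult: "(S ^^ i) (p * p') = (S ^^ i) p * (S ^^ i) p'"
  by (induction i) (simp_all add: morphism_mult[OF S_morphism])

lemma S_power_const: "(S ^^ i) [:c:] = [:(\<sigma> ^^ i) c:]"
  by (simp add: S_power map_poly_pCons field_aut_0[OF field_aut_funpow[OF \<sigma>]])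

lemma S_power_E: "(S ^^ i) (E p) = E p"
  by (induction i) (simp_all add: S_E)

text \<open>
  For \<open>h\<close> irreducible over \<open>K\<close>, the ring \<open>L[y]/(h)\<close> need not be a field, but it has no proper nonzero
  ideal stable under \<open>\<sigma>\<close>: the monic generator of such an ideal is fixed by \<open>\<sigma>\<close>, so it lies
  in \<open>K[y]\<close> and divides \<open>h\<close> there.
\<close>

lemma S_stable_ideal:
  assumes I: "poly_ideal I" "\<And>a. a \<in> I \<Longrightarrow> S a \<in> I" and h: "irreducible h" "E h \<in> I" and one: "1 \<notin> I"
    and a: "a \<in> I"
  shows "E h dvd a"
proof -
  have "E h \<noteq> 0" using h(1) by (auto simp: E_eq_0_iff)
  then obtain g where g: "g \<in> I" "lead_coeff g = 1" "\<And>b. b \<in> I \<Longrightarrow> g dvd b"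
    using poly_ideal_generator[OF I(1) h(2)] by metis
  have "g dvd S g" using g(3)[OF I(2)[OF g(1)]] .
  then obtain k where k: "S g = g * k" by (elim dvdE)
  have lS: "lead_coeff (S g) = 1" using g(2) by (simp add: degree_S coeff_S field_aut_1[OF \<sigma>])
  then have "g \<noteq> 0" "k \<noteq> 0" using k by auto
  then have "degree k = 0" using arg_cong[OF k, of degree] by (simp add: degree_S degree_mult_eq)
  moreover have "lead_coeff k = 1" using lS g(2) unfolding k lead_coeff_mult by simp
  ultimately have "k = 1" by (metis degree_eq_zeroE lead_coeff_pCons(2) one_pCons)
  then have "S g = g" using k by simp
  then obtain g' where g': "g = E g'" using S_fixed_iff by blast
  have "g' dvd h" using g(3)[OF h(2)] by (simp add: g' E_dvd_E_iff)
  then have "is_unit g' \<or> h dvd g'" using irreducibleD'[OF h(1)] by blast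
  then show ?thesis
  proof
    assume "is_unit g'"
    then have "E g' dvd E 1" by (simp only: E_dvd_E_iff)
    then have "1 = g * (1 div g)" by (simp add: g' morphism_1[OF E_morphism])
    then have "1 \<in> I" using I(1) g(1) unfolding poly_ideal_def by (metis mult.commute)
    then show ?thesis using one by simp
  next
    assume "h dvd g'"
    then have "E h dvd g" by (simp add: g' E_dvd_E_iff)
    then show ?thesis using g(3)[OF a] dvd_trans by blast
  qed
qed

definition poly_norm :: "'a poly \<Rightarrow> 'a poly" where
  "poly_norm p = (\<Prod>i<n. (S ^^ i) p)"

lemma S_partial_norm: "b * S (\<Prod>i<m. (S ^^ i) b) = (\<Prod>i<Suc m. (S ^^ i) b)"
  by (subst prod.lessThan_Suc_shift) (simp add: morphism_prod[OF S_morphism])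

lemma poly_norm_mult: "poly_norm (a * b) = poly_norm a * poly_norm b"
  by (simp add: poly_norm_def S_power_mult prod.distrib)

lemma S_poly_norm: "S (poly_norm p) = poly_norm p"
proof (cases "p = 0")
  case True
  then show ?thesis using n_pos S_power_E[of _ 0] by (simp add: poly_norm_def zero_power)
next
  case False
  have "p * S (poly_norm p) = poly_norm p * p"
    unfolding poly_norm_def S_partial_norm by (simp add: S_order)
  then show ?thesis using False by (simp add: mult.commute)
qed

lemma degree_irreducible: "irreducible (h :: 'b poly) \<Longrightarrow> degree h > 0"
  by (metis gr0I irreducible_def is_unit_iff_degree)

lemma mod_E_S_power: "(S ^^ i) (p mod E h) = (S ^^ i) p mod E h"
  by (induction i) (simp_all add: map_poly_morphism_mod[OF \<sigma>_morphism] S_E)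

lemma poly_norm_mod: "poly_norm (p mod E h) mod E h = poly_norm p mod E h"
  by (simp add: poly_norm_def mod_E_S_power mod_prod_eq)

text \<open>
  Dedekind's independence of automorphisms. If the sum vanished modulo \<open>h\<close> on all constants, then for
  every polynomial \<open>P\<close> the combination of the \<open>b i\<close> with coefficients \<open>P(\<sigma>\<^sup>i(g))\<close> would vanish, where \<open>g\<close>
  has \<open>n\<close> distinct conjugates. A polynomial \<open>P\<close> with all conjugates except \<open>g\<close> as roots isolates \<open>b 0\<close>.
\<close>

lemma twisted_trace_nonzero:
  assumes h: "irreducible h" and b0: "b 0 = 1"
  shows "\<exists>x. \<not> E h dvd (\<Sum>i<n. b i * (S ^^ i) x)"
proof (rule ccontr)
  assume "\<not> ?thesis"
  then have all: "E h dvd (\<Sum>i<n. b i * (S ^^ i) x)" for x by blast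
  obtain g where g: "inj_on (\<lambda>i. (\<sigma> ^^ i) g) {..<n}" using \<sigma>_free_orbit by blast
  let ?\<gamma> = "\<lambda>i. (\<sigma> ^^ i) g"
  have rel: "E h dvd (\<Sum>i<n. smult (poly P (?\<gamma> i) * ?\<gamma> i ^ k) (b i))" for P k
  proof (induction P arbitrary: k rule: pCons_induct)
    case (pCons c P)
    have "E h dvd smult c (\<Sum>i<n. b i * (S ^^ i) [:g ^ k:]) + (\<Sum>i<n. smult (poly P (?\<gamma> i) * ?\<gamma> i ^ Suc k) (b i))"
      using pCons.IH[of "Suc k"] all by (intro dvd_add dvd_smult)
    also have "smult c (\<Sum>i<n. b i * (S ^^ i) [:g ^ k:]) = (\<Sum>i<n. smult (c * ?\<gamma> i ^ k) (b i))"
      by (simp add: smult_sum_right S_power_const field_aut_power[OF field_aut_funpow[OF \<sigma>]])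
    also have "\<dots> + (\<Sum>i<n. smult (poly P (?\<gamma> i) * ?\<gamma> i ^ Suc k) (b i)) =
        (\<Sum>i<n. smult (poly (pCons c P) (?\<gamma> i) * ?\<gamma> i ^ k) (b i))"
      by (simp add: sum.distrib[symmetric] smult_add_left[symmetric] algebra_simps)
    finally show ?case .
  qed simp
  define P where "P = (\<Prod>i\<in>{1..<n}. [:- ?\<gamma> i, 1:])"
  have P: "poly P (?\<gamma> i) = 0" if "i \<in> {1..<n}" for i
    using that by (auto simp: P_def poly_prod)
  have P0: "poly P g \<noteq> 0"
  proof
    assume "poly P g = 0"
    then obtain i where "i \<in> {1..<n}" "?\<gamma> 0 = ?\<gamma> i" by (auto simp: P_def poly_prod)
    then show False using inj_onD[OF g, of 0 i] by auto
  qed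
  have "(\<Sum>i<n. smult (poly P (?\<gamma> i) * ?\<gamma> i ^ 0) (b i)) = (\<Sum>i\<in>{0}. smult (poly P (?\<gamma> i) * ?\<gamma> i ^ 0) (b i))"
    using n_pos P by (intro sum.mono_neutral_right) auto
  then have "E h dvd [:poly P g:]" using rel[of P 0] b0 by simp
  then have "degree (E h) \<le> degree [:poly P g:]" using P0 by (intro dvd_imp_degree_le) simp_all
  then show False using degree_irreducible[OF h] by (simp add: degree_E)
qed

text \<open>
  Hilbert's Theorem 90. The usual twisted trace gives a \<open>c\<close>, nonzero modulo \<open>h\<close>, with \<open>c = b \<sigma>(c)\<close> modulo
  \<open>h\<close>. The ideal generated by \<open>c\<close> and \<open>h\<close> is stable under \<open>\<sigma>\<close>, so \<open>c\<close> is even a unit.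
\<close>

lemma hilbert_90_mod:
  assumes h: "irreducible h" and b: "E h dvd poly_norm b - 1"
  shows "\<exists>c. E h dvd c - b * S c \<and> (\<exists>a. E h dvd 1 - a * c)"
proof -
  let ?b = "\<lambda>i. \<Prod>j<i. (S ^^ j) b"
  obtain x where x: "\<not> E h dvd (\<Sum>i<n. ?b i * (S ^^ i) x)"
    using twisted_trace_nonzero[OF h, of ?b] by auto
  define c where "c = (\<Sum>i<n. ?b i * (S ^^ i) x)"
  have "b * S c = (\<Sum>i<n. ?b (Suc i) * (S ^^ Suc i) x)"
    by (simp only: c_def morphism_sum[OF S_morphism] morphism_mult[OF S_morphism] sum_distrib_left
        S_partial_norm[symmetric] funpow.simps comp_apply mult.assoc)
  also have "\<dots> = (\<Sum>i<Suc n. ?b i * (S ^^ i) x) - x"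
    by (subst sum.lessThan_Suc_shift) simp
  also have "\<dots> = c + (poly_norm b - 1) * x"
    by (simp add: c_def poly_norm_def S_order algebra_simps)
  finally have "c - b * S c = (poly_norm b - 1) * (- x)" by (simp add: algebra_simps)
  then have cb: "E h dvd c - b * S c" using b by simp
  obtain m where m: "n = Suc m" using n_pos by (cases n) auto
  \<comment> \<open>The product of the nontrivial conjugates of \<open>b\<close>, an inverse of \<open>b\<close> modulo \<open>h\<close>.\<close>
  define b' where "b' = S (\<Prod>i<m. (S ^^ i) b)"
  have b': "b * b' = poly_norm b" unfolding b'_def S_partial_norm poly_norm_def by (simp only: m)
  have Sc: "E h dvd S c - b' * c"
  proof -
    have "S c - b' * c = - (poly_norm b - 1) * S c - b' * (c - b * S c)"
      by (simp add: b'[symmetric] algebra_simps)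
    then show ?thesis using b cb by (metis dvd_diff dvd_minus_iff dvd_mult dvd_mult2)
  qed
  let ?I = "{y. \<exists>a. E h dvd y - a * c}"
  have "poly_ideal ?I"
    unfolding poly_ideal_def
  proof (intro conjI ballI allI)
    show "0 \<in> ?I" by (auto intro: exI[of _ 0])
  next
    fix y z r assume "y \<in> ?I"
    then obtain a where a: "E h dvd y - a * c" by blast
    then have "E h dvd r * (y - a * c)" by (rule dvd_mult)
    then have "E h dvd r * y - (r * a) * c" by (simp add: algebra_simps)
    then show "r * y \<in> ?I" by blast
    assume "z \<in> ?I"
    then obtain a' where "E h dvd z - a' * c" by blast
    then have "E h dvd (y - a * c) + (z - a' * c)" using a by (rule dvd_add[rotated])
    then have "E h dvd y + z - (a + a') * c" by (simp add: algebra_simps)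
    then show "y + z \<in> ?I" by blast
  qed
  moreover have "S y \<in> ?I" if y: "y \<in> ?I" for y
  proof -
    obtain a where "E h dvd y - a * c" using y by blast
    then have "S (E h) dvd S (y - a * c)" by (auto elim!: dvdE simp: morphism_mult[OF S_morphism])
    then have "E h dvd (S y - S a * S c) + S a * (S c - b' * c)"
      using Sc by (simp add: S_E morphism_diff[OF S_morphism] morphism_mult[OF S_morphism])
    then have "E h dvd S y - (S a * b') * c" by (simp add: algebra_simps)
    then show ?thesis by blast
  qed
  moreover have "E h \<in> ?I" by (auto intro: exI[of _ 0])
  moreover have "c \<in> ?I" by (auto intro: exI[of _ 1])
  moreover have "\<not> E h dvd c" using x by (simp add: c_def)
  ultimately have "1 \<in> ?I" using S_stable_ideal[OF _ _ h, of ?I c] by blast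
  then show ?thesis using cb by blast
qed

definition residue_monoid :: "'b poly \<Rightarrow> 'a poly monoid" where
  "residue_monoid h = \<lparr>carrier = {p. p = 0 \<or> degree p < degree h}, mult = (\<lambda>a b. a * b mod E h), one = 1\<rparr>"

text \<open>
  In the group of units of \<open>L[y]/(h)\<close>, the kernel of \<open>x \<mapsto> x / \<sigma>(x)\<close> consists of the units fixed by \<open>\<sigma>\<close>;
  the Herbrand count turns Hilbert's Theorem 90 into the statement that they are norms.
\<close>

lemma norm_surjective_mod:
  assumes h: "irreducible h" and c: "E h dvd 1 - a * E c"
  shows "\<exists>u. E h dvd poly_norm u - E c"
proof -
  let ?H = "E h" and ?M = "residue_monoid h"
  let ?G = "units_of ?M"
  have h0: "?H \<noteq> 0" "degree h > 0" using h degree_irreducible[OF h] by (auto simp: E_eq_0_iff)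
  have small: "p mod ?H = 0 \<or> degree (p mod ?H) < degree h" for p
    using degree_mod_less[OF h0(1), of p] by (simp add: degree_E)
  have mod_id: "p mod ?H = p" if "p = 0 \<or> degree p < degree h" for p
    using that by (auto intro: mod_poly_less simp: degree_E)
  have M: "comm_monoid ?M"
    by (rule comm_monoidI) (use small mod_id h0(2) in
      \<open>auto simp: residue_monoid_def mod_mult_left_eq mod_mult_right_eq mult_ac\<close>)
  interpret M: comm_monoid ?M by (rule M)
  interpret G: comm_group ?G by (rule M.units_comm_group)
  have mult: "x \<otimes>\<^bsub>?G\<^esub> y = x * y mod ?H" "\<one>\<^bsub>?G\<^esub> = 1" for x y
    by (simp_all add: units_of_def residue_monoid_def)
  have carrier: "p \<in> carrier ?G \<longleftrightarrow> (p = 0 \<or> degree p < degree h) \<and> (\<exists>a. ?H dvd 1 - a * p)" for p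
  proof
    assume "p \<in> carrier ?G"
    then obtain x where x: "p = 0 \<or> degree p < degree h" "x * p mod ?H = 1"
      by (auto simp: units_of_def Units_def residue_monoid_def)
    then have "?H dvd 1 - x * p" by (metis dvd_minus_mod dvd_minus_iff minus_diff_eq)
    then show "(p = 0 \<or> degree p < degree h) \<and> (\<exists>a. ?H dvd 1 - a * p)" using x by blast
  next
    assume p: "(p = 0 \<or> degree p < degree h) \<and> (\<exists>a. ?H dvd 1 - a * p)"
    then obtain x where x: "?H dvd 1 - x * p" by blast
    have "1 mod ?H = x * p mod ?H" using x by (simp only: mod_eq_dvd_iff)
    then have "(x mod ?H) * p mod ?H = 1" using mod_id[of 1] h0(2) by (simp add: mod_mult_left_eq)
    then show "p \<in> carrier ?G"
      using p small[of x] unfolding units_of_def Units_def residue_monoid_def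
      by (auto simp: mult.commute)
  qed
  have unitD: "\<exists>a. ?H dvd 1 - a * p" and smallD: "p = 0 \<or> degree p < degree h"
    if "p \<in> carrier ?G" for p
    using that unfolding carrier by simp_all
  have unitI: "p \<in> carrier ?G" if "p = 0 \<or> degree p < degree h" "?H dvd 1 - a * p" for p a
    using that unfolding carrier by blast
  have S_closed: "S p \<in> carrier ?G" if "p \<in> carrier ?G" for p
  proof -
    obtain x where "?H dvd 1 - x * p" using unitD[OF \<open>p \<in> carrier ?G\<close>] by blast
    then have "S ?H dvd S (1 - x * p)" by (auto elim!: dvdE simp: morphism_mult[OF S_morphism])
    then have "?H dvd 1 - S x * S p"
      by (simp add: S_E morphism_diff[OF S_morphism] morphism_mult[OF S_morphism] morphism_1[OF S_morphism])
    moreover have "S p = 0 \<or> degree (S p) < degree h"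
      using smallD[OF \<open>p \<in> carrier ?G\<close>] by (auto simp: degree_S)
    ultimately show ?thesis by (intro unitI)
  qed
  have S_hom: "S \<in> hom ?G ?G"
    by (rule homI)
      (simp_all add: S_closed mult map_poly_morphism_mod[OF \<sigma>_morphism] S_E morphism_mult[OF S_morphism])
  let ?N = "\<lambda>p. poly_norm p mod ?H" and ?D = "\<lambda>p. p \<otimes>\<^bsub>?G\<^esub> inv\<^bsub>?G\<^esub> (S p)"
  have unit_norm: "\<exists>a. ?H dvd 1 - a * poly_norm p" if "?H dvd 1 - x * p" for x p
  proof -
    have "x * p mod ?H = 1 mod ?H" using that by (metis mod_eq_dvd_iff)
    then have "poly_norm (x * p) mod ?H = poly_norm 1 mod ?H" by (metis poly_norm_mod)
    then have "?H dvd poly_norm 1 - poly_norm (x * p)" by (metis mod_eq_dvd_iff)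
    moreover have "poly_norm 1 = 1"
      using S_power_E[of _ 1] by (simp add: poly_norm_def morphism_1[OF E_morphism])
    ultimately show ?thesis by (auto simp: poly_norm_mult)
  qed
  have unit_mod: "p mod ?H \<in> carrier ?G" if "?H dvd 1 - x * p" for x p
  proof -
    have "1 mod ?H = x * (p mod ?H) mod ?H" using that by (simp add: mod_eq_dvd_iff mod_mult_right_eq)
    then have "?H dvd 1 - x * (p mod ?H)" by (simp only: mod_eq_dvd_iff)
    then show ?thesis by (rule unitI[OF small])
  qed
  have N_hom: "?N \<in> hom ?G ?G"
  proof (rule homI)
    show "?N p \<in> carrier ?G" if "p \<in> carrier ?G" for p
    proof -
      obtain x where "?H dvd 1 - x * p" using unitD[OF \<open>p \<in> carrier ?G\<close>] by blast
      then obtain a where "?H dvd 1 - a * poly_norm p" using unit_norm by blast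
      then show ?thesis by (rule unit_mod)
    qed
    show "?N (p \<otimes>\<^bsub>?G\<^esub> p') = ?N p \<otimes>\<^bsub>?G\<^esub> ?N p'" for p p'
      by (simp add: mult poly_norm_mod poly_norm_mult mod_mult_eq)
  qed
  have D_hom: "?D \<in> hom ?G ?G"
  proof (rule homI)
    show "?D p \<in> carrier ?G" if "p \<in> carrier ?G" for p
      using that S_closed by simp
    show "?D (p \<otimes>\<^bsub>?G\<^esub> p') = ?D p \<otimes>\<^bsub>?G\<^esub> ?D p'" if "p \<in> carrier ?G" "p' \<in> carrier ?G" for p p'
      using that S_closed by (simp add: hom_mult[OF S_hom] G.inv_mult G.m_ac)
  qed
  have fixed: "kernel ?G ?G ?D = {p \<in> carrier ?G. S p = p}"
  proof -
    have "?D p = \<one>\<^bsub>?G\<^esub> \<longleftrightarrow> S p = p" if "p \<in> carrier ?G" for p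
      using that S_closed by (metis G.inv_closed G.inv_equality G.inv_inv G.r_inv)
    then show ?thesis by (auto simp: kernel_def)
  qed
  have "?N ` carrier ?G = kernel ?G ?G ?D"
  proof (rule herbrand_finite_group[OF G.group_axioms _ N_hom D_hom])
    show "finite (carrier ?G)"
      using smallD by (intro finite_subset[OF _ finite_degree_less[of "degree h"]]) blast
    show "?N ` carrier ?G \<subseteq> kernel ?G ?G ?D"
      unfolding fixed using hom_in_carrier[OF N_hom]
      by (auto simp: map_poly_morphism_mod[OF \<sigma>_morphism] S_E S_poly_norm)
    show "kernel ?G ?G ?N \<subseteq> ?D ` carrier ?G"
    proof
      fix p assume "p \<in> kernel ?G ?G ?N"
      then have p: "p \<in> carrier ?G" "poly_norm p mod ?H = 1" by (auto simp: kernel_def mult)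
      then have "?H dvd poly_norm p - 1" by (metis dvd_minus_mod)
      then obtain e where e: "?H dvd e - p * S e" "\<exists>a. ?H dvd 1 - a * e"
        using hilbert_90_mod[OF h] by blast
      let ?e = "e mod ?H"
      have eG: "?e \<in> carrier ?G" using e(2) unit_mod by metis
      have "?e = p \<otimes>\<^bsub>?G\<^esub> S ?e"
        using e(1) by (simp add: mult map_poly_morphism_mod[OF \<sigma>_morphism] S_E mod_mult_right_eq mod_eq_dvd_iff)
      then have "p = ?D ?e" using eG p(1) S_closed by (metis G.inv_solve_right)
      then show "p \<in> ?D ` carrier ?G" using eG by blast
    qed
  qed
  moreover have "E c mod ?H \<in> kernel ?G ?G ?D"
    unfolding fixed using unit_mod[OF c] by (simp add: map_poly_morphism_mod[OF \<sigma>_morphism] S_E)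
  ultimately obtain u where "poly_norm u mod ?H = E c mod ?H" by (metis (no_types, lifting) imageE)
  then show ?thesis by (auto simp: mod_eq_dvd_iff)
qed

text \<open>
  This is the case \<open>h = y\<close>, where \<open>L[y]/(h)\<close> is \<open>L\<close> itself.
\<close>

lemma field_norm_surjective:
  assumes c: "c \<noteq> 0"
  shows "\<exists>\<alpha>. (\<Prod>i<n. (\<sigma> ^^ i) \<alpha>) = \<iota> c"
proof -
  let ?y = "[:0, 1:] :: 'b poly"
  have "irreducible ?y" by (rule irreducible_linear_field_poly) simp
  moreover have "E ?y dvd 1 - [:inverse (\<iota> c):] * E [:c:]"
    using c by (simp add: map_poly_pCons morphism_0[OF \<iota>] \<iota>_eq_0_iff one_pCons)
  ultimately obtain u where "E ?y dvd poly_norm u - E [:c:]" using norm_surjective_mod by blast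
  then obtain k where "poly_norm u - E [:c:] = E ?y * k" by (rule dvdE)
  then have "poly (poly_norm u - E [:c:]) 0 = poly (E ?y * k) 0" by (rule arg_cong)
  then have "poly (poly_norm u - E [:c:]) 0 = 0"
    unfolding poly_mult by (simp add: map_poly_pCons morphism_0[OF \<iota>])
  moreover have "poly ((S ^^ i) u) 0 = (\<sigma> ^^ i) (poly u 0)" for i
    by (simp add: S_power poly_0_coeff_0 coeff_map_poly field_aut_0[OF field_aut_funpow[OF \<sigma>]])
  ultimately have "(\<Prod>i<n. (\<sigma> ^^ i) (poly u 0)) = \<iota> c"
    by (simp add: poly_norm_def poly_prod map_poly_pCons morphism_0[OF \<iota>])
  then show ?thesis by blast
qed

end

context cyclic_extension
begin

section \<open>A simple module of the right size\<close>

text \<open>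
  Letting \<open>t\<close> act on \<open>L[y]\<close> as \<open>v \<mapsto> u \<sigma>(v)\<close> makes \<open>L[y]\<close> an \<open>R\<close>-module, and \<open>t\<^sup>n\<close> then acts as multiplication
  by the norm of \<open>u\<close>. If this norm is \<open>y\<close> modulo \<open>h\<close>, then on \<open>L[y]/(h)\<close> the central element \<open>t\<^sup>n\<close> acts as
  \<open>y\<close>.
\<close>

definition twist :: "'a poly \<Rightarrow> 'a poly \<Rightarrow> 'a poly" where
  "twist u v = u * S v"

definition act :: "'a poly \<Rightarrow> 'a poly \<Rightarrow> 'a poly \<Rightarrow> 'a poly" where
  "act u r v = (\<Sum>i\<le>degree r. smult (coeff r i) ((twist u ^^ i) v))"

lemma act_0: "act u 0 v = 0"
  by (simp add: act_def)

lemma act_pCons: "act u (pCons c r) v = smult c v + act u r (twist u v)"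
proof (cases "r = 0")
  case False
  then have "act u (pCons c r) v = (\<Sum>i\<le>Suc (degree r). smult (coeff (pCons c r) i) ((twist u ^^ i) v))"
    by (simp add: act_def)
  also have "\<dots> = smult c v + act u r (twist u v)"
    by (subst sum.atMost_Suc_shift) (simp add: act_def funpow_swap1)
  finally show ?thesis .
qed (simp add: act_def)

lemma act_const: "act u [:c:] v = smult c v"
  by (simp add: act_pCons act_0)

lemma act_1: "act u 1 v = v"
  using act_const[of u 1 v] by (simp add: one_pCons)

lemma act_add: "act u (r + r') v = act u r v + act u r' v"
  by (induction r r' arbitrary: v rule: poly_induct2)
    (simp_all add: act_0 act_pCons smult_add_left)

lemma act_smult: "act u (smult c r) v = smult c (act u r v)"
  by (induction r arbitrary: v) (simp_all add: act_0 act_pCons smult_add_right)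

lemma act_diff: "act u (r - r') v = act u r v - act u r' v"
  using act_add[of u "r - r'" r' v] by simp

lemma twist_diff: "twist u (v - v') = twist u v - twist u v'"
  by (simp add: twist_def morphism_diff[OF S_morphism] algebra_simps)

lemma act_diff_right: "act u r (v - v') = act u r v - act u r v'"
  by (induction r arbitrary: v v') (simp_all add: act_0 act_pCons twist_diff smult_diff_right)

lemma twist_dvd: "E h dvd v \<Longrightarrow> E h dvd twist u v"
  unfolding twist_def
  by (auto elim!: dvdE simp: morphism_mult[OF S_morphism] S_E intro: dvd_mult)

lemma act_dvd: "E h dvd v \<Longrightarrow> E h dvd act u r v"
  by (induction r arbitrary: v) (simp_all add: act_0 act_pCons twist_dvd dvd_smult)

lemma twist_smult: "twist u (smult c v) = smult (\<sigma> c) (twist u v)"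
proof -
  have "smult c v = [:c:] * v" by simp
  then have "S (smult c v) = [:\<sigma> c:] * S v"
    by (simp only: morphism_mult[OF S_morphism]) (simp add: map_poly_pCons morphism_0[OF \<sigma>_morphism])
  then show ?thesis by (simp add: twist_def)
qed

lemma twist_add: "twist u (v + v') = twist u v + twist u v'"
  by (simp add: twist_def morphism_add[OF S_morphism] algebra_simps)

lemma act_S_twist: "act u (S r) (twist u v) = twist u (act u r v)"
proof (induction r arbitrary: v)
  case (pCons c r)
  then show ?case
    by (simp add: map_poly_pCons morphism_0[OF \<sigma>_morphism] act_pCons twist_add twist_smult)
qed (simp add: act_0 twist_def)

lemma t_mult: "monom 1 1 \<star> r = pCons 0 (S r)"
  by (rule poly_eqI) (simp add: coeff_monom_left coeff_pCons coeff_S split: nat.split)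

lemma mult_t: "r \<star> monom 1 1 = pCons 0 r"
  by (rule poly_eqI)
    (simp add: coeff_monom_right coeff_pCons field_aut_1[OF field_aut_funpow[OF \<sigma>]] split: nat.split)

lemma act_mult: "act u (r \<star> s) v = act u r (act u s v)"
proof (induction r arbitrary: s)
  case (pCons c r)
  have "pCons c r \<star> s = smult c s + r \<star> pCons 0 (S s)"
  proof -
    have "pCons c r = [:c:] + r \<star> monom 1 1" by (simp only: mult_t) simp
    then show ?thesis by (simp only: add_left assoc t_mult const_left)
  qed
  then show ?case by (simp add: act_add act_smult pCons.IH act_pCons act_S_twist)
qed (simp add: act_0 zero_left)

lemma act_monom: "act u (monom 1 i) v = (twist u ^^ i) v"
proof (induction i arbitrary: v)
  case 0
  then show ?case by (simp add: act_1)
next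
  case (Suc i)
  then show ?case by (simp add: monom_Suc act_pCons funpow_swap1)
qed

lemma twist_power: "(twist u ^^ i) v = (\<Prod>j<i. (S ^^ j) u) * (S ^^ i) v"
proof (induction i)
  case (Suc i)
  have "(twist u ^^ Suc i) v = (u * S (\<Prod>j<i. (S ^^ j) u)) * (S ^^ Suc i) v"
    by (simp add: Suc.IH twist_def morphism_mult[OF S_morphism] mult.assoc)
  then show ?case unfolding S_partial_norm .
qed simp

lemma act_at_tn:
  assumes u: "E h dvd poly_norm u - [:0, 1:]"
  shows "E h dvd act u (at_tn p) v - p * v"
proof (induction p)
  case (pCons c p)
  have "act u (at_tn (pCons c p)) v = smult c v + poly_norm u * act u (at_tn p) v"
    by (simp add: at_tn_pCons act_add act_const act_mult act_monom twist_power S_order poly_norm_def)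
  then have "act u (at_tn (pCons c p)) v - pCons c p * v =
      (poly_norm u - [:0, 1:]) * act u (at_tn p) v + [:0, 1:] * (act u (at_tn p) v - p * v)"
    by (simp add: algebra_simps)
  then show ?case using u pCons.IH by (metis dvd_add dvd_mult dvd_mult2)
qed (simp add: at_tn_0 act_0)

lemma irreducible_coeff_0_eq_0:
  fixes h :: "'b poly"
  assumes h: "irreducible h" "coeff h 0 = 0"
  shows "degree h = 1"
proof -
  obtain h' where h': "h = pCons 0 h'" using h(2) by (metis coeff_pCons_0 pCons_cases)
  then have e: "h = [:0, 1:] * h'" by simp
  have "is_unit h'" using irreducibleD[OF h(1) e] by (auto simp: is_unit_iff_degree)
  moreover have "h' \<noteq> 0" using h(1) h' by auto
  ultimately show ?thesis by (simp add: h' is_unit_iff_degree)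
qed

lemma y_unit_mod:
  assumes "coeff h 0 \<noteq> 0"
  shows "\<exists>a. E h dvd 1 - a * [:0, 1:]"
proof -
  obtain h0 h1 where h: "h = pCons h0 h1" by (cases h)
  then have h0: "\<iota> h0 \<noteq> 0" using assms by (simp add: \<iota>_eq_0_iff)
  have Eh: "E h = pCons (\<iota> h0) (E h1)" by (simp add: h map_poly_pCons morphism_0[OF \<iota>])
  have "1 - smult (- inverse (\<iota> h0)) (E h1) * [:0, 1:] = E h * [:inverse (\<iota> h0):]"
    using h0 by (simp add: Eh one_pCons)
  then show ?thesis by (metis dvd_triv_left)
qed

text \<open>
  The submodule generated by \<open>v\<close> is an ideal of \<open>L[y]/(h)\<close>, because \<open>t\<^sup>n\<close> acts as \<open>y\<close>. It is stable under
  \<open>\<sigma>\<close>, because \<open>u\<close> is a unit: it divides its norm \<open>y\<close>, which is invertible as \<open>h(0) \<noteq> 0\<close>. So it is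
  everything.
\<close>

lemma twisted_module_simple:
  assumes h: "irreducible h" "coeff h 0 \<noteq> 0" and u: "E h dvd poly_norm u - [:0, 1:]"
    and v: "\<not> E h dvd v"
  shows "\<exists>r. E h dvd 1 - act u r v"
proof -
  let ?H = "E h"
  obtain a where a: "?H dvd 1 - a * [:0, 1:]" using y_unit_mod[OF h(2)] by blast
  note act_y = act_at_tn[OF u]
  let ?I = "{x. \<exists>r. ?H dvd x - act u r v}"
  have mult_I: "s * x \<in> ?I" if "x \<in> ?I" for s x
  proof -
    obtain r where r: "?H dvd x - act u r v" using \<open>x \<in> ?I\<close> by blast
    have "?H dvd act u (at_tn s) (x - act u r v) - (act u (at_tn s) x - s * x)"
      using act_dvd[OF r] act_y[of s x] by (rule dvd_diff)
    then have "?H dvd s * x - act u (at_tn s \<star> r) v" by (simp add: act_diff_right act_mult)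
    then show ?thesis by blast
  qed
  have add_I: "x + x' \<in> ?I" if "x \<in> ?I" "x' \<in> ?I" for x x'
  proof -
    obtain r r' where "?H dvd x - act u r v" "?H dvd x' - act u r' v" using \<open>x \<in> ?I\<close> \<open>x' \<in> ?I\<close> by blast
    then have "?H dvd (x - act u r v) + (x' - act u r' v)" by (rule dvd_add)
    then have "?H dvd x + x' - act u (r + r') v" by (simp add: act_add algebra_simps)
    then show ?thesis by blast
  qed
  have dvd_I: "x \<in> ?I" if "?H dvd x" for x using that by (auto simp: act_0 intro!: exI[of _ 0])
  have ideal: "poly_ideal ?I" unfolding poly_ideal_def using mult_I add_I dvd_I[of 0] by blast
  have "S x \<in> ?I" if x: "x \<in> ?I" for x
  proof -
    obtain r where "?H dvd x - act u r v" using x by blast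
    then have "?H dvd twist u (x - act u r v)" by (rule twist_dvd)
    then have "?H dvd twist u x - act u (monom 1 1 \<star> r) v"
      using act_monom[of u 1] by (simp add: twist_diff act_mult)
    then have uS: "u * S x \<in> ?I" unfolding twist_def[symmetric] by blast
    obtain m where m: "n = Suc m" using n_pos by (cases n) auto
    define u' where "u' = S (\<Prod>i<m. (S ^^ i) u)"
    have u': "u * u' = poly_norm u" unfolding u'_def S_partial_norm poly_norm_def by (simp only: m)
    have e: "S x = (a * u') * (u * S x) + ((1 - a * [:0, 1:]) * S x - a * (poly_norm u - [:0, 1:]) * S x)"
      unfolding u'[symmetric] by (simp only: algebra_simps mult_1_left)
    have d: "?H dvd (1 - a * [:0, 1:]) * S x - a * (poly_norm u - [:0, 1:]) * S x"
      using dvd_mult2[OF a, of "S x"] dvd_mult2[OF dvd_mult[OF u, of a], of "S x"] by (rule dvd_diff)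
    show ?thesis
      using add_I[OF mult_I[OF uS, of "a * u'"] dvd_I[OF d]] unfolding e[symmetric] .
  qed
  moreover have "?H dvd v - act u 1 v" by (simp add: act_1)
  then have "v \<in> ?I" by blast
  moreover have "?H \<in> ?I" by (rule dvd_I) simp
  ultimately have "1 \<in> ?I" using S_stable_ideal[OF ideal _ h(1), of v] v by blast
  then show ?thesis by blast
qed

text \<open>
  Let \<open>w\<close> generate the annihilator of \<open>1\<close> in the module \<open>L[y]/(h)\<close>. The module is generated by \<open>1\<close>, so it
  is isomorphic to \<open>R/Rw\<close>; counting elements gives the degree of \<open>w\<close>, and simplicity of the module
  gives irreducibility.
\<close>

lemma skew_irreducible_factor_exists:
  assumes h: "irreducible h" "coeff h 0 \<noteq> 0"
  shows "\<exists>w. skew_irreducible \<sigma> w \<and> degree w = degree h \<and> right_dvd w (at_tn (E h))"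
proof -
  let ?H = "E h"
  have H0: "?H \<noteq> 0" using h(1) by (auto simp: E_eq_0_iff)
  obtain a where a: "?H dvd 1 - a * [:0, 1:]" using y_unit_mod[OF h(2)] by blast
  have y: "E [:0, 1:] = [:0, 1:]"
    by (simp add: map_poly_pCons morphism_0[OF \<iota>] morphism_1[OF \<iota>])
  obtain u where u: "?H dvd poly_norm u - [:0, 1:]"
    using norm_surjective_mod[OF h(1), of a "[:0, 1:]"] a by (auto simp: y)
  note act_y = act_at_tn[OF u]
  let ?A = "{r. ?H dvd act u r 1}"
  have A: "left_ideal ?A"
    unfolding left_ideal_def by (auto simp: act_0 act_add act_mult act_dvd)
  have HA: "at_tn ?H \<in> ?A"
    using dvd_add[OF act_y[of ?H 1], of ?H] by simp
  obtain w where w: "w \<in> ?A" "lead_coeff w = 1" "\<And>b. b \<in> ?A \<Longrightarrow> right_dvd w b"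
    using left_ideal_generator[OF A HA] at_tn_eq_0_iff H0 by metis
  have w0: "w \<noteq> 0" using w(2) by auto
  have in_A: "r \<in> ?A" if "right_dvd w r" for r
    using that left_idealD(3)[OF A w(1)] by (auto simp: right_dvd_def)
  let ?W = "{r::'a poly. r = 0 \<or> degree r < degree w}"
  let ?V = "{v::'a poly. v = 0 \<or> degree v < degree h}"
  let ?\<phi> = "\<lambda>r. act u r 1 mod ?H"
  have "inj_on ?\<phi> ?W"
  proof (rule inj_onI)
    fix r r' assume r: "r \<in> ?W" "r' \<in> ?W" "?\<phi> r = ?\<phi> r'"
    then have "?H dvd act u (r - r') 1" by (simp add: mod_eq_dvd_iff act_diff)
    then have "right_dvd w (r - r')" using w(3) by blast
    then show "r = r'" using small_right_dvd[of w r r'] r(1,2) w0 by blast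
  qed
  moreover have "?\<phi> ` ?W = ?V"
  proof
    show "?\<phi> ` ?W \<subseteq> ?V" using degree_mod_less[OF H0] by (auto simp: degree_E)
    show "?V \<subseteq> ?\<phi> ` ?W"
    proof
      fix v assume v: "v \<in> ?V"
      let ?r = "skew_mod \<sigma> (at_tn v) w"
      have "?H dvd act u (at_tn v - ?r) 1" using in_A[OF right_dvd_minus_mod[OF w0]] by blast
      then have "act u (at_tn v) 1 mod ?H = ?\<phi> ?r" by (simp add: act_diff mod_eq_dvd_iff)
      moreover have "act u (at_tn v) 1 mod ?H = v mod ?H" using act_y[of v 1] by (simp add: mod_eq_dvd_iff)
      moreover have "v mod ?H = v" using v by (auto intro: mod_poly_less simp: degree_E)
      ultimately have "v = ?\<phi> ?r" by simp
      moreover have "?r \<in> ?W" using mod_degree[OF w0] by blast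
      ultimately show "v \<in> ?\<phi> ` ?W" by (rule image_eqI)
    qed
  qed
  ultimately have "card ?W = card ?V" using card_image[of ?\<phi> ?W] by simp
  then have deg: "degree w = degree h" using card_gt_1(1) by (simp add: card_degree_less)
  have "skew_irreducible \<sigma> w"
    unfolding skew_irreducible_def
  proof (intro conjI notI)
    show "degree w > 0" using deg degree_irreducible[OF h(1)] by simp
    assume "\<exists>a b. degree a < degree w \<and> degree b < degree w \<and> w = a \<star> b"
    then obtain k b where kb: "degree k < degree w" "degree b < degree w" "w = k \<star> b" by blast
    have nz: "k \<noteq> 0" "b \<noteq> 0" using kb(3) w0 zero_left zero_right by metis+
    then have db: "degree b > 0" using degree_mult[of k b] kb by simp
    define v where "v = act u b 1"
    have v: "\<not> ?H dvd v"
    proof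
      assume "?H dvd v"
      then have "right_dvd w b" using w(3) by (simp add: v_def)
      then show False using right_dvd_degree[OF _ nz(2)] kb(2) by fastforce
    qed
    obtain r where "?H dvd 1 - act u r v" using twisted_module_simple[OF h u v] by blast
    then have "1 - r \<star> b \<in> ?A" by (simp add: act_diff act_1 act_mult v_def)
    then have "right_dvd w (1 - r \<star> b)" using w(3) by blast
    moreover have "right_dvd b w" using kb(3) by (auto simp: right_dvd_def)
    ultimately have "right_dvd b (1 - r \<star> b)" using right_dvd_trans by blast
    then have "right_dvd b (1 - r \<star> b + r \<star> b)" 
      by (intro right_dvd_add right_dvd_mult right_dvd_refl)
    then show False using right_dvd_degree[of b 1] db by simp
  qed
  then show ?thesis using deg w(3)[OF HA] by blast
qed

text \<open>
  If \<open>f\<close> had a nonzero constant term and \<open>t\<^sup>n = u f\<close>, the lowest term of \<open>u\<close> would already have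
  degree \<open>n\<close>, leaving no room for the degree of \<open>f\<close>. So \<open>f\<close> is a left multiple of \<open>t\<close>.
\<close>

lemma degree_1_if_dvd_power_of_t:
  assumes f: "skew_irreducible \<sigma> f" and dvd: "right_dvd f (monom 1 n)"
  shows "degree f = 1"
proof -
  obtain u where u: "monom 1 n = u \<star> f" using dvd by (auto simp: right_dvd_def)
  have "coeff f 0 = 0"
  proof (rule ccontr)
    assume f0: "coeff f 0 \<noteq> 0"
    have z: "coeff u k = 0" if "k < n" for k
      using that
    proof (induction k rule: less_induct)
      case (less k)
      have "0 = coeff (u \<star> f) k" using less.prems by (simp flip: u)
      also have "\<dots> = (\<Sum>i\<in>{k}. coeff u i * (\<sigma> ^^ i) (coeff f (k - i)))"
        unfolding coeff_skew_mult[OF \<sigma>] using less by (intro sum.mono_neutral_right) auto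
      finally show ?case using f0 by (simp add: field_aut_eq_0_iff[OF field_aut_funpow[OF \<sigma>]])
    qed
    have nz: "u \<noteq> 0" "f \<noteq> 0" using u zero_left zero_right by (metis monom_eq_0_iff zero_neq_one)+
    then have "n \<le> degree u" using z leading_coeff_0_iff not_le_imp_less by blast
    moreover have "n = degree u + degree f"
      using degree_mult[OF nz] by (simp add: degree_monom_eq flip: u)
    ultimately show False using irreducible_degree[OF f] by simp
  qed
  then obtain f' where f': "f = pCons 0 f'" by (metis coeff_pCons_0 pCons_cases)
  then have "f = f' \<star> monom 1 1" by (simp only: mult_t)
  moreover have "degree f = Suc (degree f')" using f' irreducible_nonzero[OF f] by auto
  ultimately show ?thesis
    using f unfolding skew_irreducible_def
    by (metis degree_monom_eq lessI nat_neq_iff less_one not_less_eq zero_neq_one)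
qed

text \<open>
  When \<open>h(0) \<noteq> 0\<close>, all irreducible right divisors of \<open>h(t\<^sup>n)\<close> are similar, hence have the degree of the
  one constructed from the module \<open>L[y]/(h)\<close>. Otherwise \<open>h(t\<^sup>n) = t\<^sup>n\<close>.
\<close>

lemma monic_irreducible_multiple:
  assumes f: "skew_irreducible \<sigma> f"
  shows "\<exists>h\<in>monic_irreducibles (degree f). right_dvd f (at_tn (E h))"
proof -
  obtain h where h: "irreducible h" "lead_coeff h = 1" "right_dvd f (at_tn (E h))"
    using irreducible_dvd_central[OF f] by blast
  have "degree h = degree f"
  proof (cases "coeff h 0 = 0")
    case False
    obtain w where w: "skew_irreducible \<sigma> w" "degree w = degree h" "right_dvd w (at_tn (E h))"
      using skew_irreducible_factor_exists[OF h(1) False] by blast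
    have "similar f w" "similar w f"
      using similar_if_common_central_multiple f w h False by blast+
    then show ?thesis using similar_degree_le f w by (metis antisym)
  next
    case True
    then have "degree h = 1" by (rule irreducible_coeff_0_eq_0[OF h(1)])
    then have "h = [:0, 1:]"
      using True h(2) by (intro poly_eqI) (auto simp: coeff_pCons coeff_eq_0 split: nat.split)
    then have "at_tn (E h) = monom 1 n"
      by (simp add: at_tn_def map_poly_pCons morphism_0[OF \<iota>] morphism_1[OF \<iota>] pcompose_pCons)
    then show ?thesis using degree_1_if_dvd_power_of_t[OF f] h(3) \<open>h = [:0, 1:]\<close> by simp
  qed
  then have "h \<in> monic_irreducibles (degree f)" using h by (simp add: monic_irreducibles_def)
  then show ?thesis using h(3) by blast
qed

end

context cyclic_extension
begin

section \<open>Automorphisms of the skew polynomial ring\<close>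

text \<open>The coefficient of \<open>t\<^sup>i\<close> in \<open>(\<alpha> t)\<^sup>i\<close>.\<close>

definition partial_norm :: "'a \<Rightarrow> nat \<Rightarrow> 'a" where
  "partial_norm \<alpha> i = (\<Prod>j<i. (\<sigma> ^^ j) \<alpha>)"

lemma partial_norm_add: "partial_norm \<alpha> (i + m) = partial_norm \<alpha> i * (\<sigma> ^^ i) (partial_norm \<alpha> m)"
proof (induction m)
  case 0
  then show ?case by (simp add: partial_norm_def field_aut_1[OF field_aut_funpow[OF \<sigma>]])
next
  case (Suc m)
  then show ?case
    by (simp add: partial_norm_def field_aut_mult[OF field_aut_funpow[OF \<sigma>]] funpow_add mult.assoc)
qed

lemma partial_norm_nonzero: "\<alpha> \<noteq> 0 \<Longrightarrow> partial_norm \<alpha> i \<noteq> 0"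
  by (simp add: partial_norm_def field_aut_eq_0_iff[OF field_aut_funpow[OF \<sigma>]])

lemma partial_norm_period:
  assumes "partial_norm \<alpha> n = \<iota> c"
  shows "partial_norm \<alpha> (k * n) = \<iota> c ^ k"
proof (induction k)
  case 0
  then show ?case by (simp add: partial_norm_def)
next
  case (Suc k)
  have "partial_norm \<alpha> (Suc k * n) = partial_norm \<alpha> (n + k * n)" by (simp add: add.commute)
  also have "\<dots> = \<iota> c * \<iota> c ^ k" by (simp add: partial_norm_add \<sigma>_order assms Suc.IH)
  finally show ?case by simp
qed

text \<open>
  Apply \<open>\<phi>\<close> to the coefficients and substitute \<open>\<alpha> t\<close> for \<open>t\<close>. This respects \<open>t a = \<sigma>(a) t\<close> as soon as \<open>\<phi>\<close>
  commutes with \<open>\<sigma>\<close>.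
\<close>

definition skew_subst :: "('a \<Rightarrow> 'a) \<Rightarrow> 'a \<Rightarrow> 'a poly \<Rightarrow> 'a poly" where
  "skew_subst \<phi> \<alpha> a = (\<Sum>i\<le>degree a. monom (\<phi> (coeff a i) * partial_norm \<alpha> i) i)"

context
  fixes \<phi> :: "'a \<Rightarrow> 'a" and \<alpha> :: 'a
  assumes \<phi>: "field_aut \<phi>" and comm: "\<And>x. \<phi> (\<sigma> x) = \<sigma> (\<phi> x)" and \<alpha>: "\<alpha> \<noteq> 0"
begin

abbreviation \<Phi> :: "'a poly \<Rightarrow> 'a poly" where "\<Phi> \<equiv> skew_subst \<phi> \<alpha>"

lemma coeff_skew_subst: "coeff (\<Phi> a) k = \<phi> (coeff a k) * partial_norm \<alpha> k"
  by (simp add: skew_subst_def coeff_sum field_aut_0[OF \<phi>] coeff_eq_0)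

lemma skew_subst_add: "\<Phi> (a + b) = \<Phi> a + \<Phi> b"
  by (intro poly_eqI) (simp add: coeff_skew_subst field_aut_add[OF \<phi>] algebra_simps)

lemma skew_subst_0: "\<Phi> 0 = 0"
  by (intro poly_eqI) (simp add: coeff_skew_subst field_aut_0[OF \<phi>])

lemma skew_subst_diff: "\<Phi> (a - b) = \<Phi> a - \<Phi> b"
  using skew_subst_add[of "a - b" b] by simp

lemma skew_subst_mult: "\<Phi> (a \<star> b) = \<Phi> a \<star> \<Phi> b"
proof (rule poly_eqI)
  fix k
  have c: "\<phi> ((\<sigma> ^^ i) x) = (\<sigma> ^^ i) (\<phi> x)" for i x by (induction i) (simp_all add: comm)
  have p: "partial_norm \<alpha> k = partial_norm \<alpha> i * (\<sigma> ^^ i) (partial_norm \<alpha> (k - i))" if "i \<le> k" for i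
    using partial_norm_add[of \<alpha> i "k - i"] that by simp
  have "coeff (\<Phi> (a \<star> b)) k =
      (\<Sum>i\<le>k. \<phi> (coeff a i) * (\<sigma> ^^ i) (\<phi> (coeff b (k - i))) * partial_norm \<alpha> k)"
    by (simp add: coeff_skew_subst coeff_skew_mult[OF \<sigma>] field_aut_sum[OF \<phi>] field_aut_mult[OF \<phi>]
        c sum_distrib_right)
  also have "\<dots> = coeff (\<Phi> a \<star> \<Phi> b) k"
    unfolding coeff_skew_mult[OF \<sigma>]
    by (intro sum.cong refl)
      (simp add: coeff_skew_subst field_aut_mult[OF field_aut_funpow[OF \<sigma>]] p algebra_simps)
  finally show "coeff (\<Phi> (a \<star> b)) k = coeff (\<Phi> a \<star> \<Phi> b) k" .
qed

lemma coeff_skew_subst_eq_0_iff: "coeff (\<Phi> a) k = 0 \<longleftrightarrow> coeff a k = 0"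
  by (simp add: coeff_skew_subst partial_norm_nonzero[OF \<alpha>] field_aut_eq_0_iff[OF \<phi>])

lemma degree_skew_subst: "degree (\<Phi> a) = degree a"
  by (simp add: degree_def coeff_skew_subst_eq_0_iff)

lemma skew_subst_eq_0_iff: "\<Phi> a = 0 \<longleftrightarrow> a = 0"
  by (simp add: poly_eq_iff coeff_skew_subst_eq_0_iff)

lemma skew_subst_inj: "inj \<Phi>"
  by (rule injI) (metis skew_subst_diff skew_subst_eq_0_iff right_minus_eq)

lemma skew_subst_image: "\<Phi> ` {a. a = 0 \<or> degree a < m} = {a. a = 0 \<or> degree a < m}"
  using skew_subst_inj
  by (intro endo_inj_surj finite_degree_less)
    (auto simp: degree_skew_subst skew_subst_0 intro: inj_on_subset)

lemma skew_subst_right_dvd: "right_dvd f a \<Longrightarrow> right_dvd (\<Phi> f) (\<Phi> a)"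
  by (auto simp: right_dvd_def skew_subst_mult)

lemma skew_subst_irreducible:
  assumes f: "skew_irreducible \<sigma> f" shows "skew_irreducible \<sigma> (\<Phi> f)"
  unfolding skew_irreducible_def
proof (intro conjI notI)
  show "degree (\<Phi> f) > 0" using irreducible_degree[OF f] by (simp add: degree_skew_subst)
  assume "\<exists>a b. degree a < degree (\<Phi> f) \<and> degree b < degree (\<Phi> f) \<and> \<Phi> f = a \<star> b"
  then obtain a b where ab: "degree a < degree f" "degree b < degree f" "\<Phi> f = a \<star> b"
    by (auto simp: degree_skew_subst)
  then have "a \<in> \<Phi> ` {a. a = 0 \<or> degree a < degree f}" "b \<in> \<Phi> ` {a. a = 0 \<or> degree a < degree f}"
    unfolding skew_subst_image by simp_all
  then obtain a' b' where a'b': "a = \<Phi> a'" "b = \<Phi> b'" by blast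
  then have "f = a' \<star> b'" using ab(3) injD[OF skew_subst_inj] by (simp add: skew_subst_mult)
  moreover have "degree a' < degree f" "degree b' < degree f"
    using ab(1,2) by (simp_all add: a'b' degree_skew_subst)
  ultimately show False using f unfolding skew_irreducible_def by blast
qed

lemma isotopic_skew_subst:
  assumes f: "f \<noteq> 0"
  shows "isotopic (skew_semifield \<sigma> f) (skew_semifield \<sigma> (\<Phi> f))"
proof -
  have f': "\<Phi> f \<noteq> 0" using f by (simp add: skew_subst_eq_0_iff)
  have b: "additive_bij (skew_semifield \<sigma> f) (skew_semifield \<sigma> (\<Phi> f)) \<Phi>"
    using skew_subst_image[of "degree f"] inj_on_subset[OF skew_subst_inj]
    by (simp add: additive_bij_def skew_semifield_def bij_betw_def degree_skew_subst skew_subst_add)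
  have "skew_mod \<sigma> (\<Phi> a) (\<Phi> f) = \<Phi> (skew_mod \<sigma> a f)" for a
  proof (rule mod_eqI[OF f'])
    show "\<Phi> (skew_mod \<sigma> a f) = 0 \<or> degree (\<Phi> (skew_mod \<sigma> a f)) < degree (\<Phi> f)"
      using mod_degree[OF f, of a] by (simp add: degree_skew_subst skew_subst_eq_0_iff)
    show "right_dvd (\<Phi> f) (\<Phi> a - \<Phi> (skew_mod \<sigma> a f))"
      using skew_subst_right_dvd[OF right_dvd_minus_mod[OF f]] by (simp add: skew_subst_diff)
  qed
  then have "\<forall>x\<in>carrier (skew_semifield \<sigma> f). \<forall>y\<in>carrier (skew_semifield \<sigma> f).
      \<Phi> x \<otimes>\<^bsub>skew_semifield \<sigma> (\<Phi> f)\<^esub> \<Phi> y = \<Phi> (x \<otimes>\<^bsub>skew_semifield \<sigma> f\<^esub> y)"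
    by (simp add: skew_semifield_def skew_subst_mult[symmetric])
  then show ?thesis unfolding isotopic_def using b by (intro exI[of _ \<Phi>] conjI)
qed

text \<open>
  The substitution sends \<open>t\<^sup>n\<close> to \<open>N(\<alpha>) t\<^sup>n = c t\<^sup>n\<close>; the factor \<open>c\<^sup>d\<close> undoes the normalisation that keeps the
  action of \<open>\<Gamma>L(1,q)\<close> among monic polynomials.
\<close>

lemma skew_subst_central:
  assumes N: "partial_norm \<alpha> n = \<iota> c" and \<rho>: "field_aut \<rho>" "\<And>x. \<phi> (\<iota> x) = \<iota> (\<rho> x)"
    and c: "c \<noteq> 0" and h: "h \<in> monic_irreducibles d"
  shows "\<Phi> (at_tn (E h)) = at_tn (E (smult (c ^ d) (GammaL1_act d (c, \<rho>) h)))"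
proof (rule poly_eqI)
  fix k
  show "coeff (\<Phi> (at_tn (E h))) k = coeff (at_tn (E (smult (c ^ d) (GammaL1_act d (c, \<rho>) h)))) k"
  proof (cases "n dvd k")
    case True
    then obtain i where i: "k = i * n" by (metis dvdE mult.commute)
    have "coeff (smult (c ^ d) (GammaL1_act d (c, \<rho>) h)) i = \<rho> (coeff h i) * c ^ i"
      using c by (simp add: coeff_GammaL1_act[OF h \<rho>(1)] mult.commute)
    then show ?thesis
      using n_pos partial_norm_period[OF N, of i]
      by (simp add: i coeff_skew_subst coeff_at_tn coeff_E \<rho>(2) morphism_mult[OF \<iota>]
          morphism_power[OF \<iota>] del: coeff_smult)
  qed (simp add: coeff_skew_subst coeff_at_tn field_aut_0[OF \<phi>])
qed

end

section \<open>Isotopism classes and orbits\<close>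

lemma CHAR_eq: "CHAR('a) = CHAR('b)"
proof -
  have n: "\<iota> (of_nat k) = of_nat k" for k
    by (induction k) (simp_all add: morphism_0[OF \<iota>] morphism_add[OF \<iota>] morphism_1[OF \<iota>])
  have "(of_nat k :: 'b) = 0 \<longleftrightarrow> (of_nat k :: 'a) = 0" for k
    using \<iota>_eq_0_iff[of "of_nat k"] by (simp add: n)
  then have "CHAR('b) dvd k \<longleftrightarrow> CHAR('a) dvd k" for k
    unfolding of_nat_eq_0_iff_char_dvd .
  then show ?thesis by (metis dvd_antisym dvd_refl)
qed

text \<open>
  The elements of degree \<open>0\<close> multiply as in \<open>L\<close>, so no reduction takes place. This covers \<open>h = y\<close>,
  where the argument by similarity does not apply.
\<close>

lemma isotopic_degree_1:
  assumes f: "degree f = 1" and g: "degree g = 1"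
  shows "isotopic (skew_semifield \<sigma> f) (skew_semifield \<sigma> g)"
proof -
  have small: "skew_mod \<sigma> (a \<star> b) p = a \<star> b" if "degree a = 0" "degree b = 0" "degree p = 1" for a b p
    using that skew_mult_degree_le[OF \<sigma>, of a b] by (intro mod_small) auto
  have "additive_bij (skew_semifield \<sigma> f) (skew_semifield \<sigma> g) (\<lambda>x. x)"
    using f g by (simp add: additive_bij_def skew_semifield_def bij_betw_def)
  moreover have "\<forall>x\<in>carrier (skew_semifield \<sigma> f). \<forall>y\<in>carrier (skew_semifield \<sigma> f).
      x \<otimes>\<^bsub>skew_semifield \<sigma> g\<^esub> y = x \<otimes>\<^bsub>skew_semifield \<sigma> f\<^esub> y"
    using f g by (auto simp: skew_semifield_def small)
  ultimately show ?thesis unfolding isotopic_def by (intro exI[of _ "\<lambda>x. x"] conjI)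
qed

lemma isotopic_if_same_central_multiple:
  assumes f: "skew_irreducible \<sigma> f" "degree f = d" "right_dvd f (at_tn (E h))"
    and g: "skew_irreducible \<sigma> g" "degree g = d" "right_dvd g (at_tn (E h))"
    and h: "h \<in> monic_irreducibles d"
  shows "isotopic (skew_semifield \<sigma> f) (skew_semifield \<sigma> g)"
proof (cases "coeff h 0 = 0")
  case False
  have "irreducible h" using h by (simp add: monic_irreducibles_def)
  then have "similar g f"
    using similar_if_common_central_multiple[OF g(1) f(1) _ False g(3) f(3)] by simp
  then show ?thesis using isotopic_if_similar[OF g(1) f(1)] f(2) g(2) by simp
next
  case True
  have "irreducible h" using h by (simp add: monic_irreducibles_def)
  then have "degree h = 1" using True by (rule irreducible_coeff_0_eq_0)
  then have "d = 1" using h by (simp add: monic_irreducibles_def)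
  then show ?thesis using isotopic_degree_1 f(2) g(2) by simp
qed

text \<open>
  The substitution realising \<open>(c, \<rho>)\<close> carries \<open>f\<close> to a divisor of the same central element as \<open>g\<close>.
\<close>

lemma isotopic_if_same_orbit:
  assumes f: "skew_irreducible \<sigma> f" "degree f = d" "right_dvd f (at_tn (E h))"
    and g: "skew_irreducible \<sigma> g" "degree g = d" "right_dvd g (at_tn (E (GammaL1_act d (c, \<rho>) h)))"
    and h: "h \<in> monic_irreducibles d" and c: "c \<noteq> 0" and \<rho>: "field_aut \<rho>"
  shows "isotopic (skew_semifield \<sigma> f) (skew_semifield \<sigma> g)"
proof -
  obtain j where j: "\<And>x. \<rho> x = x ^ (CHAR('b) ^ j)" using field_aut_is_frobenius_power[OF \<rho>] by blast
  define \<phi> where "\<phi> = (\<lambda>x::'a. x ^ (CHAR('a) ^ j))"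
  have \<phi>: "field_aut \<phi>" unfolding \<phi>_def by (rule frobenius_field_aut)
  have comm: "\<phi> (\<sigma> x) = \<sigma> (\<phi> x)" for x by (simp add: \<phi>_def field_aut_power[OF \<sigma>])
  have \<phi>\<iota>: "\<phi> (\<iota> x) = \<iota> (\<rho> x)" for x by (simp add: \<phi>_def j morphism_power[OF \<iota>] CHAR_eq)
  obtain \<alpha> where \<alpha>: "partial_norm \<alpha> n = \<iota> c"
    using field_norm_surjective[OF c] by (auto simp: partial_norm_def)
  have \<alpha>0: "\<alpha> \<noteq> 0"
  proof
    assume "\<alpha> = 0"
    then have "partial_norm \<alpha> n = 0"
      using n_pos by (simp add: partial_norm_def field_aut_0[OF field_aut_funpow[OF \<sigma>]] zero_power)
    then show False using \<alpha> c by (simp add: \<iota>_eq_0_iff)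
  qed
  let ?f = "skew_subst \<phi> \<alpha> f" and ?h = "GammaL1_act d (c, \<rho>) h"
  have "right_dvd ?f (at_tn (E (smult (c ^ d) ?h)))"
    using skew_subst_right_dvd[OF \<phi> comm \<alpha>0 f(3)]
    unfolding skew_subst_central[OF \<phi> comm \<alpha>0 \<alpha> \<rho> \<phi>\<iota> c h] .
  then have "right_dvd ?f (at_tn (E (smult (c ^ d) ?h * [:inverse (c ^ d):])))"
    by (rule right_dvd_E_mult)
  then have "right_dvd ?f (at_tn (E ?h))" using c by simp
  then have "isotopic (skew_semifield \<sigma> ?f) (skew_semifield \<sigma> g)"
    using f g GammaL1_act_closed[OF h c \<rho>] skew_subst_irreducible[OF \<phi> comm \<alpha>0]
      degree_skew_subst[OF \<phi> comm \<alpha>0]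
    by (intro isotopic_if_same_central_multiple[of ?f d ?h g]) simp_all
  then show ?thesis
    using isotopic_skew_subst[OF \<phi> comm \<alpha>0 irreducible_nonzero[OF f(1)]] isotopic_trans by blast
qed

lemma card_isotopism_classes_le:
  "card (isotopism_classes (skew_semifields \<sigma> d)) \<le>
    card (orbits (GammaL1 :: ('b \<times> ('b \<Rightarrow> 'b)) monoid) (monic_irreducibles d) (GammaL1_act d))"
proof -
  let ?S = "skew_semifields \<sigma> d"
  let ?R = "{(S, T). S \<in> ?S \<and> T \<in> ?S \<and> isotopic S T}"
  let ?orb = "orbit (GammaL1 :: ('b \<times> ('b \<Rightarrow> 'b)) monoid) (GammaL1_act d)"
  note eq = equiv_isotopic[OF \<sigma>, of d]
  interpret act: group_action "GammaL1 :: ('b \<times> ('b \<Rightarrow> 'b)) monoid" "monic_irreducibles d" "GammaL1_act d"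
    by (rule group_action_GammaL1)
  \<comment> \<open>In every class choose a representative \<open>f\<close> together with its polynomial \<open>h\<close>.\<close>
  define represents where "represents f h C \<longleftrightarrow> skew_irreducible \<sigma> f \<and> degree f = d \<and>
    skew_semifield \<sigma> f \<in> C \<and> h \<in> monic_irreducibles d \<and> right_dvd f (at_tn (E h))" for f h C
  have ex: "\<exists>f h. represents f h C" if C: "C \<in> ?S // ?R" for C
  proof -
    obtain T where T: "T \<in> C" using in_quotient_imp_non_empty[OF eq C] by blast
    then have "T \<in> ?S" using in_quotient_imp_subset[OF eq C] by blast
    then obtain f where f: "skew_irreducible \<sigma> f" "degree f = d" "T = skew_semifield \<sigma> f"
      by (auto simp: skew_semifields_def)
    then obtain h where "h \<in> monic_irreducibles d" "right_dvd f (at_tn (E h))"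
      using monic_irreducible_multiple[of f] by blast
    then have "represents f h C" using f T by (simp add: represents_def)
    then show ?thesis by blast
  qed
  define f where "f C = (SOME f. \<exists>h. represents f h C)" for C
  define h where "h C = (SOME h. represents (f C) h C)" for C
  have rep: "represents (f C) (h C) C" if C: "C \<in> ?S // ?R" for C
    unfolding h_def using someI_ex[OF ex[OF C]] unfolding f_def by (rule someI_ex)
  have f: "skew_irreducible \<sigma> (f C)" "degree (f C) = d" "skew_semifield \<sigma> (f C) \<in> C"
    and h: "h C \<in> monic_irreducibles d" "right_dvd (f C) (at_tn (E (h C)))" if "C \<in> ?S // ?R" for C
    using rep[OF that] by (simp_all add: represents_def)
  have "inj_on (\<lambda>C. ?orb (h C)) (?S // ?R)"
  proof (rule inj_onI)
    fix C D assume C: "C \<in> ?S // ?R" and D: "D \<in> ?S // ?R" and o: "?orb (h C) = ?orb (h D)"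
    have "h D \<in> ?orb (h C)" unfolding o by (rule act.orbit_refl[OF h(1)[OF D]])
    then obtain c \<rho> where c\<rho>: "c \<noteq> 0" "field_aut \<rho>" "h D = GammaL1_act d (c, \<rho>) (h C)"
      by (auto simp: orbit_def GammaL1_def)
    have "isotopic (skew_semifield \<sigma> (f C)) (skew_semifield \<sigma> (f D))"
      using isotopic_if_same_orbit[OF f(1,2)[OF C] h(2)[OF C] f(1,2)[OF D] _ h(1)[OF C] c\<rho>(1,2)]
        h(2)[OF D] c\<rho>(3) by simp
    then have "(skew_semifield \<sigma> (f C), skew_semifield \<sigma> (f D)) \<in> ?R"
      using f(1,2)[OF C] f(1,2)[OF D] by (simp add: skew_semifields_def)
    then show "C = D" using quotient_eq_iff[OF eq C D f(3)[OF C] f(3)[OF D]] by simp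
  qed
  moreover have "(\<lambda>C. ?orb (h C)) ` (?S // ?R) \<subseteq> orbits GammaL1 (monic_irreducibles d) (GammaL1_act d)"
    using h(1) unfolding orbits_def by blast
  moreover have "finite (orbits (GammaL1 :: ('b \<times> ('b \<Rightarrow> 'b)) monoid) (monic_irreducibles d) (GammaL1_act d))"
    unfolding orbits_def setcompr_eq_image Collect_mem_eq by (intro finite_imageI finite_monic_irreducibles)
  ultimately show ?thesis unfolding isotopism_classes_def by (rule card_inj_on_le)
qed

end

theorem theorem2:
  fixes q n d :: nat
    and \<sigma> :: "'a::{field,finite} \<Rightarrow> 'a"
  assumes "primepow q" and "n \<ge> 1" and "d \<ge> 1"
    and "CARD('a) = q ^ n" and "CARD('b::{field,finite}) = q"
    and "field_aut \<sigma>" and "card (fixed_field \<sigma>) = q"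
  shows "card (isotopism_classes (skew_semifields \<sigma> d)) \<le>
    card (orbits (GammaL1 :: ('b \<times> ('b \<Rightarrow> 'b)) monoid) (monic_irreducibles d) (GammaL1_act d))"
proof -
  obtain p k where p: "prime p" "q = p ^ k" using assms(1) by (auto simp: primepow_def)
  have "CHAR('a) = p" using CHAR_eq_if_CARD_power[of p "k * n"] p assms(4) by (simp add: power_mult)
  moreover have "CHAR('b) = p" using CHAR_eq_if_CARD_power[of p k] p assms(5) by simp
  moreover have "0 \<in> fixed_field \<sigma>" "1 \<in> fixed_field \<sigma>"
    "\<And>x y. x \<in> fixed_field \<sigma> \<Longrightarrow> y \<in> fixed_field \<sigma> \<Longrightarrow> x * y \<in> fixed_field \<sigma>"
    using assms(6) by (simp_all add: fixed_field_def field_aut_0 field_aut_1 field_aut_mult)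
  ultimately obtain \<iota> :: "'b \<Rightarrow> 'a" where "ring_morphism \<iota>" "range \<iota> = fixed_field \<sigma>"
    using finite_field_embedding[where 'b='b, of "fixed_field \<sigma>"] assms(5,7) by auto
  then interpret cyclic_extension \<sigma> \<iota> n
    using assms by unfold_locales auto
  show ?thesis by (rule card_isotopism_classes_le)
qed

end
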